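(* Let $S=\{p,p^2: p \text{ is a safe prime}\}\cup\{3^k:k\in\mathbb{N}\}$, let $T$ be the set of all powers of odd primes, and let $R=T\setminus S$. For a positive integer $n$, let ${\rm ACG}(n)$ be the set of circulant graphs of order $n$, ${\rm Small}(n)$ the set of $\Gamma\in{\rm ACG}(n)$ with ${\rm Aut}(\Gamma)=\langle\rho,\iota\rangle$ (where $\rho(i)=i+1$, $\iota(i)=-i$), and ${\rm NonNorG}(n)$ the set of non-normal circulant graphs of order $n$. Then $$\lim_{n\in R,\ n\to\infty}\frac{\vert{\rm NonNorG}(n)\vert}{\vert{\rm ACG}(n)\setminus{\rm Small}(n)\vert}=0.$$ Additionally, if $n\in S$, then more than one fifth of all elements of ${\rm ACG}(n)\setminus{\rm Small}(n)$ are in ${\rm NonNorG}(n)$.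
   Context: A safe prime is a prime $p=2q+1$ with $q$ also prime. A circulant graph of order $n$ is the graph $\Gamma(\mathbb{Z}_n,S)$ with vertex set $\mathbb{Z}_n$, arcs $\{(u,v):u-v\in S\}$, where $S\subseteq\mathbb{Z}_n\setminus\{0\}$ and $S=-S$; circulant graphs are counted as labelled objects (by connection set). A circulant graph $\Gamma$ is normal if $\langle\rho\rangle\trianglelefteq{\rm Aut}(\Gamma)$.
   Formalization: In the second claim n = 3 is excluded from S: both circulant graphs of order 3 have automorphism group ⟨ρ,ι⟩, so ACG(3)∖Small(3) is empty and "more than one fifth of its elements" fails; powers 3^k are taken with k ≥ 1. *)

theory Defs
  imports "HOL-Analysis.Analysis" "HOL-Computational_Algebra.Primes"
    "HOL-Algebra.Bij" "HOL-Algebra.Coset" "HOL-Algebra.Generated_Groups"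
    "Graph_Theory.Pair_Digraph"
begin

definition safe_prime :: "nat \<Rightarrow> bool" where
  "safe_prime p \<longleftrightarrow> prime p \<and> (\<exists>q. prime q \<and> p = 2 * q + 1)"

definition odd_prime_powers :: "nat set" where
  "odd_prime_powers = {p ^ k | p k. prime p \<and> odd p \<and> k \<ge> 1}"

definition safe_orders :: "nat set" where
  "safe_orders = {p. safe_prime p} \<union> {p ^ 2 | p. safe_prime p} \<union> {3 ^ k | k. k \<ge> 1}"

definition regular_orders :: "nat set" where
  "regular_orders = odd_prime_powers - safe_orders"

text \<open>The cyclic group of order \<open>n\<close> is represented by the residues \<open>0, \<dots>, n - 1\<close>, with
  arithmetic modulo \<open>n\<close>.\<close>

definition Zmod :: "nat \<Rightarrow> int set" where
  "Zmod n = {0..<int n}"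

definition connection_set :: "nat \<Rightarrow> int set \<Rightarrow> bool" where
  "connection_set n S \<longleftrightarrow> S \<subseteq> Zmod n - {0} \<and> (\<lambda>s. (- s) mod int n) ` S = S"

definition circulant :: "nat \<Rightarrow> int set \<Rightarrow> int pair_pre_digraph" where
  "circulant n S =
    \<lparr> pverts = Zmod n, parcs = {(u, v). u \<in> Zmod n \<and> v \<in> Zmod n \<and> (u - v) mod int n \<in> S} \<rparr>"

text \<open>Graphs are compared by equality, not up to isomorphism. Distinct connection sets give
  distinct graphs, so this counts circulant graphs by connection set.\<close>

definition ACG :: "nat \<Rightarrow> int pair_pre_digraph set" where
  "ACG n = {circulant n S | S. connection_set n S}"

definition Aut :: "'a pair_pre_digraph \<Rightarrow> ('a \<Rightarrow> 'a) set" where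
  "Aut G = {f \<in> Bij (pverts G).
     \<forall>u \<in> pverts G. \<forall>v \<in> pverts G. (f u, f v) \<in> parcs G \<longleftrightarrow> (u, v) \<in> parcs G}"

definition rho :: "nat \<Rightarrow> int \<Rightarrow> int" where
  "rho n = (\<lambda>i \<in> Zmod n. (i + 1) mod int n)"

definition iota :: "nat \<Rightarrow> int \<Rightarrow> int" where
  "iota n = (\<lambda>i \<in> Zmod n. (- i) mod int n)"

definition Small :: "nat \<Rightarrow> int pair_pre_digraph set" where
  "Small n = {G \<in> ACG n. Aut G = generate (BijGroup (Zmod n)) {rho n, iota n}}"

definition normal_circulant :: "nat \<Rightarrow> int pair_pre_digraph \<Rightarrow> bool" where
  "normal_circulant n G \<longleftrightarrow>
     generate (BijGroup (Zmod n)) {rho n} \<lhd> (BijGroup (Zmod n))\<lparr>carrier := Aut G\<rparr>"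

definition NonNorG :: "nat \<Rightarrow> int pair_pre_digraph set" where
  "NonNorG n = {G \<in> ACG n. \<not> normal_circulant n G}"

text \<open>Order \<open>3\<close> is degenerate: both circulant graphs of order \<open>3\<close> have automorphism group
  \<open>\<langle>\<rho>, \<iota>\<rangle>\<close>, so there is nothing of which to take a proportion.\<close>

lemma ACG_3_minus_Small_3: "ACG 3 - Small 3 = {}"
proof -
  let ?B = "BijGroup (Zmod 3)"
  have Z: "Zmod 3 = {0, 1, 2}"
    by (auto simp: Zmod_def)
  interpret group ?B by (rule group_BijGroup)
  have r: "rho 3 \<in> carrier ?B" and i: "iota 3 \<in> carrier ?B"
    by (auto simp: BijGroup_def Bij_def Z rho_def iota_def bij_betw_def inj_on_def)
  have mult: "f \<otimes>\<^bsub>?B\<^esub> g = compose (Zmod 3) f g" if "f \<in> carrier ?B" "g \<in> carrier ?B" for f g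
    using that by (simp add: BijGroup_def)
  let ?G = "generate ?B {rho 3, iota 3}"
  have sub: "?G \<subseteq> carrier ?B"
    using r i generate_incl by simp
  have r1: "rho 3 \<in> ?G" and i1: "iota 3 \<in> ?G" and e1: "\<one>\<^bsub>?B\<^esub> \<in> ?G"
    by (auto intro: generate.intros)
  have comp: "compose (Zmod 3) f g \<in> ?G" if "f \<in> ?G" "g \<in> ?G" for f g
    using generate.eng[OF that] unfolding mult[OF subsetD[OF sub that(1)] subsetD[OF sub that(2)]] .
  have "f \<in> ?G" if f: "f \<in> carrier ?B" for f
  proof -
    have ext: "f \<in> extensional (Zmod 3)" and bij: "bij_betw f {0, 1, 2} {0, 1, 2}"
      using f by (auto simp: BijGroup_def Bij_def Z)
    have eqI: "f = g" if "g \<in> extensional (Zmod 3)" "f 0 = g 0" "f 1 = g 1" "f 2 = g 2" for g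
      using that ext by (intro extensionalityI[of f "Zmod 3" g]) (auto simp: Z)
    have vals: "f 0 \<in> {0, 1, 2}" "f 1 \<in> {0, 1, 2}" "f 2 \<in> {0, 1, 2}"
      "f 0 \<noteq> f 1" "f 0 \<noteq> f 2" "f 1 \<noteq> f 2"
      using bij by (auto simp: bij_betw_def inj_on_def)
    let ?c = "compose (Zmod 3)"
    have "f = \<one>\<^bsub>?B\<^esub> \<or> f = rho 3 \<or> f = ?c (rho 3) (rho 3) \<or> f = iota 3
        \<or> f = ?c (rho 3) (iota 3) \<or> f = ?c (rho 3) (?c (rho 3) (iota 3))"
    proof -
      consider "f 0 = 0" "f 1 = 1" "f 2 = 2" | "f 0 = 1" "f 1 = 2" "f 2 = 0"
        | "f 0 = 2" "f 1 = 0" "f 2 = 1" | "f 0 = 0" "f 1 = 2" "f 2 = 1"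
        | "f 0 = 1" "f 1 = 0" "f 2 = 2" | "f 0 = 2" "f 1 = 1" "f 2 = 0"
        using vals by (auto simp del: One_nat_def)
      then show ?thesis
      proof cases
        case 1 then have "f = \<one>\<^bsub>?B\<^esub>" by (intro eqI) (auto simp: BijGroup_def Z)
        then show ?thesis by blast
      next
        case 2 then have "f = rho 3" by (intro eqI) (auto simp: rho_def Z)
        then show ?thesis by blast
      next
        case 3 then have "f = ?c (rho 3) (rho 3)"
          by (intro eqI) (auto simp: rho_def Z compose_def)
        then show ?thesis by blast
      next
        case 4 then have "f = iota 3" by (intro eqI) (auto simp: iota_def Z)
        then show ?thesis by blast
      next
        case 5 then have "f = ?c (rho 3) (iota 3)"
          by (intro eqI) (auto simp: rho_def iota_def Z compose_def)
        then show ?thesis by blast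
      next
        case 6 then have "f = ?c (rho 3) (?c (rho 3) (iota 3))"
          by (intro eqI) (auto simp: rho_def iota_def Z compose_def)
        then show ?thesis by blast
      qed
    qed
    moreover have "?c (rho 3) (rho 3) \<in> ?G" "?c (rho 3) (iota 3) \<in> ?G"
      "?c (rho 3) (?c (rho 3) (iota 3)) \<in> ?G"
      by (intro comp r1 i1)+
    ultimately show ?thesis using r1 i1 e1 by (elim disjE) (simp_all only:)
  qed
  with sub have gen: "?G = Bij (Zmod 3)"
    by (auto simp: BijGroup_def)
  have "Aut (circulant 3 S) = Bij (Zmod 3)" if S: "connection_set 3 S" for S
  proof -
    have im: "(\<lambda>s. (- s) mod 3) ` S = S" and S3: "S \<subseteq> {1, 2}"
      using S by (auto simp: connection_set_def Z)
    have "1 \<in> S \<Longrightarrow> 2 \<in> S"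
      using imageI[of 1 S "\<lambda>s. (- s) mod 3"] im by simp
    moreover have "2 \<in> S \<Longrightarrow> 1 \<in> S"
      using imageI[of 2 S "\<lambda>s. (- s) mod 3"] im by simp
    ultimately have iff: "(u - v) mod 3 \<in> S \<longleftrightarrow> 1 \<in> S \<and> u \<noteq> v"
      if "u \<in> Zmod 3" "v \<in> Zmod 3" for u v
      using that S3 by (auto simp: Z)
    show ?thesis
    proof (intro equalityI subsetI)
      fix f assume f: "f \<in> Bij (Zmod 3)"
      have mem: "f u \<in> Zmod 3" if "u \<in> Zmod 3" for u
        using f that by (auto simp: Bij_def bij_betw_def)
      have inj: "f u = f v \<longleftrightarrow> u = v" if "u \<in> Zmod 3" "v \<in> Zmod 3" for u v
        using f that by (auto simp: Bij_def bij_betw_def inj_on_def)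
      show "f \<in> Aut (circulant 3 S)"
        using f by (simp add: Aut_def circulant_def iff mem inj)
    qed (simp add: Aut_def circulant_def)
  qed
  then show ?thesis
    by (auto simp: Small_def ACG_def gen)
qed

end

theory Submission
  imports "HOL-Number_Theory.Residue_Primitive_Roots" Defs
begin

text \<open>
  Let \<open>f\<close> be an automorphism of a circulant graph of order \<open>p\<^sup>k\<close>, and call a set of residues stable
  if \<open>f\<close> preserves the relation that the difference of two residues lies in it. Schur's multiplier
  argument shows that multiplication by units preserves stable sets. Hence, if \<open>k \<ge> 2\<close> and the
  connection set is not a union of cosets of the subgroup \<open>P\<close> of order \<open>p\<close> outside the subgroup of
  index \<open>p\<close>, then \<open>f\<close> is affine; for \<open>k = 1\<close> Mueller's polynomial argument shows that \<open>f\<close> is affine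
  unless the graph is complete or empty. So for \<open>k \<ge> 2\<close> the non-normal graphs are exactly those whose
  connection set is such a union of cosets, that is, is invariant under the multiplier \<open>- (1 + p\<^sup>k\<^sup>-\<^sup>1)\<close>.
  A normal graph that is not small has a multiplier other than \<open>1\<close> and \<open>- 1\<close>, so everything
  reduces to counting the orbits of multipliers on the non-zero residues.
\<close>

section \<open>Multipliers of difference-stable sets\<close>

text \<open>Write p = 2 q + 1. The pigeonhole argument for k >= 2 compares the lifts of a residue
  class modulo p, and there are no such lifts when k = 1; prime order therefore needs its own
  argument. The two families of orders differ in the multipliers that are available besides 1 and
  -1. For k >= 2 a non-normal graph is bound to a multiplier of order 2p. A divisor r >= 2 of q
  gives a multiplier of order 2r that acts freely on the nonzero residues, hence 2^((p^k - 1)/(2r))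
  graphs that are not small. For k >= 3 the choice r = q already outnumbers the non-normal graphs.
  For k <= 2 it does not, and a proper factor of q is needed, which exists (for p > 3) unless p is
  safe. For p = 3 no r exists at all. The constant one fifth comes from order p^2 with p safe: there
  are 2^(2q) non-normal graphs, the normal ones that are not small lie in a family of 2^(2q + 2)
  graphs, and the two families meet, so the total is less than (1 + 4) 2^(2q).\<close>

definition dilate :: "nat \<Rightarrow> int \<Rightarrow> int set \<Rightarrow> int set" where
  "dilate n m A = {x. \<exists>a\<in>A. [x = m * a] (mod int n)}"

lemma dilate_cong:
  assumes "[m = m'] (mod int n)"
  shows "dilate n m A = dilate n m' A"
proof -
  have "[x = m * a] (mod int n) \<longleftrightarrow> [x = m' * a] (mod int n)" for x a
    using cong_scalar_right [OF assms, of a] by (simp add: Cong.cong_def)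
  then show ?thesis by (simp add: dilate_def)
qed

text \<open>The coefficient at the class of \<open>x\<close> of the image of \<open>q\<close> in the
  group ring Z[X]/(X^n - 1). Powers are taken in \<open>int poly\<close>; exponents are identified
  modulo \<open>n\<close> only when a coefficient is read.\<close>

definition residue_coeff :: "nat \<Rightarrow> int poly \<Rightarrow> int \<Rightarrow> int" where
  "residue_coeff n q x = (\<Sum>i\<le>degree q. if [int i = x] (mod int n) then coeff q i else 0)"

lemma residue_coeff_bound:
  assumes "degree q \<le> d"
  shows "residue_coeff n q x = (\<Sum>i\<le>d. if [int i = x] (mod int n) then coeff q i else 0)"
  unfolding residue_coeff_def
  by (rule sum.mono_neutral_left) (use assms in \<open>auto simp: coeff_eq_0\<close>)

lemma residue_coeff_add: "residue_coeff n (p + q) x = residue_coeff n p x + residue_coeff n q x"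
proof -
  define d where "d = max (degree p) (degree q)"
  have "degree (p + q) \<le> d" "degree p \<le> d" "degree q \<le> d"
    by (auto simp: d_def degree_add_le)
  then show ?thesis
    by (simp add: residue_coeff_bound sum.distrib [symmetric] if_distrib cong: if_cong)
qed

lemma residue_coeff_0 [simp]: "residue_coeff n 0 x = 0"
  by (simp add: residue_coeff_def cong: if_cong)

lemma residue_coeff_sum:
  "residue_coeff n (\<Sum>i\<in>I. f i) x = (\<Sum>i\<in>I. residue_coeff n (f i) x)"
  by (induction I rule: infinite_finite_induct) (simp_all add: residue_coeff_add)

lemma residue_coeff_smult: "residue_coeff n (smult c q) x = c * residue_coeff n q x"
proof -
  have "residue_coeff n (smult c q) x
      = (\<Sum>i\<le>degree q. if [int i = x] (mod int n) then coeff (smult c q) i else 0)"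
    by (rule residue_coeff_bound) (rule degree_smult_le)
  also have "\<dots> = c * residue_coeff n q x"
    unfolding residue_coeff_def sum_distrib_left by (rule sum.cong) auto
  finally show ?thesis .
qed

lemma residue_coeff_monom:
  "residue_coeff n (monom c a) x = (if [int a = x] (mod int n) then c else 0)"
proof -
  have "residue_coeff n (monom c a) x
      = (\<Sum>i\<le>a. if [int i = x] (mod int n) then coeff (monom c a) i else 0)"
    by (rule residue_coeff_bound) (rule degree_monom_le)
  also have "\<dots> = (\<Sum>i\<in>{a}. if [int i = x] (mod int n) then coeff (monom c a) i else 0)"
    by (rule sum.mono_neutral_right) auto
  finally show ?thesis by simp
qed

lemma residue_coeff_monom_mult:
  "residue_coeff n (monom 1 a * q) x = residue_coeff n q (x - int a)"
proof -
  have c: "[int a + int i = x] (mod int n) \<longleftrightarrow> [int i = x - int a] (mod int n)" for i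
    by (simp add: cong_iff_dvd_diff algebra_simps)
  have "monom 1 a * q = (\<Sum>i\<le>degree q. monom (coeff q i) (a + i))"
    by (subst poly_as_sum_of_monoms [symmetric, of q]) (simp add: sum_distrib_left mult_monom)
  then show ?thesis
    by (simp only: residue_coeff_sum residue_coeff_monom residue_coeff_def [of n q] c of_nat_add)
qed

lemma residue_coeff_cong:
  assumes "[x = y] (mod int n)"
  shows "residue_coeff n q x = residue_coeff n q y"
  using assms by (simp add: residue_coeff_def Cong.cong_def)

text \<open>The inner binomial coefficients are divisible by \<open>l\<close>. The ring is arbitrary
  because the application is to \<open>int poly\<close>.\<close>

lemma prime_dvd_add_power:
  fixes x y :: "'a :: comm_ring_1"
  assumes "prime l"
  shows "of_nat l dvd (x + y) ^ l - (x ^ l + y ^ l)"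
proof -
  have l: "l > 0" using assms prime_gt_0_nat by blast
  have "(x + y) ^ l = (\<Sum>k\<le>l. of_nat (l choose k) * x ^ k * y ^ (l - k))"
    by (rule binomial_ring)
  also have "{..l} = insert 0 (insert l {1..<l})" using l by auto
  also have "(\<Sum>k\<in>insert 0 (insert l {1..<l}). of_nat (l choose k) * x ^ k * y ^ (l - k))
      = y ^ l + (x ^ l + (\<Sum>k\<in>{1..<l}. of_nat (l choose k) * x ^ k * y ^ (l - k)))"
    using l by simp
  finally have "(x + y) ^ l - (x ^ l + y ^ l)
      = (\<Sum>k\<in>{1..<l}. of_nat (l choose k) * x ^ k * y ^ (l - k))"
    by simp
  moreover have "of_nat l dvd (of_nat (l choose k) :: 'a)" if "k \<in> {1..<l}" for k
  proof -
    have "l dvd l choose k" using that assms by (intro dvd_choose_prime) auto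
    then show ?thesis by (metis dvd_def of_nat_mult)
  qed
  ultimately show ?thesis by (auto intro!: dvd_sum dvd_mult2)
qed

lemma prime_dvd_sum_power:
  fixes f :: "'b \<Rightarrow> 'a :: comm_ring_1"
  assumes "prime l"
  shows "of_nat l dvd (\<Sum>i\<in>I. f i) ^ l - (\<Sum>i\<in>I. f i ^ l)"
proof (induction I rule: infinite_finite_induct)
  case (insert i I)
  have "(\<Sum>i\<in>insert i I. f i) ^ l - (\<Sum>i\<in>insert i I. f i ^ l)
     = ((f i + (\<Sum>i\<in>I. f i)) ^ l - (f i ^ l + (\<Sum>i\<in>I. f i) ^ l))
       + ((\<Sum>i\<in>I. f i) ^ l - (\<Sum>i\<in>I. f i ^ l))"
    using insert by simp
  then show ?case
    using insert.IH prime_dvd_add_power [OF assms] by (metis dvd_add)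
qed (use assms prime_gt_0_nat in \<open>auto simp: zero_power\<close>)

text \<open>\<open>F\<close> need not preserve \<open>{0..<int n}\<close>; its reduction modulo
  \<open>n\<close> does, and an injective self-map of a finite set permutes it.\<close>

lemma sum_residues_reindex:
  fixes F :: "int \<Rightarrow> int" and g :: "int \<Rightarrow> 'a :: comm_monoid_add"
  assumes n: "n > 0"
    and F: "\<And>x y. [F x = F y] (mod int n) \<longleftrightarrow> [x = y] (mod int n)"
    and g: "\<And>x y. [x = y] (mod int n) \<Longrightarrow> g x = g y"
  shows "(\<Sum>y\<in>{0..<int n}. g (F y)) = (\<Sum>y\<in>{0..<int n}. g y)"
proof -
  have inj: "inj_on (\<lambda>y. F y mod int n) {0..<int n}"
  proof (rule inj_onI)
    fix x y assume xy: "x \<in> {0..<int n}" "y \<in> {0..<int n}" and eq: "F x mod int n = F y mod int n"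
    then have "[x = y] (mod int n)" using F unfolding Cong.cong_def by blast
    then show "x = y" using xy by (simp add: Cong.cong_def)
  qed
  have "(\<lambda>y. F y mod int n) ` {0..<int n} = {0..<int n}"
    by (rule endo_inj_surj) (use n inj in auto)
  then have "(\<Sum>y\<in>{0..<int n}. g y) = (\<Sum>y\<in>{0..<int n}. g (F y mod int n))"
    using sum.reindex [OF inj, of g] by (simp add: o_def)
  also have "\<dots> = (\<Sum>y\<in>{0..<int n}. g (F y))"
    by (rule sum.cong) (auto intro: g)
  finally show ?thesis by simp
qed

text \<open>Residues are represented by all integers. The equivalence makes \<open>F\<close> both
  well defined and injective on classes, hence a permutation of them.\<close>

locale residue_perm =
  fixes n :: nat and F :: "int \<Rightarrow> int"
  assumes n_pos: "n > 0"
    and F_cong: "[F x = F y] (mod int n) \<longleftrightarrow> [x = y] (mod int n)"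
begin

definition stable :: "int set \<Rightarrow> bool" where
  "stable A \<longleftrightarrow> (\<forall>x y. [x = y] (mod int n) \<longrightarrow> (x \<in> A \<longleftrightarrow> y \<in> A))
     \<and> (\<forall>x y. F x - F y \<in> A \<longleftrightarrow> x - y \<in> A)"

lemma stable_congD: "stable A \<Longrightarrow> [x = y] (mod int n) \<Longrightarrow> x \<in> A \<longleftrightarrow> y \<in> A"
  unfolding stable_def by blast

lemma stable_diff_iff: "stable A \<Longrightarrow> F x - F y \<in> A \<longleftrightarrow> x - y \<in> A"
  unfolding stable_def by blast

text \<open>The coefficient of \<open>P ^ j\<close> at \<open>u - v\<close> is the number of walks
  of length \<open>j\<close> from \<open>u\<close> to \<open>v\<close> in the Cayley digraph of
  \<open>A\<close>, which has \<open>F\<close> as an automorphism. The induction splits off the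
  first step of the walk.\<close>

lemma residue_coeff_power_stable:
  assumes A: "stable A"
  defines "P \<equiv> \<Sum>a\<in>{a \<in> {0..<int n}. a \<in> A}. monom 1 (nat a) :: int poly"
  shows "residue_coeff n (P ^ j) (F u - F v) = residue_coeff n (P ^ j) (u - v)"
proof (induction j arbitrary: u v)
  case 0
  have "residue_coeff n 1 x = (if [0 = x] (mod int n) then 1 else 0)" for x
    using residue_coeff_monom [of n 1 0 x] by simp
  moreover have "[0 = F u - F v] (mod int n) \<longleftrightarrow> [0 = u - v] (mod int n)"
    using F_cong [of u v] by (metis cong_diff_iff_cong_0 cong_sym)
  ultimately show ?case by simp
next
  case (Suc j)
  have step: "residue_coeff n (P ^ Suc j) (u - v)
      = (\<Sum>y\<in>{0..<int n}. if u - y \<in> A then residue_coeff n (P ^ j) (y - v) else 0)" for u v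
  proof -
    let ?g = "\<lambda>a. if a \<in> A then residue_coeff n (P ^ j) (u - v - a) else 0"
    have "residue_coeff n (P ^ Suc j) (u - v)
        = (\<Sum>a\<in>{a \<in> {0..<int n}. a \<in> A}. residue_coeff n (P ^ j) (u - v - a))"
      unfolding power_Suc P_def sum_distrib_right residue_coeff_sum residue_coeff_monom_mult
      by (rule sum.cong) auto
    also have "\<dots> = (\<Sum>a\<in>{0..<int n}. ?g a)"
      by (rule sum.inter_filter) simp
    also have "\<dots> = (\<Sum>y\<in>{0..<int n}. ?g (u - y))"
    proof (rule sum_residues_reindex [symmetric, OF n_pos])
      show "[u - x = u - y] (mod int n) \<longleftrightarrow> [x = y] (mod int n)" for x y
        by (simp add: cong_iff_dvd_diff dvd_diff_commute)
      show "?g x = ?g y" if "[x = y] (mod int n)" for x y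
        using stable_congD [OF A that] residue_coeff_cong [OF cong_diff [OF cong_refl that]] by simp
    qed
    finally show ?thesis by (simp add: algebra_simps cong: if_cong)
  qed
  let ?h = "\<lambda>y. if F u - y \<in> A then residue_coeff n (P ^ j) (y - F v) else 0"
  have "residue_coeff n (P ^ Suc j) (F u - F v) = (\<Sum>y\<in>{0..<int n}. ?h y)"
    by (rule step)
  also have "\<dots> = (\<Sum>y\<in>{0..<int n}. ?h (F y))"
  proof (rule sum_residues_reindex [symmetric, OF n_pos F_cong])
    show "?h x = ?h y" if "[x = y] (mod int n)" for x y
      using stable_congD [OF A cong_diff [OF cong_refl that]]
        residue_coeff_cong [OF cong_diff [OF that cong_refl]] by simp
  qed
  also have "\<dots> = residue_coeff n (P ^ Suc j) (u - v)"
    unfolding step by (rule sum.cong) (simp_all add: stable_diff_iff [OF A] Suc.IH)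
  finally show ?case .
qed

text \<open>Schur's theorem on multipliers: modulo the prime \<open>l\<close>, the \<open>l\<close>-th power of the
  formal sum of \<open>A\<close> is the formal sum of \<open>l A\<close>.\<close>

lemma stable_dilate_prime:
  assumes A: "stable A" and l: "prime l" "coprime l n"
  shows "stable (dilate n (int l) A)"
proof -
  define B where "B = {a \<in> {0..<int n}. a \<in> A}"
  define P :: "int poly" where "P = (\<Sum>a\<in>B. monom 1 (nat a))"
  have finite_B: "finite B"
    unfolding B_def by (rule finite_subset [of _ "{0..<int n}"]) auto
  have cl: "coprime (int l) (int n)" using l by simp
  \<comment> \<open>Modulo \<open>l\<close> the coefficient counts the \<open>a\<close> in
    \<open>B\<close> with l a = x. The count is 0 or 1 because \<open>l\<close> is a unit modulo
    \<open>n\<close>, so divisibility by \<open>l\<close> decides membership.\<close>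
  have mem: "x \<in> dilate n (int l) A \<longleftrightarrow> \<not> int l dvd residue_coeff n (P ^ l) x" for x
  proof -
    have "of_nat l dvd P ^ l - (\<Sum>a\<in>B. monom 1 (nat a) ^ l)"
      unfolding P_def by (rule prime_dvd_sum_power [OF l(1)])
    then obtain Q where Q: "P ^ l - (\<Sum>a\<in>B. monom 1 (nat a) ^ l) = of_nat l * Q" ..
    then have "P ^ l = (\<Sum>a\<in>B. monom 1 (l * nat a)) + smult (int l) Q"
      by (simp add: monom_power algebra_simps of_nat_poly)
    then have "residue_coeff n (P ^ l) x
        = (\<Sum>a\<in>B. if [int l * a = x] (mod int n) then 1 else 0) + int l * residue_coeff n Q x"
      by (simp add: residue_coeff_add residue_coeff_sum residue_coeff_smult residue_coeff_monom)
         (rule sum.cong, auto simp: B_def)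
    then have *: "int l dvd residue_coeff n (P ^ l) x
        \<longleftrightarrow> int l dvd (\<Sum>a\<in>B. if [int l * a = x] (mod int n) then 1 else 0)"
      by (simp add: dvd_add_left_iff)
    show ?thesis
    proof (cases "\<exists>a\<in>B. [int l * a = x] (mod int n)")
      case True
      then obtain a where a: "a \<in> B" "[int l * a = x] (mod int n)" by blast
      have "b = a" if "b \<in> B" "[int l * b = x] (mod int n)" for b
      proof -
        have "[int l * b = int l * a] (mod int n)"
          by (rule cong_trans [OF that(2) cong_sym [OF a(2)]])
        then have "[b = a] (mod int n)" using cl by (simp add: cong_mult_lcancel)
        then show ?thesis using a that by (simp add: B_def Cong.cong_def)
      qed
      then have "[int l * b = x] (mod int n) \<longleftrightarrow> b = a" if "b \<in> B" for b
        using a that by blast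
      then have "(\<Sum>b\<in>B. if [int l * b = x] (mod int n) then 1 else 0)
          = (\<Sum>b\<in>B. if b = a then 1 else 0 :: int)"
        by (intro sum.cong refl) (simp only:)
      also have "\<dots> = 1" using a(1) by (simp add: finite_B)
      finally have "\<not> int l dvd residue_coeff n (P ^ l) x"
        using * l prime_nat_iff by auto
      moreover have "x \<in> dilate n (int l) A"
        using a by (auto simp: dilate_def B_def intro: cong_sym)
      ultimately show ?thesis by blast
    next
      case False
      then have "(\<Sum>a\<in>B. if [int l * a = x] (mod int n) then 1 else 0 :: int) = 0"
        by (intro sum.neutral) auto
      then have "int l dvd residue_coeff n (P ^ l) x"
        using * by (simp only: dvd_0_right)
      moreover have "x \<notin> dilate n (int l) A"
      proof
        assume "x \<in> dilate n (int l) A"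
        then obtain a where a: "a \<in> A" "[x = int l * a] (mod int n)"
          unfolding dilate_def by blast
        have am: "[a mod int n = a] (mod int n)" unfolding Cong.cong_def by (rule mod_mod_trivial)
        have "a mod int n \<in> A"
          using a(1) stable_congD [OF A am] by blast
        moreover have "a mod int n \<in> {0..<int n}"
          using n_pos pos_mod_sign pos_mod_bound by auto
        ultimately have "a mod int n \<in> B"
          unfolding B_def by blast
        moreover have "[int l * (a mod int n) = x] (mod int n)"
          by (rule cong_trans [OF cong_scalar_left [OF am] cong_sym [OF a(2)]])
        ultimately show False using False by blast
      qed
      ultimately show ?thesis by blast
    qed
  qed
  show ?thesis
    unfolding stable_def
  proof (intro allI conjI impI)
    show "x \<in> dilate n (int l) A \<longleftrightarrow> y \<in> dilate n (int l) A" if "[x = y] (mod int n)" for x y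
      unfolding mem residue_coeff_cong [OF that] ..
    show "F x - F y \<in> dilate n (int l) A \<longleftrightarrow> x - y \<in> dilate n (int l) A" for x y
      unfolding mem P_def B_def residue_coeff_power_stable [OF A] ..
  qed
qed

lemma stable_dilate:
  assumes A: "stable A" and m: "coprime m n" "m > 0"
  shows "stable (dilate n (int m) A)"
  using m
proof (induction m rule: prime_divisors_induct)
  case zero then show ?case by simp
next
  case (unit x)
  moreover have "dilate n 1 A = A"
    unfolding dilate_def mult_1_left using stable_congD [OF A] cong_refl by blast
  ultimately show ?case using A by simp
next
  case (factor l m)
  then have "stable (dilate n (int m) A)" by auto
  then have "stable (dilate n (int l) (dilate n (int m) A))"
    using factor.prems factor.hyps by (auto intro!: stable_dilate_prime)
  moreover have "dilate n (int l) (dilate n (int m) A) = dilate n (int (l * m)) A"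
  proof (intro equalityI subsetI)
    fix x assume "x \<in> dilate n (int l) (dilate n (int m) A)"
    then obtain y a where "[x = int l * y] (mod int n)" "a \<in> A" "[y = int m * a] (mod int n)"
      by (auto simp: dilate_def)
    have "[int l * y = int l * (int m * a)] (mod int n)"
      using \<open>[y = int m * a] (mod int n)\<close> by (rule cong_scalar_left)
    then have "[x = int (l * m) * a] (mod int n)"
      using \<open>[x = int l * y] (mod int n)\<close> by (simp add: Cong.cong_def mult.assoc)
    then show "x \<in> dilate n (int (l * m)) A" using \<open>a \<in> A\<close> by (auto simp: dilate_def)
  next
    fix x assume "x \<in> dilate n (int (l * m)) A"
    then obtain a where "a \<in> A" "[x = int l * (int m * a)] (mod int n)"
      by (auto simp: dilate_def mult.assoc)
    then show "x \<in> dilate n (int l) (dilate n (int m) A)"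
      unfolding dilate_def using cong_refl by blast
  qed
  ultimately show ?case by simp
qed

text \<open>The atom containing \<open>x\<close> of the Boolean algebra of stable sets; on residues,
  the orbit of \<open>x\<close> under the stabiliser of 0 in the group generated by \<open>F\<close>
  and the translations.\<close>

definition block :: "int \<Rightarrow> int set" where
  "block x = \<Inter>{A. stable A \<and> x \<in> A}"

lemma stable_block: "stable (block x)"
  unfolding stable_def block_def by (auto simp: stable_congD stable_diff_iff)

lemma block_self: "x \<in> block x"
  by (simp add: block_def)

lemma block_subset: "stable A \<Longrightarrow> x \<in> A \<Longrightarrow> block x \<subseteq> A"
  by (auto simp: block_def)

text \<open>Complements of stable sets are stable, so a smaller stable set inside
  \<open>block x\<close> that misses \<open>x\<close> could be removed from it.\<close>

lemma block_eq:
  assumes "y \<in> block x"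
  shows "block y = block x"
proof
  show "block y \<subseteq> block x" by (rule block_subset [OF stable_block assms])
  have "x \<in> block y"
  proof (rule ccontr)
    assume "x \<notin> block y"
    moreover have "stable (- block y)"
      using stable_block [of y] by (simp add: stable_def)
    ultimately have "y \<in> - block y" using assms block_subset by blast
    then show False using block_self by blast
  qed
  then show "block x \<subseteq> block y" by (rule block_subset [OF stable_block])
qed

lemma block_diff: "F x - F y \<in> block (x - y)"
  using stable_diff_iff [OF stable_block] block_self by blast

text \<open>Multiplication by a unit permutes the stable sets and hence their atoms; the second
  inclusion uses the inverse of \<open>m\<close>.\<close>

lemma block_mult:
  assumes m: "coprime m (int n)"
  shows "block (m * x) = dilate n m (block x)"
proof -
  have dil: "stable (dilate n m A)" if A: "stable A" and m: "coprime m (int n)" for m A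
  proof -
    \<comment> \<open>The summand \<open>n\<close> keeps the representative positive even if
      \<open>m mod int n\<close> is 0, which happens for \<open>n = 1\<close>.\<close>
    define m' where "m' = nat (m mod int n) + n"
    have m': "[m = int m'] (mod int n)" using n_pos by (simp add: m'_def Cong.cong_def)
    then have "coprime m' n" using m cong_imp_coprime by force
    moreover have "dilate n m A = dilate n (int m') A"
      by (rule dilate_cong [OF m'])
    ultimately show ?thesis using stable_dilate [OF A, of m'] n_pos by (simp add: m'_def)
  qed
  obtain m' where m': "[m * m' = 1] (mod int n)"
    using cong_solve_coprime_int [OF m] ..
  then have cm': "coprime m' (int n)"
    using coprime_iff_invertible_int [of m' "int n"] mult.commute [of m m'] by auto
  have "m * x \<in> dilate n m (block x)" using block_self cong_refl unfolding dilate_def by blast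
  then have "block (m * x) \<subseteq> dilate n m (block x)"
    by (intro block_subset dil stable_block m)
  moreover have "dilate n m (block x) \<subseteq> block (m * x)"
  proof
    fix z assume "z \<in> dilate n m (block x)"
    then obtain y where y: "y \<in> block x" "[z = m * y] (mod int n)" by (auto simp: dilate_def)
    have "[x = m' * (m * x)] (mod int n)"
      using cong_sym [OF cong_scalar_right [OF m', of x]] by (simp add: ac_simps)
    then have "x \<in> dilate n m' (block (m * x))"
      unfolding dilate_def using block_self by blast
    then have "block x \<subseteq> dilate n m' (block (m * x))"
      by (intro block_subset dil stable_block cm')
    then obtain w where w: "w \<in> block (m * x)" "[y = m' * w] (mod int n)"
      using y by (auto simp: dilate_def)
    have "[m * y = m * (m' * w)] (mod int n)" using w cong_scalar_left by blast
    moreover have "[m * (m' * w) = w] (mod int n)"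
      using cong_scalar_right [OF m', of w] by (simp add: ac_simps)
    ultimately have "[w = z] (mod int n)" using y(2) by (simp add: Cong.cong_def)
    then show "z \<in> block (m * x)" using w stable_congD [OF stable_block] by blast
  qed
  ultimately show ?thesis by blast
qed

end

section \<open>Odd prime powers with exponent at least two\<close>

lemma square_dvd_one_plus_power:
  fixes x :: int
  shows "x\<^sup>2 dvd (1 + x) ^ m - (1 + int m * x)"
proof (induction m)
  case (Suc m)
  have "(1 + x) ^ Suc m - (1 + int (Suc m) * x)
      = (1 + x) * ((1 + x) ^ m - (1 + int m * x)) + x\<^sup>2 * int m"
    by (simp add: algebra_simps power2_eq_square)
  then show ?case using Suc by (metis dvd_add dvd_mult dvd_triv_left)
qed simp

text \<open>The \<open>p\<close>-th power raises the valuation of u - 1 by exactly one. Since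
  \<open>p\<close> is odd, (p - 1)/2 is an integer, so the sum of (1 + x)^m over m < p is p modulo
  p^2.\<close>

lemma one_plus_prime_power_power:
  fixes w :: int
  assumes p: "prime p" "odd p" and i: "i \<ge> 1" and w: "\<not> int p dvd w"
  shows "\<exists>w'. (1 + int p ^ i * w) ^ p = 1 + int p ^ Suc i * w' \<and> \<not> int p dvd w'"
proof -
  define x where "x = int p ^ i * w"
  have px: "int p dvd x" using i by (simp add: x_def dvd_power)
  have "(int p)\<^sup>2 dvd (\<Sum>m<p. (1 + x) ^ m) - int p"
  proof -
    have "(int p)\<^sup>2 dvd (\<Sum>m<p. (1 + x) ^ m - (1 + int m * x))"
      by (intro dvd_sum dvd_trans [OF _ square_dvd_one_plus_power]) (use px in simp)
    moreover have "(int p)\<^sup>2 dvd (int p * x) * ((int p - 1) div 2)"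
      using px by (simp add: power2_eq_square)
    moreover have "(\<Sum>m<p. int m) = int p * ((int p - 1) div 2)"
    proof -
      have "2 * (\<Sum>m<q. int m) = int q * (int q - 1)" for q
        by (induction q) (auto simp: algebra_simps)
      moreover have "even (int p - 1)" using p by simp
      ultimately show ?thesis by (metis dvd_mult_div_cancel mult.left_commute mult_cancel_left zero_neq_numeral)
    qed
    then have "(\<Sum>m<p. (1 + x) ^ m) - int p
        = (\<Sum>m<p. (1 + x) ^ m - (1 + int m * x)) + (int p * x) * ((int p - 1) div 2)"
      by (simp add: sum_subtractf sum.distrib sum_distrib_right [symmetric])
    ultimately show ?thesis by (simp only: dvd_add)
  qed
  then obtain z where z: "(\<Sum>m<p. (1 + x) ^ m) = int p + (int p)\<^sup>2 * z"
    by (metis add.commute diff_add_cancel dvd_def)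
  have "(1 + x) ^ p - 1 = x * (\<Sum>m<p. (1 + x) ^ m)"
    using power_diff_1_eq [of "1 + x" p] by simp
  also have "\<dots> = x * (int p + (int p)\<^sup>2 * z)" by (simp only: z)
  also have "\<dots> = int p ^ Suc i * (w * (1 + int p * z))"
    unfolding x_def by (simp add: algebra_simps power2_eq_square)
  finally have "(1 + x) ^ p = 1 + int p ^ Suc i * (w * (1 + int p * z))" by simp
  moreover have "\<not> int p dvd w * (1 + int p * z)"
    using p w prime_gt_1_nat [of p] by (simp add: prime_dvd_mult_iff dvd_add_left_iff)
  ultimately show ?thesis unfolding x_def by blast
qed

lemma one_plus_prime_power_powers:
  fixes w :: int
  assumes p: "prime p" "odd p" and i: "i \<ge> 1" and w: "\<not> int p dvd w"
  shows "\<exists>m w'. (1 + int p ^ i * w) ^ m = 1 + int p ^ (i + d) * w' \<and> \<not> int p dvd w'"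
proof (induction d)
  case 0
  show ?case using w by (intro exI [of _ 1] exI [of _ w]) simp
next
  case (Suc d)
  then obtain m w' where w': "(1 + int p ^ i * w) ^ m = 1 + int p ^ (i + d) * w'" "\<not> int p dvd w'"
    by blast
  obtain w'' where "(1 + int p ^ (i + d) * w') ^ p = 1 + int p ^ Suc (i + d) * w''" "\<not> int p dvd w''"
    using one_plus_prime_power_power [OF p _ w'(2)] i by (metis trans_le_add1)
  then show ?case
    by (intro exI [of _ "m * p"] exI [of _ w'']) (simp add: power_mult w'(1))
qed

text \<open>For odd \<open>p\<close> the units congruent to 1 modulo \<open>p\<close> form a cyclic
  \<open>p\<close>-group, so every nontrivial subgroup contains the subgroup of order
  \<open>p\<close>, the units 1 + p^(k-1) j. A first exponent brings \<open>u\<close> to valuation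
  exactly \<open>k - 1\<close>, a second one adjusts \<open>j\<close>.\<close>

lemma powers_cover_kernel:
  fixes u j :: int
  assumes p: "prime p" "odd p" and k: "k \<ge> 2"
    and u: "[u = 1] (mod int p)" "\<not> [u = 1] (mod int p ^ k)"
  shows "\<exists>m. [u ^ m = 1 + int p ^ (k - 1) * j] (mod int p ^ k)"
proof -
  have "u - 1 \<noteq> 0" using u(2) by auto
  moreover have "\<not> is_unit (int p)" using p by (simp add: prime_nat_iff)
  ultimately obtain i w where iw: "u - 1 = int p ^ i * w" "\<not> int p dvd w"
    using multiplicity_decompose' [of "u - 1" "int p"] by metis
  have i1: "i \<ge> 1"
    using iw u(1) by (cases i) (auto simp: cong_iff_dvd_diff)
  have "i < k"
  proof (rule ccontr)
    assume "\<not> i < k"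
    then have "int p ^ k dvd u - 1" unfolding iw(1) by (simp add: le_imp_power_dvd)
    then show False using u(2) by (simp add: cong_iff_dvd_diff)
  qed
  then obtain m w' where m: "u ^ m = 1 + int p ^ (k - 1) * w'" and w': "\<not> int p dvd w'"
    using one_plus_prime_power_powers [OF p i1 iw(2), of "k - 1 - i"] iw(1)
    by (auto simp: algebra_simps)
  have "coprime w' (int p)"
    using p w' by (metis coprime_commute prime_imp_coprime prime_nat_int_transfer)
  then obtain v where v: "[w' * v = 1] (mod int p)" using cong_solve_coprime_int by blast
  \<comment> \<open>The exponent solves l w' = j modulo \<open>p\<close>. The higher binomial terms
    vanish because 2 (k - 1) >= k.\<close>
  define l where "l = nat (v * j mod int p)"
  have p0: "int p > 0" using p prime_gt_0_nat by simp
  have "[int l = v * j] (mod int p)"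
    using p0 by (simp add: l_def Cong.cong_def)
  then have "[int l * w' = v * j * w'] (mod int p)" by (rule cong_scalar_right)
  moreover have "[v * j * w' = j] (mod int p)"
    using cong_scalar_right [OF v, of j] by (simp add: ac_simps)
  ultimately have "int p dvd int l * w' - j"
    using cong_trans cong_iff_dvd_diff by blast
  then have "int p ^ (k - 1) * int p dvd int p ^ (k - 1) * (int l * w' - j)" by simp
  moreover have "int p ^ (k - 1) * int p = int p ^ k"
    using k by (simp add: power_Suc2 [symmetric] del: power_Suc2)
  ultimately have "int p ^ k dvd int p ^ (k - 1) * (int l * w' - j)" by (simp only:)
  moreover have "int p ^ k dvd (1 + int p ^ (k - 1) * w') ^ l - (1 + int l * (int p ^ (k - 1) * w'))"
  proof (rule dvd_trans [OF _ square_dvd_one_plus_power])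
    have "int p ^ k dvd int p ^ ((k - 1) * 2)" using k by (intro le_imp_power_dvd) simp
    also have "\<dots> dvd (int p ^ (k - 1) * w')\<^sup>2"
      by (simp add: power_mult_distrib power_mult)
    finally show "int p ^ k dvd (int p ^ (k - 1) * w')\<^sup>2" .
  qed
  moreover have "u ^ (m * l) - (1 + int p ^ (k - 1) * j)
      = ((1 + int p ^ (k - 1) * w') ^ l - (1 + int l * (int p ^ (k - 1) * w')))
        + int p ^ (k - 1) * (int l * w' - j)"
    unfolding power_mult m by (simp add: algebra_simps)
  ultimately have "int p ^ k dvd u ^ (m * l) - (1 + int p ^ (k - 1) * j)"
    by (simp only: dvd_add)
  then show ?thesis unfolding cong_iff_dvd_diff by blast
qed

context residue_perm
begin

text \<open>For \<open>k \<ge> 2\<close> a stable set that is not a union of cosets of \<open>p\<^sup>k\<^sup>-\<^sup>1\<close> off \<open>p\<close> forces the block of \<open>1\<close>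
  to be a group \<open>M\<close> of units that embeds into the units modulo \<open>p\<close>. After normalisation \<open>F\<close> fixes
  \<open>0\<close> and \<open>1\<close>, and then \<open>x u - 1 = (x - 1) v\<close> with \<open>u, v \<in> M\<close> has too few solutions for \<open>F\<close> to move
  any residue class modulo \<open>p\<close>.\<close>

theorem affine_if_not_coset_union:
  assumes p: "prime p" "odd p" and k: "k \<ge> 2" and n: "n = p ^ k"
    and S: "stable S" and x: "\<not> int p dvd x" "x \<in> S" "x + int p ^ (k - 1) * j \<notin> S"
  shows "\<exists>a b. \<forall>x. [F x = a * x + b] (mod int n)"
proof -
  define M where "M = block 1"
  have p0: "p > 0" "p > 1" using p prime_gt_0_nat prime_gt_1_nat by auto
  have ip: "prime (int p)" using p by simp
  have pn: "int p dvd int n" using k by (simp add: n)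
  have pk: "int p ^ (k - 1) * int p = int n"
    using k by (simp add: n power_Suc2 [symmetric] del: power_Suc2)
  have modp: "[a = b] (mod int p)" if "[a = b] (mod int n)" for a b
    using that pn cong_dvd_modulus by blast
  have cop: "coprime u (int n)" if "\<not> int p dvd u" for u
    using prime_imp_coprime [OF ip that] by (simp add: n coprime_commute)
  have M_cong: "a \<in> M \<longleftrightarrow> b \<in> M" if "[a = b] (mod int n)" for a b
    unfolding M_def by (rule stable_congD [OF stable_block that])
  have block_unit: "y \<in> block u \<longleftrightarrow> (\<exists>m\<in>M. [y = u * m] (mod int n))" if "\<not> int p dvd u" for u y
    using block_mult [OF cop [OF that], of 1] by (simp add: M_def dilate_def)
  have "1 \<in> M" unfolding M_def by (rule block_self)
  \<comment> \<open>The block of \<open>x\<close> is \<open>x\<close> times \<open>M\<close>, so the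
    missing coset element at \<open>x\<close> is moved to 1 by the inverse of
    \<open>x\<close>.\<close>
  obtain j' where j': "1 + int p ^ (k - 1) * j' \<notin> M"
  proof -
    obtain x' where x': "[x * x' = 1] (mod int n)"
      using cong_solve_coprime_int [OF cop [OF x(1)]] ..
    have "1 + int p ^ (k - 1) * (x' * j) \<notin> M"
    proof
      assume *: "1 + int p ^ (k - 1) * (x' * j) \<in> M"
      have "int n dvd (1 - x * x') * (int p ^ (k - 1) * j)"
        using cong_sym [OF x'] unfolding cong_iff_dvd_diff by (rule dvd_mult2)
      then have "[x + int p ^ (k - 1) * j = x * (1 + int p ^ (k - 1) * (x' * j))] (mod int n)"
        unfolding cong_iff_dvd_diff by (simp add: algebra_simps)
      then have "x + int p ^ (k - 1) * j \<in> block x"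
        using * block_unit [OF x(1)] by blast
      then show False using x block_subset [OF S] by blast
    qed
    then show ?thesis by (rule that)
  qed
  \<comment> \<open>Multiplication by 1 + p^(k-1) j' fixes every multiple of \<open>p\<close>. Such
    a multiple in \<open>M\<close> would lie in the blocks of both 1 and 1 + p^(k-1) j', which
    \<open>j'\<close> keeps apart.\<close>
  have M_unit: "\<not> int p dvd y" if y: "y \<in> M" for y
  proof
    assume py: "int p dvd y"
    define m where "m = 1 + int p ^ (k - 1) * j'"
    have "int p dvd int p ^ (k - 1) * j'" using k by (simp add: dvd_power)
    then have m: "\<not> int p dvd m"
      unfolding m_def using p0 by (simp add: dvd_add_left_iff)
    have "int p ^ (k - 1) * int p dvd (int p ^ (k - 1) * j') * y"
      using py by (simp add: mult_dvd_mono)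
    then have "[y = m * y] (mod int n)"
      unfolding m_def cong_iff_dvd_diff pk [symmetric] by (simp add: algebra_simps)
    then have "y \<in> block m" using y block_unit [OF m] by blast
    then have "block m = block 1" using block_eq y unfolding M_def by blast
    then show False using j' block_self [of m] by (simp add: M_def m_def)
  qed
  have M_mult: "t * s \<in> M" if "t \<in> M" "s \<in> M" for t s
  proof -
    have "t * s \<in> block t" using block_unit [OF M_unit] that cong_refl by blast
    then show ?thesis using block_eq that(1) unfolding M_def by blast
  qed
  have M_power: "t ^ i \<in> M" if "t \<in> M" for t i
    using that M_mult \<open>1 \<in> M\<close> by (induction i) auto
  \<comment> \<open>A nontrivial element would have 1 + p^(k-1) j' among its powers, which is not in
    \<open>M\<close>.\<close>
  have M_kernel: "[u = 1] (mod int n)" if u: "u \<in> M" "[u = 1] (mod int p)" for u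
  proof (rule ccontr)
    assume "\<not> [u = 1] (mod int n)"
    then obtain m where "[u ^ m = 1 + int p ^ (k - 1) * j'] (mod int n)"
      using powers_cover_kernel [OF p k u(2)] by (auto simp: n)
    then show False using M_cong M_power u(1) j' by blast
  qed
  have M_inverse: "\<exists>v'\<in>M. [v * v' = 1] (mod int n)" if v: "v \<in> M" for v
  proof -
    have "n > 1" using one_less_power [OF p0(2), of k] k by (simp add: n)
    then have "[v ^ totient n = 1] (mod int n)"
      using residues.euler_theorem [of "int n" v] cop [OF M_unit [OF v]] by (simp add: residues_def)
    moreover have "v ^ totient n = v * v ^ (totient n - 1)"
      using \<open>n > 1\<close> by (simp add: power_eq_if)
    ultimately show ?thesis using M_power [OF v] by (intro bexI [of _ "v ^ (totient n - 1)"]) simp_all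
  qed
  have M_inj: "[u = v] (mod int n)" if u: "u \<in> M" and v: "v \<in> M" and uv: "[u = v] (mod int p)" for u v
  proof -
    obtain v' where v': "v' \<in> M" "[v * v' = 1] (mod int n)" using M_inverse [OF v] by blast
    have "[u * v' = 1] (mod int p)"
      using cong_trans [OF cong_scalar_right [OF uv] modp [OF v'(2)]] .
    then have uv': "[u * v' = 1] (mod int n)" using M_kernel M_mult u v'(1) by blast
    have "[u * (v * v') = u * 1] (mod int n)" using v'(2) by (rule cong_scalar_left)
    moreover have "[(u * v') * v = 1 * v] (mod int n)" using uv' by (rule cong_scalar_right)
    ultimately show ?thesis by (simp add: Cong.cong_def ac_simps)
  qed
  have F_unit: "\<exists>u\<in>M. [F x - F y = (x - y) * u] (mod int n)" if "\<not> int p dvd x - y" for x y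
    using block_unit [OF that] block_diff by blast
  have F_nonunit: "int p dvd F x - F y" if xy: "int p dvd x - y" for x y
  proof (rule ccontr)
    assume *: "\<not> int p dvd F x - F y"
    have "x - y \<in> block (F x - F y)"
      using stable_diff_iff [OF stable_block] block_self by blast
    then obtain m where m: "m \<in> M" "[x - y = (F x - F y) * m] (mod int n)"
      using block_unit [OF *] by blast
    have "int p dvd (F x - F y) * m"
      using modp [OF m(2)] xy by (simp add: cong_dvd_iff)
    then show False using * M_unit [OF m(1)] ip by (simp add: prime_dvd_mult_iff)
  qed
  define a where "a = F 1 - F 0"
  have "a \<in> M"
  proof -
    obtain u where "u \<in> M" "[F 1 - F 0 = (1 - 0) * u] (mod int n)"
      using F_unit [of 1 0] p0 by auto
    then show ?thesis using M_cong [of a u] by (simp add: a_def)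
  qed
  then obtain a' where a': "a' \<in> M" "[a * a' = 1] (mod int n)" using M_inverse by blast
  define g where "g x = a' * (F x - F 0)" for x
  have g0: "g 0 = 0" by (simp add: g_def)
  have g1: "[g 1 = 1] (mod int n)" using a'(2) by (simp add: g_def a_def mult.commute)
  have g_unit: "\<exists>u\<in>M. [g x - g y = (x - y) * u] (mod int n)" if xy: "\<not> int p dvd x - y" for x y
  proof -
    obtain u where u: "u \<in> M" "[F x - F y = (x - y) * u] (mod int n)" using F_unit [OF xy] by blast
    have "[a' * (F x - F y) = a' * ((x - y) * u)] (mod int n)" using u(2) by (rule cong_scalar_left)
    then have "[g x - g y = (x - y) * (a' * u)] (mod int n)"
      by (simp add: g_def algebra_simps)
    then show ?thesis using M_mult a'(1) u(1) by blast
  qed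
  have g_nonunit: "[g x = g y] (mod int p)" if xy: "[x = y] (mod int p)" for x y
  proof -
    have "int p dvd a' * (F x - F y)" using F_nonunit xy by (simp add: cong_iff_dvd_diff)
    then show ?thesis by (simp add: g_def cong_iff_dvd_diff algebra_simps)
  qed
  have g_unit0: "\<exists>u\<in>M. [g x = x * u] (mod int n)" if "\<not> int p dvd x" for x
    using g_unit [of x 0] that g0 by simp
  have g_unit1: "\<exists>u\<in>M. [g x - 1 = (x - 1) * u] (mod int n)" if x: "\<not> int p dvd x - 1" for x
  proof -
    obtain u where u: "u \<in> M" "[g x - g 1 = (x - 1) * u] (mod int n)" using g_unit [OF x] by blast
    have "[g x - 1 = g x - g 1] (mod int n)" by (rule cong_diff [OF cong_refl cong_sym [OF g1]])
    then show ?thesis using u cong_trans by blast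
  qed
  have g_class: "[g c = c] (mod int p)" for c
  proof -
    consider "int p dvd c" | "int p dvd c - 1" | "\<not> int p dvd c" "\<not> int p dvd c - 1" by blast
    then show ?thesis
    proof cases
      case 1
      then have c: "[c = 0] (mod int p)" by (simp add: cong_iff_dvd_diff)
      show ?thesis using g_nonunit [OF c] c g0 by (simp add: Cong.cong_def)
    next
      case 2
      then have c: "[c = 1] (mod int p)" by (simp add: cong_iff_dvd_diff)
      show ?thesis using g_nonunit [OF c] c modp [OF g1] by (simp add: Cong.cong_def)
    next
      case 3
      \<comment> \<open>For t < p these lifts of the class of \<open>c\<close> are distinct modulo
        p^2, a divisor of \<open>n\<close> because k >= 2.\<close>
      define X where "X t = c + int p * int t" for t :: nat
      have X: "[X t = c] (mod int p)" for t by (simp add: X_def cong_iff_dvd_diff)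
      have X0: "\<not> int p dvd X t" for t
        using 3(1) by (simp add: X_def dvd_add_left_iff)
      have X1: "\<not> int p dvd X t - 1" for t
      proof -
        have "X t - 1 = (c - 1) + int p * int t" by (simp add: X_def)
        then show ?thesis using 3(2) by (simp only: dvd_add_left_iff dvd_triv_left not_False_eq_True)
      qed
      obtain u where u: "\<And>t. u t \<in> M" "\<And>t. [g (X t) = X t * u t] (mod int n)"
        using g_unit0 [OF X0] by metis
      obtain v where v: "\<And>t. v t \<in> M" "\<And>t. [g (X t) - 1 = (X t - 1) * v t] (mod int n)"
        using g_unit1 [OF X1] by metis
      \<comment> \<open>Eliminating \<open>g (X t)\<close> leaves X u - 1 = (X - 1) v, a relation
        between \<open>X t\<close> and two elements of \<open>M\<close>.\<close>
      have uv: "int n dvd X t * (u t - v t) - (1 - v t)" for t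
      proof -
        have "int n dvd ((g (X t) - 1) - (X t - 1) * v t) - (g (X t) - X t * u t)"
          using u(2) [of t] v(2) [of t] unfolding cong_iff_dvd_diff by (simp only: dvd_add dvd_diff dvd_mult dvd_mult2)
        then show ?thesis by (simp add: algebra_simps)
      qed
      \<comment> \<open>There are \<open>p\<close> lifts but only \<open>p - 1\<close> unit classes,
        so two lifts share \<open>v\<close>, and then also \<open>u\<close>. With u - v a unit, the
        relation determines X modulo \<open>n\<close>, so the two lifts would coincide.\<close>
      have "\<exists>t. [u t = v t] (mod int p)"
      proof (rule ccontr)
        assume *: "\<nexists>t. [u t = v t] (mod int p)"
        have "(\<lambda>t. v t mod int p) ` {..<p} \<subseteq> {1..<int p}"
        proof (rule image_subsetI)
          fix t
          have "v t mod int p \<noteq> 0" using M_unit [OF v(1)] by (simp add: dvd_eq_mod_eq_0)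
          moreover have "0 \<le> v t mod int p" "v t mod int p < int p" using p0 by simp_all
          ultimately show "v t mod int p \<in> {1..<int p}" by simp
        qed
        then have "card ((\<lambda>t. v t mod int p) ` {..<p}) \<le> card {1..<int p}"
          by (intro card_mono) auto
        then have "\<not> inj_on (\<lambda>t. v t mod int p) {..<p}"
          using p0 pigeonhole [of "\<lambda>t. v t mod int p" "{..<p}"] by simp
        then obtain s t where st: "s < p" "t < p" "s \<noteq> t" "[v s = v t] (mod int p)"
          unfolding inj_on_def Cong.cong_def by blast
        have vv: "int n dvd v s - v t"
          using M_inj [OF v(1) v(1) st(4)] by (simp add: cong_iff_dvd_diff)
        have "int p dvd X t - X s" by (simp add: X_def algebra_simps)
        then have "int p dvd (X s * (u s - v s) - (1 - v s)) - (X t * (u t - v t) - (1 - v t))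
            + (X s - 1) * (v s - v t) + (X t - X s) * (u t - v t)"
          using dvd_trans [OF pn uv] dvd_trans [OF pn vv] by (simp only: dvd_add dvd_diff dvd_mult dvd_mult2)
        then have "int p dvd X s * (u s - u t)" by (simp add: algebra_simps)
        then have "[u s = u t] (mod int p)"
          using X0 ip by (simp add: prime_dvd_mult_iff cong_iff_dvd_diff)
        then have uu: "int n dvd u s - u t"
          using M_inj [OF u(1) u(1)] by (simp add: cong_iff_dvd_diff)
        have "int n dvd (X s * (u s - v s) - (1 - v s)) - (X t * (u t - v t) - (1 - v t))
            + (X s - 1) * (v s - v t) - X s * (u s - u t)"
          using uv vv uu by (simp only: dvd_add dvd_diff dvd_mult dvd_mult2)
        then have "int n dvd (u t - v t) * (X s - X t)" by (simp add: algebra_simps)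
        moreover have "coprime (u t - v t) (int n)"
          using * by (intro cop) (simp add: cong_iff_dvd_diff)
        ultimately have "int n dvd X s - X t"
          by (simp add: coprime_dvd_mult_right_iff coprime_commute)
        moreover have "(int p)\<^sup>2 dvd int n" using k by (simp add: n le_imp_power_dvd)
        ultimately have "int p * int p dvd int p * (int s - int t)"
          unfolding X_def by (auto simp: power2_eq_square algebra_simps intro: dvd_trans)
        then have "[int s = int t] (mod int p)" using p0 by (simp add: cong_iff_dvd_diff)
        then show False using st by (simp add: cong_int_iff Cong.cong_def)
      qed
      then obtain t where t: "[u t = v t] (mod int p)" by blast
      \<comment> \<open>With u = v the relation gives v = 1, so \<open>g\<close> fixes the lift
        \<open>X t\<close> and hence its class.\<close>
      have "int n dvd u t - v t"
        using M_inj [OF u(1) v(1) t] by (simp add: cong_iff_dvd_diff)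
      then have "int n dvd (X t * (u t - v t) - (1 - v t)) - X t * (u t - v t) + (u t - v t)"
        using uv by (simp only: dvd_add dvd_diff dvd_mult dvd_mult2)
      then have "int n dvd X t * (u t - 1)" by (intro dvd_mult) simp
      then have "int n dvd (g (X t) - X t * u t) + X t * (u t - 1)"
        using u(2) [of t] unfolding cong_iff_dvd_diff by (intro dvd_add)
      then have "[g (X t) = X t] (mod int n)"
        by (simp add: cong_iff_dvd_diff algebra_simps)
      then have "[g (X t) = X t] (mod int p)" by (rule modp)
      then show ?thesis using g_nonunit [OF X [of t]] X [of t] by (simp add: Cong.cong_def)
    qed
  qed
  \<comment> \<open>Since \<open>g\<close> preserves classes modulo \<open>p\<close>, the unit by
    which it scales \<open>x\<close> is 1 modulo \<open>p\<close>, hence 1. For multiples of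
    \<open>p\<close> the difference to 1 replaces the difference to 0.\<close>
  have g_id: "[g x = x] (mod int n)" for x
  proof (cases "int p dvd x")
    case False
    then obtain u where u: "u \<in> M" "[g x = x * u] (mod int n)" using g_unit0 by blast
    have "int p dvd (g x - x) - (g x - x * u)"
      using g_class [of x] modp [OF u(2)] unfolding cong_iff_dvd_diff by (simp only: dvd_add dvd_diff dvd_mult dvd_mult2)
    then have "int p dvd x * (u - 1)" by (simp add: algebra_simps)
    then have "[u = 1] (mod int p)" using False ip by (simp add: prime_dvd_mult_iff cong_iff_dvd_diff)
    then have "[x * u = x * 1] (mod int n)" by (intro cong_scalar_left M_kernel u(1))
    then show ?thesis using u(2) cong_trans by auto
  next
    case True
    then have x1: "\<not> int p dvd x - 1"
      using p0 by (simp add: dvd_diff_right_iff)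
    then obtain u where u: "u \<in> M" "[g x - 1 = (x - 1) * u] (mod int n)" using g_unit1 by blast
    have "int p dvd (g x - x) - (g x - 1 - (x - 1) * u)"
      using g_class [of x] modp [OF u(2)] unfolding cong_iff_dvd_diff by (simp only: dvd_add dvd_diff dvd_mult dvd_mult2)
    then have "int p dvd (x - 1) * (u - 1)" by (simp add: algebra_simps)
    then have "[u = 1] (mod int p)" using x1 ip by (simp add: prime_dvd_mult_iff cong_iff_dvd_diff)
    then have "[(x - 1) * u = (x - 1) * 1] (mod int n)" by (intro cong_scalar_left M_kernel u(1))
    then have "[g x - 1 = x - 1] (mod int n)" using u(2) cong_trans by auto
    then show ?thesis by (simp add: cong_iff_dvd_diff)
  qed
  have "[F x = a * x + F 0] (mod int n)" for x
  proof -
    have "int n dvd a * (g x - x) - (a * a' - 1) * (F x - F 0)"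
      using g_id [of x] a'(2) unfolding cong_iff_dvd_diff by (simp only: dvd_add dvd_diff dvd_mult dvd_mult2)
    then show ?thesis by (simp add: g_def cong_iff_dvd_diff algebra_simps)
  qed
  then show ?thesis by blast
qed

end

section \<open>Prime order\<close>

lemma coeff_shift_power:
  "coeff ([:u, 1:] ^ i) m = of_nat (i choose m) * (u :: 'a :: comm_ring_1) ^ (i - m)"
proof (cases "m \<le> i")
  case True
  then show ?thesis by (simp add: coeff_linear_poly_power)
next
  case False
  have "degree ([:u, 1:] ^ i) \<le> 1 * i"
    by (rule order_trans [OF degree_power_le]) simp
  then show ?thesis using False by (simp add: coeff_eq_0 binomial_eq_0)
qed

text \<open>Lagrange's bound on the number of roots over the field with \<open>p\<close> elements,
  for integer coefficients: synthetic division at a root costs one degree and one root.\<close>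

lemma poly_roots_mod_prime:
  fixes h :: "int poly"
  assumes p: "prime p" and A: "finite A" "\<And>a b. a \<in> A \<Longrightarrow> b \<in> A \<Longrightarrow> p dvd a - b \<Longrightarrow> a = b"
    and roots: "\<And>a. a \<in> A \<Longrightarrow> p dvd poly h a" and deg: "degree h < card A"
  shows "p dvd coeff h i"
  using assms
proof (induction "degree h" arbitrary: h A i)
  case 0
  then obtain a where a: "a \<in> A" by (metis card.empty equals0I less_nat_zero_code)
  obtain c where "h = [:c:]" using 0 by (metis degree_eq_zeroE)
  then show ?case using 0(5) [OF a] by (cases i) auto
next
  case (Suc d)
  then obtain a where a: "a \<in> A" by (metis card.empty equals0I less_nat_zero_code)
  define g where "g = synthetic_div h a"
  have h: "[:- a, 1:] * g + [:poly h a:] = h" unfolding g_def by (rule synthetic_div_correct')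
  have dg: "degree g = d" using Suc(2) by (simp add: g_def degree_synthetic_div)
  have g: "p dvd coeff g j" for j
  proof (rule Suc.hyps(1) [of g "A - {a}"])
    show "d = degree g" using dg by simp
    show "degree g < card (A - {a})" using dg Suc a by simp
    fix b assume b: "b \<in> A - {a}"
    have "poly h b = (b - a) * poly g b + poly h a"
      by (subst h [symmetric]) (simp add: algebra_simps)
    then have "p dvd (b - a) * poly g b"
      using Suc.prems(4) [of a] Suc.prems(4) [of b] a b by (metis DiffD1 dvd_add_left_iff)
    then show "p dvd poly g b"
      using Suc.prems(3) [of b a] a b p by (auto simp: prime_dvd_mult_iff)
  qed (use Suc in auto)
  have "coeff h i = coeff ([:- a, 1:] * g) i + coeff [:poly h a:] i"
    by (subst h [symmetric]) simp
  moreover have "p dvd coeff ([:- a, 1:] * g) i"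
    by (cases i) (auto intro!: dvd_add dvd_diff g dvd_mult simp: coeff_pCons)
  moreover have "p dvd coeff [:poly h a:] i"
    using Suc.prems(4) [OF a] by (cases i) auto
  ultimately show ?case by (simp only: dvd_add)
qed

text \<open>By Fermat, 1 - (x - a)^(p - 1) is the indicator of the class of \<open>a\<close> modulo
  \<open>p\<close>.\<close>

lemma exists_interpolating_poly:
  assumes p: "prime p" and F: "\<And>x y. [x = y] (mod int p) \<Longrightarrow> [F x = F y] (mod int p)"
  shows "\<exists>q :: int poly. degree q \<le> p - 1 \<and> (\<forall>x. [poly q x = F x] (mod int p))"
proof -
  have p1: "p > 1" using p prime_gt_1_nat by blast
  define q :: "int poly" where "q = (\<Sum>a\<in>{0..<int p}. smult (F a) (1 - [:- a, 1:] ^ (p - 1)))"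
  have "degree (1 - [:- a, 1:] ^ (p - 1)) \<le> p - 1" for a :: int
  proof (rule degree_diff_le)
    show "degree ([:- a, 1:] ^ (p - 1)) \<le> p - 1"
      by (rule order_trans [OF degree_power_le]) simp
  qed simp
  then have deg: "degree q \<le> p - 1"
    unfolding q_def by (intro degree_sum_le) (auto intro: order_trans [OF degree_smult_le])
  have "[poly q x = F x] (mod int p)" for x
  proof -
    have "[F a * (1 - (x - a) ^ (p - 1)) = (if a = x mod int p then F x else 0)] (mod int p)"
      if a: "a \<in> {0..<int p}" for a
    proof (cases "a = x mod int p")
      case True
      then have xa: "[x = a] (mod int p)" by (simp add: Cong.cong_def)
      then have "int p dvd x - a" by (simp add: cong_iff_dvd_diff)
      also have "x - a dvd (x - a) ^ (p - 1)" using p1 by (intro dvd_power) simp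
      finally have "int p dvd (x - a) ^ (p - 1)" .
      then have "int p dvd F a * (x - a) ^ (p - 1)" by (rule dvd_mult)
      moreover have "int p dvd F a - F x" using F [OF cong_sym [OF xa]] by (simp add: cong_iff_dvd_diff)
      ultimately have "int p dvd (F a - F x) - F a * (x - a) ^ (p - 1)" by (simp only: dvd_diff)
      then show ?thesis using True by (simp add: cong_iff_dvd_diff algebra_simps)
    next
      case False
      then have "\<not> int p dvd x - a"
        using a by (simp add: mod_eq_dvd_iff [symmetric])
      then have "coprime (x - a) (int p)"
        using p prime_imp_coprime [of "int p" "x - a"] by (simp add: coprime_commute)
      then have "[(x - a) ^ (p - 1) = 1] (mod int p)"
        using residues.euler_theorem [of "int p" "x - a"] p1 totient_prime [OF p] by (simp add: residues_def)
      then have "int p dvd F a * ((x - a) ^ (p - 1) - 1)" by (simp add: cong_iff_dvd_diff)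
      then show ?thesis using False by (simp add: cong_iff_dvd_diff algebra_simps dvd_diff_commute)
    qed
    then have "[(\<Sum>a\<in>{0..<int p}. F a * (1 - (x - a) ^ (p - 1)))
        = (\<Sum>a\<in>{0..<int p}. if a = x mod int p then F x else 0)] (mod int p)"
      by (intro cong_sum)
    also have "(\<Sum>a\<in>{0..<int p}. if a = x mod int p then F x else 0) = F x"
      using p1 by simp
    finally show ?thesis by (simp add: q_def poly_sum)
  qed
  then show ?thesis using deg by blast
qed

text \<open>Leading terms that vanish modulo \<open>m\<close> are stripped, so that
  \<open>degree q\<close> becomes the degree modulo \<open>m\<close>. A constant may still vanish,
  hence the proviso.\<close>

lemma exists_minimal_poly:
  assumes q: "degree q \<le> d" "\<And>x. [poly q x = F x] (mod m)"
  shows "\<exists>q :: int poly. degree q \<le> d \<and> (\<forall>x. [poly q x = F x] (mod m))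
    \<and> (degree q \<ge> 1 \<longrightarrow> \<not> m dvd lead_coeff q)"
  using q
proof (induction "degree q" arbitrary: q rule: less_induct)
  case less
  show ?case
  proof (cases "degree q \<ge> 1 \<and> m dvd lead_coeff q")
    case False
    then show ?thesis using less by blast
  next
    case True
    define r where "r = q - monom (lead_coeff q) (degree q)"
    have "degree r < degree q"
      using True by (intro degree_lessI) (auto simp: r_def coeff_eq_0)
    moreover have "[poly r x = F x] (mod m)" for x
    proof -
      have "m dvd lead_coeff q * x ^ degree q" using True by simp
      moreover have "m dvd poly q x - F x" using less(3) by (simp add: cong_iff_dvd_diff)
      ultimately have "m dvd (poly q x - F x) - lead_coeff q * x ^ degree q" by (simp only: dvd_diff)
      then show ?thesis by (simp add: r_def cong_iff_dvd_diff poly_monom algebra_simps)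
    qed
    ultimately show ?thesis using less(1) [of r] less(2) by simp
  qed
qed

text \<open>The monic polynomial with root set \<open>U\<close>, summed over \<open>U\<close>, gives
  0. If all these power sums vanished, only its constant coefficient times \<open>card U\<close>
  would remain, a product of two units modulo \<open>p\<close>.\<close>

lemma exists_power_sum_not_dvd:
  fixes U :: "int set"
  assumes p: "prime p" and U: "finite U" "U \<noteq> {}" "card U < p" "\<And>u. u \<in> U \<Longrightarrow> \<not> int p dvd u"
  shows "\<exists>r\<ge>1. r \<le> card U \<and> \<not> int p dvd (\<Sum>u\<in>U. u ^ r)"
proof (rule ccontr)
  assume *: "\<not> ?thesis"
  define g :: "int poly" where "g = (\<Prod>u\<in>U. [:- u, 1:])"
  have dg: "degree g = card U" unfolding g_def by (subst degree_prod_eq_sum_degree) auto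
  have "(\<Sum>u\<in>U. poly g u) = (\<Sum>u\<in>U. \<Sum>i\<le>card U. coeff g i * u ^ i)"
    by (simp add: poly_altdef dg)
  also have "\<dots> = (\<Sum>i\<le>card U. coeff g i * (\<Sum>u\<in>U. u ^ i))"
    by (subst sum.swap) (simp add: sum_distrib_left)
  also have "\<dots> = coeff g 0 * int (card U) + (\<Sum>i\<in>{1..card U}. coeff g i * (\<Sum>u\<in>U. u ^ i))"
    by (subst sum.atMost_shift) (simp add: sum.atLeast1_atMost_eq)
  finally have "coeff g 0 * int (card U)
      = (\<Sum>u\<in>U. poly g u) - (\<Sum>i\<in>{1..card U}. coeff g i * (\<Sum>u\<in>U. u ^ i))" by simp
  moreover have "(\<Sum>u\<in>U. poly g u) = 0"
    unfolding g_def poly_prod using U(1) by (intro sum.neutral) auto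
  moreover have "int p dvd (\<Sum>i\<in>{1..card U}. coeff g i * (\<Sum>u\<in>U. u ^ i))"
  proof (rule dvd_sum)
    fix i assume "i \<in> {1..card U}"
    then have "int p dvd (\<Sum>u\<in>U. u ^ i)" using * by simp
    then show "int p dvd coeff g i * (\<Sum>u\<in>U. u ^ i)" by (rule dvd_mult)
  qed
  ultimately have "int p dvd coeff g 0 * int (card U)" by simp
  moreover have "\<not> int p dvd int (card U)"
    using U by (auto dest: dvd_imp_le simp: card_gt_0_iff)
  moreover have "\<not> int p dvd coeff g 0"
  proof -
    have "coeff g 0 = (\<Prod>u\<in>U. - u)" by (simp add: g_def poly_0_coeff_0 [symmetric] poly_prod)
    then show ?thesis using U p by (simp add: prime_dvd_prod_iff)
  qed
  ultimately show False using p by (simp add: prime_dvd_mult_iff)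
qed

context residue_perm
begin

text \<open>Mueller's polynomial proof of Burnside's theorem on permutation groups of prime degree:
  let \<open>r\<close> be least such that the \<open>r\<close>-th power sum over \<open>U\<close> does not vanish, and \<open>q\<close> a polynomial of
  degree \<open>e \<ge> 2\<close> that represents \<open>F\<close>. For \<open>r \<le> e k < n\<close> the sums over \<open>u \<in> U\<close> of \<open>(q\<^sup>k)(X + u)\<close> and of
  \<open>(q(X) + u)\<^sup>k\<close> agree as functions, but not in the coefficient of \<open>X\<close> to the power \<open>e k - r\<close>.\<close>

lemma affine_if_prime_small_set:
  assumes p: "prime n" and U: "U \<noteq> {}" "U \<subseteq> {1..<int n}" "2 * card U \<le> n - 1"
    and A: "stable A" "U = A \<inter> {1..<int n}"
  shows "\<exists>a b. \<forall>x. [F x = a * x + b] (mod int n)"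
proof -
  have p1: "n > 1" using p prime_gt_1_nat by blast
  have ip: "prime (int n)" using p by simp
  have finU: "finite U" using U(2) finite_subset by blast
  have U_nz: "\<not> int n dvd u" if "u \<in> U" for u
    using that U(2) zdvd_not_zless [of u "int n"] by force
  define s where "s j = (\<Sum>u\<in>U. u ^ j)" for j
  define r where "r = (LEAST r. r \<ge> 1 \<and> \<not> int n dvd s r)"
  have "card U < n" using U(3) p1 by linarith
  then obtain r0 where r0: "r0 \<ge> 1" "r0 \<le> card U" "\<not> int n dvd s r0"
    using exists_power_sum_not_dvd [OF p finU U(1) _ U_nz] unfolding s_def by blast
  have r: "r \<ge> 1" "\<not> int n dvd s r"
    using LeastI [of "\<lambda>r. r \<ge> 1 \<and> \<not> int n dvd s r" r0] r0 by (simp_all add: r_def)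
  have "r \<le> r0" unfolding r_def using r0 by (intro Least_le) simp
  \<comment> \<open>The bound on \<open>card U\<close> enters here; it yields
    \<open>r \<le> e * k\<close> below.\<close>
  then have r2: "2 * r \<le> n - 1" using r0 U(3) by simp
  have s_small: "int n dvd s j" if "1 \<le> j" "j < r" for j
    using not_less_Least [of j "\<lambda>r. r \<ge> 1 \<and> \<not> int n dvd s r"] that by (auto simp: r_def)
  obtain q where q: "degree q \<le> n - 1" "\<And>x. [poly q x = F x] (mod int n)"
      "degree q \<ge> 1 \<longrightarrow> \<not> int n dvd lead_coeff q"
    using exists_interpolating_poly [OF p] F_cong exists_minimal_poly by metis
  define e where "e = degree q"
  show ?thesis
  proof (cases "e \<le> 1")
    case True
    then have "degree q < 2" by (simp add: e_def)
    then have "q = [:coeff q 0, coeff q 1:]"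
      by (intro poly_eqI) (auto simp: coeff_pCons coeff_eq_0 split: nat.splits)
    then have "poly q x = coeff q 1 * x + coeff q 0" for x
      by (metis add.commute mult.commute mult_zero_right add_0_right poly_0 poly_pCons)
    then show ?thesis using q(2) cong_sym by metis
  next
    case False
    then have e: "e \<ge> 2" by simp
    \<comment> \<open>The largest exponent with e k < n. Degrees stay below the number of residues,
      while n - 1 < e k + e <= 2 e k forces r <= e k.\<close>
    define k where "k = (n - 1) div e"
    have ek: "e * k \<le> n - 1" unfolding k_def by simp
    have k1: "k \<ge> 1"
      using q(1) e by (simp add: k_def e_def [symmetric] Suc_le_eq div_greater_zero_iff)
    have rek: "r \<le> e * k"
    proof (rule ccontr)
      assume "\<not> r \<le> e * k"
      moreover have "n - 1 < e * k + e"
        using e dividend_less_times_div [of e "n - 1"] by (simp add: k_def add.commute)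
      moreover have "e \<le> e * k" using k1 by simp
      ultimately show False using r2 by linarith
    qed
    define m where "m = e * k - r"
    define Q where "Q = q ^ k"
    have q0: "q \<noteq> 0" using e by (auto simp: e_def)
    have dQ: "degree Q = e * k" using q0 by (simp add: Q_def degree_power_eq e_def mult.commute)
    define R where "R u = (\<Sum>i\<le>e * k. smult (coeff Q i) ([:u, 1:] ^ i))" for u
    define H where "H = (\<Sum>u\<in>U. R u - (q + [:u:]) ^ k)"
    have poly_R: "poly (R u) x = poly Q (u + x)" for u x
      by (simp add: R_def poly_sum poly_altdef [of Q] dQ)
    have "degree H \<le> e * k"
      unfolding H_def
    proof (intro degree_sum_le finU degree_diff_le)
      fix u :: int
      have "degree ([:u, 1:] ^ i) \<le> 1 * i" for i
        by (rule order_trans [OF degree_power_le]) simp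
      then show "degree (R u) \<le> e * k"
        unfolding R_def
        by (intro degree_sum_le) (auto intro!: order_trans [OF degree_smult_le] intro: order_trans)
      have "degree ((q + [:u:]) ^ k) \<le> degree (q + [:u:]) * k" by (rule degree_power_le)
      also have "\<dots> \<le> e * k" unfolding e_def by (intro mult_le_mono1 degree_add_le) auto
      finally show "degree ((q + [:u:]) ^ k) \<le> e * k" .
    qed
    then have dH: "degree H < card {0..<int n}" using ek p1 by simp
    \<comment> \<open>Stability makes F (x + u) - F x, reduced modulo \<open>n\<close>, run through
      \<open>U\<close> as \<open>u\<close> does, so both power sums have the same terms.\<close>
    have "int n dvd poly H x" for x
    proof -
      define f where "f u = (F (x + u) - F x) mod int n" for u
      have fU: "f u \<in> U" if "u \<in> U" for u
      proof -
        have "F (x + u) - F x \<in> A" using stable_diff_iff [OF A(1), of "x + u" x] that A(2) by simp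
        then have "f u \<in> A"
          using stable_congD [OF A(1), of "f u" "F (x + u) - F x"] by (simp add: f_def)
        moreover have "f u \<noteq> 0"
        proof
          assume "f u = 0"
          then have "[F (x + u) = F x] (mod int n)" by (simp add: f_def cong_iff_dvd_diff mod_0_imp_dvd)
          then show False using F_cong U_nz [OF that] by (simp add: cong_iff_dvd_diff)
        qed
        moreover have "0 \<le> f u" "f u < int n" using p1 by (simp_all add: f_def)
        ultimately show ?thesis unfolding A(2) by simp
      qed
      have "inj_on f U"
      proof (rule inj_onI)
        fix u v assume uv: "u \<in> U" "v \<in> U" "f u = f v"
        then have "int n dvd (F (x + u) - F x) - (F (x + v) - F x)"
          unfolding f_def by (simp only: mod_eq_dvd_iff)
        then have "[F (x + u) = F (x + v)] (mod int n)" by (simp add: cong_iff_dvd_diff)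
        then have "[u = v] (mod int n)" using F_cong by (simp add: cong_iff_dvd_diff)
        moreover have "0 \<le> u" "u < int n" "0 \<le> v" "v < int n" using uv U(2) by force+
        ultimately show "u = v" by (simp add: Cong.cong_def)
      qed
      then have "f ` U = U" using fU finU by (intro endo_inj_surj) auto
      then have "(\<Sum>u\<in>U. (F x + u) ^ k) = (\<Sum>u\<in>U. (F x + f u) ^ k)"
        using sum.reindex [OF \<open>inj_on f U\<close>, of "\<lambda>u. (F x + u) ^ k"] by (simp add: o_def)
      moreover have "[(\<Sum>u\<in>U. (F x + f u) ^ k) = (\<Sum>u\<in>U. poly q (x + u) ^ k)] (mod int n)"
      proof (intro cong_sum cong_pow)
        fix u
        have "[F x + f u = F (x + u)] (mod int n)"
          by (simp add: f_def Cong.cong_def mod_add_right_eq)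
        then show "[F x + f u = poly q (x + u)] (mod int n)"
          by (rule cong_trans [OF _ cong_sym [OF q(2)]])
      qed
      moreover have "[(\<Sum>u\<in>U. (F x + u) ^ k) = (\<Sum>u\<in>U. (poly q x + u) ^ k)] (mod int n)"
        by (intro cong_sum cong_pow cong_add cong_refl cong_sym [OF q(2)])
      ultimately have "[(\<Sum>u\<in>U. poly q (x + u) ^ k) = (\<Sum>u\<in>U. (poly q x + u) ^ k)] (mod int n)"
        by (simp only: Cong.cong_def)
      moreover have "poly H x = (\<Sum>u\<in>U. poly q (x + u) ^ k) - (\<Sum>u\<in>U. (poly q x + u) ^ k)"
        by (simp add: H_def poly_sum poly_R sum_subtractf Q_def add.commute)
      ultimately show ?thesis by (simp add: cong_iff_dvd_diff)
    qed
    then have H_coeff: "int n dvd coeff H m"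
      using poly_roots_mod_prime [OF ip, of "{0..<int n}" H] dH
      by (auto simp: mod_eq_dvd_iff [symmetric])
    \<comment> \<open>The term of index \<open>i\<close> carries the power sum of order i - m, which
      vanishes modulo \<open>n\<close> for 0 < i - m < r; only i = m and i = e k survive.\<close>
    have R_coeff: "int n dvd (\<Sum>u\<in>U. coeff (R u) m)
        - (coeff Q m * s 0 + coeff Q (e * k) * int (e * k choose m) * s r)"
    proof -
      define t where "t i = coeff Q i * int (i choose m) * s (i - m)" for i
      have "(\<Sum>u\<in>U. coeff (R u) m) = (\<Sum>i\<le>e * k. t i)"
        unfolding R_def coeff_sum coeff_smult coeff_shift_power
        by (subst sum.swap) (simp add: t_def s_def sum_distrib_left mult.assoc)
      also have "\<dots> = (\<Sum>i\<in>{..e * k} - {m, e * k}. t i) + (\<Sum>i\<in>{m, e * k}. t i)"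
        by (rule sum.subset_diff) (auto simp: m_def)
      also have "(\<Sum>i\<in>{m, e * k}. t i) = t m + t (e * k)"
        using r(1) rek by (simp add: m_def)
      finally have "(\<Sum>u\<in>U. coeff (R u) m) - (t m + t (e * k))
          = (\<Sum>i\<in>{..e * k} - {m, e * k}. t i)" by simp
      moreover have "int n dvd (\<Sum>i\<in>{..e * k} - {m, e * k}. t i)"
      proof (rule dvd_sum)
        fix i assume i: "i \<in> {..e * k} - {m, e * k}"
        show "int n dvd t i"
        proof (cases "i < m")
          case True
          then show ?thesis by (simp add: t_def binomial_eq_0)
        next
          case False
          then have "1 \<le> i - m" "i - m < r" using i rek by (auto simp: m_def)
          then show ?thesis unfolding t_def by (intro dvd_mult s_small)
        qed
      qed
      moreover have "e * k - m = r" using rek by (simp add: m_def)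
      ultimately show ?thesis by (simp add: t_def)
    qed
    \<comment> \<open>Terms with 0 < j < r vanish by the choice of \<open>r\<close>. For j >= r the
      degree e (k - j) is at most e k - 2 j, less than m = e k - r; this is where e >= 2 is
      decisive.\<close>
    have q_coeff: "int n dvd (\<Sum>u\<in>U. coeff ((q + [:u:]) ^ k) m) - coeff Q m * s 0"
    proof -
      define t where "t j = int (k choose j) * coeff (q ^ (k - j)) m * s j" for j
      have "coeff ((q + [:u:]) ^ k) m
          = (\<Sum>j\<le>k. int (k choose j) * coeff (q ^ (k - j)) m * u ^ j)" for u
      proof -
        have "(q + [:u:]) ^ k = ([:u:] + q) ^ k" by (simp only: add.commute)
        also have "\<dots> = (\<Sum>j\<le>k. of_nat (k choose j) * [:u:] ^ j * q ^ (k - j))"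
          by (rule binomial_ring)
        also have "\<dots> = (\<Sum>j\<le>k. smult (int (k choose j) * u ^ j) (q ^ (k - j)))"
          by (intro sum.cong) (simp_all add: of_nat_poly poly_const_pow mult.commute)
        finally show ?thesis by (simp add: coeff_sum mult_ac)
      qed
      then have "(\<Sum>u\<in>U. coeff ((q + [:u:]) ^ k) m) = (\<Sum>j\<le>k. t j)"
        by (simp only:, subst sum.swap) (simp add: t_def s_def sum_distrib_left mult.assoc)
      also have "\<dots> = t 0 + (\<Sum>j\<in>{1..k}. t j)"
        by (subst sum.atMost_shift) (simp add: sum.atLeast1_atMost_eq)
      finally have "(\<Sum>u\<in>U. coeff ((q + [:u:]) ^ k) m) - t 0 = (\<Sum>j\<in>{1..k}. t j)" by simp
      moreover have "int n dvd (\<Sum>j\<in>{1..k}. t j)"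
      proof (rule dvd_sum)
        fix j assume j: "j \<in> {1..k}"
        show "int n dvd t j"
        proof (cases "j < r")
          case True
          then show ?thesis unfolding t_def using j by (intro dvd_mult s_small) auto
        next
          case False
          have "2 * j \<le> e * j" using e by (rule mult_le_mono1)
          moreover have "e * (k - j) = e * k - e * j" by (rule diff_mult_distrib2)
          moreover have "e * j \<le> e * k" using j by simp
          ultimately have "e * (k - j) < m" using False r(1) rek unfolding m_def by linarith
          then have "coeff (q ^ (k - j)) m = 0"
            using q0 by (intro coeff_eq_0) (simp add: degree_power_eq e_def mult.commute)
          then show ?thesis by (simp add: t_def)
        qed
      qed
      ultimately show ?thesis by (simp add: t_def Q_def)
    qed
    have "coeff H m = (\<Sum>u\<in>U. coeff (R u) m) - (\<Sum>u\<in>U. coeff ((q + [:u:]) ^ k) m)"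
      by (simp add: H_def coeff_sum sum_subtractf)
    then have eq: "coeff Q (e * k) * int (e * k choose m) * s r
        = coeff H m + ((\<Sum>u\<in>U. coeff ((q + [:u:]) ^ k) m) - coeff Q m * s 0)
          - ((\<Sum>u\<in>U. coeff (R u) m)
            - (coeff Q m * s 0 + coeff Q (e * k) * int (e * k choose m) * s r))"
      by simp
    have "int n dvd coeff Q (e * k) * int (e * k choose m) * s r"
      by (rule dvd_diff [OF dvd_add [OF H_coeff q_coeff] R_coeff, folded eq])
    moreover have "\<not> int n dvd coeff Q (e * k)"
    proof -
      have "coeff Q (e * k) = lead_coeff q ^ k"
        using lead_coeff_power [of q k] dQ by (simp add: Q_def)
      then show ?thesis using q(3) e prime_dvd_power [OF ip, of "lead_coeff q" k] by (auto simp: e_def)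
    qed
    \<comment> \<open>The binomial coefficient divides the factorial of e k < n, which is prime to
      \<open>n\<close>.\<close>
    moreover have "\<not> int n dvd int (e * k choose m)"
    proof -
      have "fact m * fact (e * k - m) * (e * k choose m) = fact (e * k)"
        by (rule binomial_fact_lemma) (simp add: m_def)
      then have "(e * k choose m) dvd fact (e * k)" by (metis dvd_triv_right)
      moreover have "\<not> n dvd fact (e * k)"
        unfolding prime_dvd_fact_iff [OF p] using p1 ek by linarith
      ultimately show ?thesis using dvd_trans [of n "e * k choose m"] by auto
    qed
    ultimately show ?thesis using r(2) ip by (simp add: prime_dvd_mult_iff)
  qed
qed


text \<open>\<open>S\<close> and its complement are both stable and, by \<open>x\<close> and
  \<open>y\<close>, both contain a nonzero residue. One of them contains at most half of the nonzero
  residues, the size required for the polynomial argument.\<close>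

theorem affine_if_prime:
  assumes p: "prime n" and S: "stable S" and x: "x \<in> S" "\<not> int n dvd x"
    and y: "y \<notin> S" "\<not> int n dvd y"
  shows "\<exists>a b. \<forall>x. [F x = a * x + b] (mod int n)"
proof -
  have p0: "n > 0" using p prime_gt_0_nat by blast
  define C where "C A = A \<inter> {1..<int n}" for A
  have C: "stable (- S)" using S by (simp add: stable_def)
  have mem: "z mod int n \<in> C A" if "stable A" "z \<in> A" "\<not> int n dvd z" for A z
  proof -
    have "z mod int n \<in> A" using stable_congD [OF that(1), of "z mod int n" z] that(2) by simp
    moreover have "z mod int n \<noteq> 0" using that(3) by (simp add: dvd_eq_mod_eq_0)
    moreover have "0 \<le> z mod int n" "z mod int n < int n" using p0 by simp_all
    ultimately show ?thesis by (simp add: C_def)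
  qed
  have "x mod int n \<in> C S" by (rule mem [OF S x])
  then have "C S \<noteq> {}" by (rule ex_in_conv [THEN iffD1, OF exI])
  moreover have "y mod int n \<in> C (- S)" by (rule mem [OF C _ y(2)]) (use y(1) in simp)
  then have "C (- S) \<noteq> {}" by (rule ex_in_conv [THEN iffD1, OF exI])
  moreover have "card (C S) + card (C (- S)) = n - 1"
  proof -
    have "card (C S \<union> C (- S)) = card (C S) + card (C (- S))"
      by (rule card_Un_disjoint) (auto simp: C_def)
    moreover have "C S \<union> C (- S) = {1..<int n}" by (auto simp: C_def)
    ultimately show ?thesis using p0 by simp
  qed
  then consider "2 * card (C S) \<le> n - 1" | "2 * card (C (- S)) \<le> n - 1" by linarith
  ultimately show ?thesis
    using affine_if_prime_small_set [OF p _ _ _ S, of "C S"]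
      affine_if_prime_small_set [OF p _ _ _ C, of "C (- S)"]
    unfolding C_def by (cases; blast)
qed

end

section \<open>Automorphisms of circulant graphs\<close>

text \<open>Restricted to \<open>Zmod n\<close> because elements of \<open>BijGroup\<close> are
  extensional; equality of maps is then equality on residues.\<close>

definition affine_map :: "nat \<Rightarrow> int \<Rightarrow> int \<Rightarrow> int \<Rightarrow> int" where
  "affine_map n a b = (\<lambda>x\<in>Zmod n. (a * x + b) mod int n)"

lemma mem_Zmod: "x \<in> Zmod n \<longleftrightarrow> 0 \<le> x \<and> x < int n"
  by (simp add: Zmod_def)

lemma mod_mem_Zmod [simp]: "n > 0 \<Longrightarrow> x mod int n \<in> Zmod n"
  by (simp add: Zmod_def)

lemma Zmod_mod_eq: "x \<in> Zmod n \<Longrightarrow> x mod int n = x"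
  by (simp add: Zmod_def)

lemma finite_Zmod [simp]: "finite (Zmod n)"
  by (simp add: Zmod_def)

lemma Zmod_cong_imp_eq: "x \<in> Zmod n \<Longrightarrow> y \<in> Zmod n \<Longrightarrow> [x = y] (mod int n) \<Longrightarrow> x = y"
  by (simp add: Cong.cong_def Zmod_mod_eq)

lemma affine_map_Bij:
  assumes n: "n > 0" and a: "coprime a (int n)"
  shows "affine_map n a b \<in> Bij (Zmod n)"
proof -
  have "inj_on (affine_map n a b) (Zmod n)"
  proof (rule inj_onI)
    fix x y assume xy: "x \<in> Zmod n" "y \<in> Zmod n" "affine_map n a b x = affine_map n a b y"
    then have "int n dvd (a * x + b) - (a * y + b)"
      by (simp add: affine_map_def mod_eq_dvd_iff)
    then have "int n dvd a * (x - y)" by (simp add: algebra_simps)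
    then have "int n dvd x - y"
      using a by (simp add: coprime_dvd_mult_right_iff coprime_commute)
    then show "x = y" using Zmod_cong_imp_eq xy(1,2) by (simp add: cong_iff_dvd_diff)
  qed
  moreover have "affine_map n a b ` Zmod n \<subseteq> Zmod n" using n by (auto simp: affine_map_def)
  ultimately have "affine_map n a b ` Zmod n = Zmod n" by (simp add: endo_inj_surj)
  then show ?thesis
    using \<open>inj_on _ _\<close> by (simp add: Bij_def bij_betw_def affine_map_def)
qed

lemma affine_map_compose:
  assumes "n > 0"
  shows "compose (Zmod n) (affine_map n a b) (affine_map n c d) = affine_map n (a * c) (a * d + b)"
proof
  fix x
  have "(a * ((c * x + d) mod int n) + b) mod int n = (a * (c * x + d) + b) mod int n"
    by (metis mod_add_left_eq mod_mult_right_eq)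
  then show "compose (Zmod n) (affine_map n a b) (affine_map n c d) x
      = affine_map n (a * c) (a * d + b) x"
    using assms by (simp add: compose_def affine_map_def algebra_simps)
qed

lemma affine_map_cong:
  assumes "[a = a'] (mod int n)" "[b = b'] (mod int n)"
  shows "affine_map n a b = affine_map n a' b'"
proof -
  have "[a * x + b = a' * x + b'] (mod int n)" for x
    by (intro cong_add cong_mult cong_refl assms)
  then show ?thesis by (simp add: affine_map_def Cong.cong_def)
qed

lemma rho_eq: "rho n = affine_map n 1 1"
  by (simp add: rho_def affine_map_def)

lemma iota_eq: "iota n = affine_map n (- 1) 0"
  by (simp add: iota_def affine_map_def)

lemma one_eq: "\<one>\<^bsub>BijGroup (Zmod n)\<^esub> = affine_map n 1 0"
  by (auto simp: BijGroup_def affine_map_def Zmod_mod_eq fun_eq_iff)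

lemma mult_BijGroup: "f \<in> Bij S \<Longrightarrow> g \<in> Bij S \<Longrightarrow> f \<otimes>\<^bsub>BijGroup S\<^esub> g = compose S f g"
  by (simp add: BijGroup_def)

lemma carrier_BijGroup: "carrier (BijGroup S) = Bij S"
  by (simp add: BijGroup_def)

lemma inv_affine_map:
  assumes n: "n > 0" and a: "a \<in> {1, - 1 :: int}"
  shows "inv\<^bsub>BijGroup (Zmod n)\<^esub> (affine_map n a b) = affine_map n a (- (a * b))"
proof (rule group.inv_equality [OF group_BijGroup])
  have "coprime a (int n)" using a by auto
  then have *: "affine_map n a c \<in> Bij (Zmod n)" for c using affine_map_Bij [OF n] by blast
  then show "affine_map n a b \<in> carrier (BijGroup (Zmod n))"
    and "affine_map n a (- (a * b)) \<in> carrier (BijGroup (Zmod n))"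
    by (simp_all add: carrier_BijGroup)
  show "affine_map n a (- (a * b)) \<otimes>\<^bsub>BijGroup (Zmod n)\<^esub> affine_map n a b = \<one>\<^bsub>BijGroup (Zmod n)\<^esub>"
    using a * by (auto simp: mult_BijGroup affine_map_compose n one_eq)
qed

lemma affine_map_1_in_generate:
  assumes n: "n > 0" and H: "rho n \<in> H" "H \<subseteq> Bij (Zmod n)"
  shows "affine_map n 1 b \<in> generate (BijGroup (Zmod n)) H"
proof -
  have r: "affine_map n 1 c \<in> Bij (Zmod n)" for c using affine_map_Bij [OF n] by simp
  have "affine_map n 1 (int m) \<in> generate (BijGroup (Zmod n)) H" for m
  proof (induction m)
    case 0
    then show ?case using generate.one [of "BijGroup (Zmod n)" H] by (simp add: one_eq)
  next
    case (Suc m)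
    have "affine_map n 1 (int m) \<otimes>\<^bsub>BijGroup (Zmod n)\<^esub> affine_map n 1 1
        \<in> generate (BijGroup (Zmod n)) H"
      by (rule generate.eng [OF Suc generate.incl]) (use H rho_eq in simp)
    then show ?case by (simp add: mult_BijGroup r affine_map_compose n add.commute)
  qed
  moreover have "affine_map n 1 b = affine_map n 1 (int (nat (b mod int n)))"
    using n by (intro affine_map_cong) (simp_all add: Cong.cong_def)
  ultimately show ?thesis by (simp only:)
qed

lemma generate_rho:
  assumes n: "n > 0"
  shows "generate (BijGroup (Zmod n)) {rho n} = range (affine_map n 1)"
proof (intro equalityI subsetI)
  have r: "affine_map n 1 c \<in> Bij (Zmod n)" for c using affine_map_Bij [OF n] by simp
  fix f assume "f \<in> generate (BijGroup (Zmod n)) {rho n}"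
  then show "f \<in> range (affine_map n 1)"
  proof (induction rule: generate.induct)
    case (eng f g)
    then show ?case by (auto simp: mult_BijGroup r affine_map_compose n)
  qed (use n in \<open>auto simp: one_eq rho_eq inv_affine_map\<close>)
next
  fix f assume "f \<in> range (affine_map n 1)"
  then show "f \<in> generate (BijGroup (Zmod n)) {rho n}"
    using affine_map_1_in_generate [OF n, of "{rho n}"] affine_map_Bij [OF n, of 1 1]
    by (auto simp: rho_eq)
qed

lemma generate_rho_iota:
  assumes n: "n > 0"
  shows "generate (BijGroup (Zmod n)) {rho n, iota n} = {affine_map n a b | a b. a \<in> {1, - 1}}"
proof (intro equalityI subsetI)
  have r: "affine_map n a c \<in> Bij (Zmod n)" if "a \<in> {1, - 1}" for a c
    using that affine_map_Bij [OF n, of a] by auto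
  fix f assume "f \<in> generate (BijGroup (Zmod n)) {rho n, iota n}"
  then show "f \<in> {affine_map n a b | a b. a \<in> {1, - 1}}"
  proof (induction rule: generate.induct)
    case (eng f g)
    then obtain a b c d where "f = affine_map n a b" "g = affine_map n c d"
        and ac: "a \<in> {1, - 1}" "c \<in> {1, - 1}"
      by blast
    then have "f \<otimes>\<^bsub>BijGroup (Zmod n)\<^esub> g = affine_map n (a * c) (a * d + b)"
      by (simp only: mult_BijGroup r affine_map_compose n)
    moreover have "a * c \<in> {1, - 1}" using ac by auto
    ultimately show ?case by blast
  next
    case one
    have "\<one>\<^bsub>BijGroup (Zmod n)\<^esub> = affine_map n 1 0" by (rule one_eq)
    then show ?case by blast
  next
    case (incl f)
    then have "f = affine_map n 1 1 \<or> f = affine_map n (- 1) 0" by (simp add: rho_eq iota_eq)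
    then show ?case by blast
  next
    case (inv f)
    then have "f = affine_map n 1 1 \<or> f = affine_map n (- 1) 0" by (simp add: rho_eq iota_eq)
    then have "inv\<^bsub>BijGroup (Zmod n)\<^esub> f = affine_map n 1 (- 1)
        \<or> inv\<^bsub>BijGroup (Zmod n)\<^esub> f = affine_map n (- 1) 0"
      using inv_affine_map [OF n] by auto
    then show ?case by blast
  qed
next
  let ?H = "{rho n, iota n}"
  have H: "?H \<subseteq> Bij (Zmod n)"
    using affine_map_Bij [OF n, of 1] affine_map_Bij [OF n, of "- 1"] by (simp add: rho_eq iota_eq)
  fix f assume "f \<in> {affine_map n a b | a b. a \<in> {1, - 1}}"
  then obtain a b where f: "f = affine_map n a b" "a \<in> {1, - 1}" by blast
  have 1: "affine_map n 1 b \<in> generate (BijGroup (Zmod n)) ?H"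
    by (rule affine_map_1_in_generate [OF n _ H]) simp
  have "affine_map n 1 b \<otimes>\<^bsub>BijGroup (Zmod n)\<^esub> affine_map n (- 1) 0 \<in> generate (BijGroup (Zmod n)) ?H"
    by (rule generate.eng [OF 1 generate.incl]) (simp add: iota_eq)
  then have "affine_map n (- 1) b \<in> generate (BijGroup (Zmod n)) ?H"
    using affine_map_Bij [OF n, of 1] affine_map_Bij [OF n, of "- 1"]
    by (simp add: mult_BijGroup affine_map_compose n)
  then show "f \<in> generate (BijGroup (Zmod n)) ?H" using f 1 by auto
qed

lemma mem_Aut_circulant:
  "f \<in> Aut (circulant n S) \<longleftrightarrow> f \<in> Bij (Zmod n) \<and>
     (\<forall>u\<in>Zmod n. \<forall>v\<in>Zmod n. (f u - f v) mod int n \<in> S \<longleftrightarrow> (u - v) mod int n \<in> S)"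
proof -
  have "f u \<in> Zmod n" if "f \<in> Bij (Zmod n)" "u \<in> Zmod n" for u
    using that Bij_imp_funcset by blast
  then show ?thesis by (auto simp: Aut_def circulant_def)
qed

lemma Aut_subgroup: "subgroup (Aut (circulant n S)) (BijGroup (Zmod n))"
proof (rule group.subgroupI [OF group_BijGroup])
  let ?A = "Aut (circulant n S)" and ?Z = "Zmod n"
  have bij: "f \<in> Bij ?Z" if "f \<in> ?A" for f using that by (simp add: mem_Aut_circulant)
  have mem: "f u \<in> ?Z" if "f \<in> Bij ?Z" "u \<in> ?Z" for f u using that Bij_imp_funcset by blast
  show "?A \<subseteq> carrier (BijGroup ?Z)" using bij by (auto simp: carrier_BijGroup)
  have "(\<lambda>x\<in>?Z. x) \<in> ?A" by (simp add: mem_Aut_circulant id_Bij)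
  then show "?A \<noteq> {}" by blast
  show "f \<otimes>\<^bsub>BijGroup ?Z\<^esub> g \<in> ?A" if "f \<in> ?A" "g \<in> ?A" for f g
    using that mem by (simp add: mem_Aut_circulant mult_BijGroup compose_Bij) (simp add: compose_def)
  show "inv\<^bsub>BijGroup ?Z\<^esub> f \<in> ?A" if f: "f \<in> ?A" for f
  proof -
    have inv: "inv\<^bsub>BijGroup ?Z\<^esub> f = (\<lambda>x\<in>?Z. inv_into ?Z f x)"
      using inv_BijGroup bij [OF f] by blast
    have im: "f ` ?Z = ?Z" using bij [OF f] by (simp add: Bij_def bij_betw_def)
    have "(inv_into ?Z f u - inv_into ?Z f v) mod int n \<in> S \<longleftrightarrow> (u - v) mod int n \<in> S"
      if "u \<in> ?Z" "v \<in> ?Z" for u v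
    proof -
      have "inv_into ?Z f u \<in> ?Z" "inv_into ?Z f v \<in> ?Z" using that im by (simp_all add: inv_into_into)
      then have "(f (inv_into ?Z f u) - f (inv_into ?Z f v)) mod int n \<in> S
          \<longleftrightarrow> (inv_into ?Z f u - inv_into ?Z f v) mod int n \<in> S"
        using f unfolding mem_Aut_circulant by blast
      then show ?thesis using that im by (simp add: f_inv_into_f)
    qed
    then show ?thesis
      unfolding inv using restrict_inv_into_Bij [OF bij [OF f]] by (simp add: mem_Aut_circulant)
  qed
qed

lemma affine_map_in_Aut:
  assumes n: "n > 0" and a: "coprime a (int n)"
    and S: "\<And>x. (a * x) mod int n \<in> S \<longleftrightarrow> x mod int n \<in> S"
  shows "affine_map n a b \<in> Aut (circulant n S)"
proof -
  have "(affine_map n a b u - affine_map n a b v) mod int n \<in> S \<longleftrightarrow> (u - v) mod int n \<in> S"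
    if "u \<in> Zmod n" "v \<in> Zmod n" for u v
    using that S [of "u - v"] by (simp add: affine_map_def mod_diff_eq algebra_simps)
  then show ?thesis using affine_map_Bij [OF n a] by (simp add: mem_Aut_circulant)
qed

lemma Bij_affine_coprime:
  assumes n: "n > 0" and f: "affine_map n a b \<in> Bij (Zmod n)"
  shows "coprime a (int n)"
proof -
  have im: "affine_map n a b ` Zmod n = Zmod n" using f by (simp add: Bij_def bij_betw_def)
  have "(1 + b) mod int n \<in> affine_map n a b ` Zmod n" using n unfolding im by simp
  then obtain x where "x \<in> Zmod n" "(a * x + b) mod int n = (1 + b) mod int n"
    by (auto simp: affine_map_def)
  then have "[a * x = 1] (mod int n)" by (simp add: mod_eq_dvd_iff cong_iff_dvd_diff)
  then show ?thesis using coprime_iff_invertible_int by blast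
qed

text \<open>The normaliser of the translations among all permutations is the affine group: f(x + 1)
  = f(x) + b gives f(x) = b x + f(0), and conversely conjugation by an affine bijection carries
  translations to translations.\<close>

lemma normal_circulant_iff:
  assumes n: "n > 0"
  shows "normal_circulant n (circulant n S) \<longleftrightarrow> Aut (circulant n S) \<subseteq> {affine_map n a b | a b. True}"
    (is "_ \<longleftrightarrow> ?A \<subseteq> _")
proof -
  let ?B = "BijGroup (Zmod n)" and ?R = "range (affine_map n 1)"
  define G where "G = ?B\<lparr>carrier := ?A\<rparr>"
  have r: "affine_map n 1 c \<in> Bij (Zmod n)" for c using affine_map_Bij [OF n] by simp
  have bij: "f \<in> Bij (Zmod n)" if "f \<in> ?A" for f using that by (simp add: mem_Aut_circulant)
  have "affine_map n 1 b \<in> ?A" for b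
    by (rule affine_map_in_Aut [OF n]) simp_all
  then have R: "?R \<subseteq> ?A" by blast
  have G: "group G"
    unfolding G_def by (rule group.subgroup_imp_group [OF group_BijGroup Aut_subgroup])
  have "subgroup ?R ?B"
    using group.generate_is_subgroup [OF group_BijGroup, of "{rho n}" "Zmod n"] r generate_rho [OF n]
    by (simp add: carrier_BijGroup rho_eq)
  then have RG: "subgroup ?R G"
    unfolding G_def by (intro group.subgroup_incl [OF group_BijGroup] Aut_subgroup R)
  have N: "normal_circulant n (circulant n S) \<longleftrightarrow> (\<forall>f\<in>?A. ?R #>\<^bsub>G\<^esub> f = f <#\<^bsub>G\<^esub> ?R)"
    unfolding normal_circulant_def generate_rho [OF n] G_def [symmetric]
    using G RG by (auto simp: normal_def normal_axioms_def) (simp_all add: G_def)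
  have rc: "?R #>\<^bsub>G\<^esub> f = (\<lambda>b. compose (Zmod n) (affine_map n 1 b) f) ` UNIV"
    and lc: "f <#\<^bsub>G\<^esub> ?R = (\<lambda>b. compose (Zmod n) f (affine_map n 1 b)) ` UNIV" if f: "f \<in> ?A" for f
    by (auto simp: r_coset_def l_coset_def G_def mult_BijGroup r bij [OF f])
  show ?thesis
  proof
    assume "normal_circulant n (circulant n S)"
    then have N: "?R #>\<^bsub>G\<^esub> f = f <#\<^bsub>G\<^esub> ?R" if "f \<in> ?A" for f using N that by blast
    show "?A \<subseteq> {affine_map n a b | a b. True}"
    proof
      fix f assume f: "f \<in> ?A"
      have "compose (Zmod n) f (affine_map n 1 1) \<in> ?R #>\<^bsub>G\<^esub> f"
        unfolding N [OF f] lc [OF f] by blast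
      then obtain b where b: "compose (Zmod n) f (affine_map n 1 1) = compose (Zmod n) (affine_map n 1 b) f"
        unfolding rc [OF f] by blast
      have mem: "f u \<in> Zmod n" if "u \<in> Zmod n" for u
        using that Bij_imp_funcset [OF bij [OF f]] by blast
      have step: "f ((x + 1) mod int n) = (f x + b) mod int n" if "x \<in> Zmod n" for x
        using fun_cong [OF b, of x] that mem by (simp add: compose_def affine_map_def add.commute)
      have val: "f (int m) = (b * int m + f 0) mod int n" if "m < n" for m
        using that
      proof (induction m)
        case 0
        then show ?case using mem [of 0] n by (simp add: Zmod_mod_eq mem_Zmod)
      next
        case (Suc m)
        then have "f (int (Suc m)) = (f (int m) + b) mod int n"
          using step [of "int m"] by (simp add: mem_Zmod add.commute)
        then show ?case using Suc by (simp add: mod_simps algebra_simps)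
      qed
      have "f = affine_map n b (f 0)"
      proof (rule extensionalityI [of _ "Zmod n"])
        show "f \<in> extensional (Zmod n)" using bij [OF f] by (simp add: Bij_def)
        show "affine_map n b (f 0) \<in> extensional (Zmod n)" by (simp add: affine_map_def)
        fix x assume x: "x \<in> Zmod n"
        then show "f x = affine_map n b (f 0) x"
          using val [of "nat x"] by (simp add: affine_map_def mem_Zmod nat_less_iff)
      qed
      then show "f \<in> {affine_map n a b | a b. True}" by blast
    qed
  next
    assume aff: "?A \<subseteq> {affine_map n a b | a b. True}"
    show "normal_circulant n (circulant n S)"
      unfolding N
    proof
      fix f assume f: "f \<in> ?A"
      then obtain a c where ac: "f = affine_map n a c" using aff by blast
      have a: "coprime a (int n)" using Bij_affine_coprime [OF n] bij [OF f] ac by simp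
      have 1: "compose (Zmod n) (affine_map n 1 b) f = affine_map n a (c + b)"
        and 2: "compose (Zmod n) f (affine_map n 1 b) = affine_map n a (c + a * b)" for b
        by (simp_all add: ac affine_map_compose n add.commute)
      have "\<exists>b'. affine_map n a (c + b) = affine_map n a (c + a * b')" for b
      proof -
        obtain a' where a': "[a * a' = 1] (mod int n)" using cong_solve_coprime_int [OF a] ..
        have "[c + b = c + a * (a' * b)] (mod int n)"
          using cong_add [OF cong_refl cong_sym [OF cong_scalar_right [OF a', of b]], of c]
          by (simp add: mult.assoc)
        then show ?thesis using affine_map_cong cong_refl by blast
      qed
      then show "?R #>\<^bsub>G\<^esub> f = f <#\<^bsub>G\<^esub> ?R"
        unfolding rc [OF f] lc [OF f] 1 2 by blast
    qed
  qed
qed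

lemma connection_set_minus:
  assumes n: "n > 0" and S: "connection_set n S"
  shows "(- x) mod int n \<in> S \<longleftrightarrow> x mod int n \<in> S"
proof -
  have im: "(\<lambda>s. (- s) mod int n) ` S = S" using S by (simp add: connection_set_def)
  have *: "(- s) mod int n \<in> S" if "s \<in> S" for s
    using that im by (metis imageI)
  have "(- (x mod int n)) mod int n = (- x) mod int n" "(- ((- x) mod int n)) mod int n = x mod int n"
    by (simp_all add: mod_minus_eq)
  then show ?thesis using * [of "x mod int n"] * [of "(- x) mod int n"] by metis
qed

lemma Small_circulant_iff:
  assumes n: "n > 0" and S: "connection_set n S"
  shows "circulant n S \<in> Small n \<longleftrightarrow> Aut (circulant n S) \<subseteq> {affine_map n a b | a b. a \<in> {1, - 1}}"
proof -
  have "{affine_map n a b | a b. a \<in> {1, - 1}} \<subseteq> Aut (circulant n S)"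
  proof -
    have "affine_map n 1 b \<in> Aut (circulant n S)" for b
      by (rule affine_map_in_Aut [OF n]) simp_all
    moreover have "affine_map n (- 1) b \<in> Aut (circulant n S)" for b
      by (rule affine_map_in_Aut [OF n]) (simp_all add: connection_set_minus [OF n S])
    ultimately show ?thesis by blast
  qed
  moreover have "circulant n S \<in> ACG n" using S by (auto simp: ACG_def)
  ultimately show ?thesis by (auto simp: Small_def generate_rho_iota [OF n])
qed

text \<open>\<open>S\<close> is recovered as the set of all \<open>x\<close> with an arc from
  \<open>x\<close> to 0.\<close>

lemma circulant_inj:
  assumes n: "n > 0" and S: "connection_set n S" "connection_set n T"
    and eq: "circulant n S = circulant n T"
  shows "S = T"
proof -
  have *: "x \<in> S \<longleftrightarrow> (x, 0) \<in> parcs (circulant n S)" if "connection_set n S" for x and S :: "int set"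
    using that n by (auto simp: connection_set_def circulant_def mem_Zmod Zmod_mod_eq)
  show ?thesis by (rule Set.set_eqI) (simp only: * [OF S(1)] * [OF S(2)] eq)
qed

section \<open>Counting sets invariant under a multiplier\<close>

lemma card_saturated_subsets:
  assumes eq: "equiv X r" and fin: "finite X"
  shows "card {A. A \<subseteq> X \<and> (\<forall>x y. (x, y) \<in> r \<longrightarrow> x \<in> A \<longrightarrow> y \<in> A)} = 2 ^ card (X // r)"
proof -
  have "bij_betw Union (Pow (X // r)) {A. A \<subseteq> X \<and> (\<forall>x y. (x, y) \<in> r \<longrightarrow> x \<in> A \<longrightarrow> y \<in> A)}"
  proof (rule bij_betwI [where g = "\<lambda>A. A // r"])
    show "Union \<in> Pow (X // r) \<rightarrow> {A. A \<subseteq> X \<and> (\<forall>x y. (x, y) \<in> r \<longrightarrow> x \<in> A \<longrightarrow> y \<in> A)}"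
    proof (intro funcsetI CollectI conjI allI impI)
      fix Q assume Q: "Q \<in> Pow (X // r)"
      show "\<Union>Q \<subseteq> X" using Q in_quotient_imp_subset [OF eq] by blast
      fix x y assume xy: "(x, y) \<in> r" "x \<in> \<Union>Q"
      then obtain C where C: "C \<in> Q" "x \<in> C" by blast
      then have "y \<in> C" using in_quotient_imp_closed [OF eq _ C(2) xy(1)] Q by blast
      then show "y \<in> \<Union>Q" using C(1) by blast
    qed
    show "(\<lambda>A. A // r) \<in> {A. A \<subseteq> X \<and> (\<forall>x y. (x, y) \<in> r \<longrightarrow> x \<in> A \<longrightarrow> y \<in> A)} \<rightarrow> Pow (X // r)"
      by (auto simp: quotient_def)
  next
    fix Q assume Q: "Q \<in> Pow (X // r)"
    show "\<Union>Q // r = Q"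
    proof (intro Set.set_eqI iffI)
      fix C assume "C \<in> \<Union>Q // r"
      then obtain D x where D: "D \<in> Q" "x \<in> D" "C = r `` {x}" by (auto simp: quotient_def)
      then have "D \<in> X // r" using Q by blast
      then obtain z where z: "D = r `` {z}" by (auto simp: quotient_def)
      then have "r `` {z} = r `` {x}" using D(2) by (intro equiv_class_eq [OF eq]) simp
      then show "C \<in> Q" using D z by simp
    next
      fix C assume C: "C \<in> Q"
      then obtain x where x: "x \<in> X" "C = r `` {x}" using Q by (auto simp: quotient_def)
      then have "x \<in> C" using equiv_class_self [OF eq] by blast
      then have "x \<in> \<Union>Q" using C by blast
      then show "C \<in> \<Union>Q // r" unfolding quotient_def x(2) by blast
    qed
  next
    fix A assume A: "A \<in> {A. A \<subseteq> X \<and> (\<forall>x y. (x, y) \<in> r \<longrightarrow> x \<in> A \<longrightarrow> y \<in> A)}"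
    show "\<Union>(A // r) = A"
    proof (intro Set.set_eqI iffI)
      fix y assume "y \<in> \<Union>(A // r)"
      then obtain x where "x \<in> A" "(x, y) \<in> r" by (auto simp: quotient_def)
      then show "y \<in> A" using A by blast
    next
      fix y assume y: "y \<in> A"
      then have "y \<in> r `` {y}" using A equiv_class_self [OF eq] by blast
      then show "y \<in> \<Union>(A // r)" using y unfolding quotient_def by blast
    qed
  qed
  then have "card (Pow (X // r)) = card {A. A \<subseteq> X \<and> (\<forall>x y. (x, y) \<in> r \<longrightarrow> x \<in> A \<longrightarrow> y \<in> A)}"
    by (rule bij_betw_same_card)
  moreover have "finite (X // r)" by (rule finite_quotient [OF fin equiv_type [OF eq]])
  ultimately show ?thesis by (simp add: card_Pow)
qed

lemma card_classes_of_equal_size: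
  assumes eq: "equiv X r" and Y: "Y \<subseteq> X" "finite Y"
    and cl: "\<And>x. x \<in> Y \<Longrightarrow> r `` {x} \<subseteq> Y" "\<And>x. x \<in> Y \<Longrightarrow> card (r `` {x}) = c"
  shows "c * card (Y // r) = card Y"
proof -
  have un: "\<Union>(Y // r) = Y"
  proof
    show "\<Union>(Y // r) \<subseteq> Y" using cl(1) by (auto simp: quotient_def)
    show "Y \<subseteq> \<Union>(Y // r)"
    proof
      fix y assume "y \<in> Y"
      moreover from this have "y \<in> r `` {y}" using Y equiv_class_self [OF eq] by blast
      ultimately show "y \<in> \<Union>(Y // r)" unfolding quotient_def by blast
    qed
  qed
  have fin: "finite (Y // r)" using Y(2) by (simp add: quotient_def)
  have "c * card (Y // r) = card (\<Union>(Y // r))"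
  proof (rule card_partition [OF fin])
    show "finite (\<Union>(Y // r))" unfolding un by (rule Y(2))
    show "card C = c" if "C \<in> Y // r" for C using that cl(2) by (auto simp: quotient_def)
    show "C \<inter> D = {}" if "C \<in> Y // r" "D \<in> Y // r" "C \<noteq> D" for C D
    proof -
      have "Y // r \<subseteq> X // r" using Y(1) by (auto simp: quotient_def)
      then show ?thesis using quotient_disj [OF eq] that by blast
    qed
  qed
  then show ?thesis unfolding un .
qed

text \<open>Forward closure is enough: for a unit \<open>a\<close> the converse follows by
  finiteness. Symmetry is not imposed because -1 is a power of each multiplier whose invariant sets
  are counted.\<close>

definition invariant_sets :: "nat \<Rightarrow> int \<Rightarrow> int set set" where
  "invariant_sets n a = {S. S \<subseteq> Zmod n - {0} \<and> (\<forall>s\<in>S. (a * s) mod int n \<in> S)}"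

lemma invariant_sets_power:
  assumes S: "S \<in> invariant_sets n a" and x: "x mod int n \<in> S"
  shows "(a ^ i * x) mod int n \<in> S"
proof (induction i)
  case (Suc i)
  then have "(a * ((a ^ i * x) mod int n)) mod int n \<in> S"
    using S by (simp add: invariant_sets_def)
  then show ?case by (simp add: mod_mult_right_eq mult.assoc)
qed (use x in simp)

lemma finite_invariant_sets: "finite (invariant_sets n a)"
  by (rule finite_subset [of _ "Pow (Zmod n)"]) (auto simp: invariant_sets_def)

text \<open>The equivalence classes are the orbits of multiplication by \<open>a\<close>; the element \<open>x\<close> has an
  orbit of size \<open>d\<close> if \<open>a\<^sup>i x = x\<close> exactly for the multiples \<open>i\<close> of \<open>d\<close>.\<close>

lemma card_invariant_sets:
  assumes n: "n > 0" and m: "m > 0" "[a ^ m = 1] (mod int n)"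
    and Y: "Y1 \<union> Y2 = Zmod n - {0}" "Y1 \<inter> Y2 = {}"
    and Y1: "\<And>x. x \<in> Y1 \<Longrightarrow> (a * x) mod int n \<in> Y1"
    and Y2: "\<And>x. x \<in> Y2 \<Longrightarrow> (a * x) mod int n \<in> Y2"
    and d: "d1 > 0" "d2 > 0"
    and d1: "\<And>x i. x \<in> Y1 \<Longrightarrow> [a ^ i * x = x] (mod int n) \<longleftrightarrow> d1 dvd i"
    and d2: "\<And>x i. x \<in> Y2 \<Longrightarrow> [a ^ i * x = x] (mod int n) \<longleftrightarrow> d2 dvd i"
  shows "card (invariant_sets n a) = 2 ^ (card Y1 div d1 + card Y2 div d2)"
proof -
  define X where "X = Zmod n - {0}"
  define r where "r = {(x, y). x \<in> X \<and> (\<exists>i. y = (a ^ i * x) mod int n)}"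
  have XY: "X = Y1 \<union> Y2" using Y(1) by (simp add: X_def)
  have orb: "(a ^ i * x) mod int n \<in> Y" if "x \<in> Y" "Y \<subseteq> X" "\<And>x. x \<in> Y \<Longrightarrow> (a * x) mod int n \<in> Y" for x i Y
  proof (induction i)
    case 0
    then show ?case using that by (auto simp: X_def Zmod_mod_eq)
  next
    case (Suc i)
    have "(a * ((a ^ i * x) mod int n)) mod int n \<in> Y" by (rule that(3) [OF Suc])
    then show ?case by (simp add: mod_mult_right_eq mult.assoc)
  qed
  have orbX: "(a ^ i * x) mod int n \<in> X" if "x \<in> X" for x i
    by (rule orb [OF that order_refl]) (use XY Y1 Y2 in blast)
  have eq: "equiv X r"
  proof (rule equivI)
    show "r \<subseteq> X \<times> X" using orbX by (auto simp: r_def)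
    show "refl_on X r"
      by (rule refl_onI) (auto simp: r_def X_def Zmod_mod_eq intro!: exI [of _ 0])
    show "sym r"
    proof (rule symI)
      fix x y assume "(x, y) \<in> r"
      then obtain i where x: "x \<in> X" and y: "y = (a ^ i * x) mod int n" by (auto simp: r_def)
      \<comment> \<open>The inverse of \<open>a ^ i\<close> is \<open>a ^ ((m - 1) * i)\<close>,
        since \<open>a ^ m\<close> is 1 modulo \<open>n\<close>.\<close>
      have "(a ^ ((m - 1) * i) * y) mod int n = (a ^ (m * i) * x) mod int n"
        unfolding y mod_mult_right_eq mult.assoc [symmetric] power_add [symmetric]
        using m(1) by (simp add: algebra_simps)
      also have "[a ^ (m * i) * x = 1 ^ i * x] (mod int n)"
        unfolding power_mult by (intro cong_mult cong_pow m(2) cong_refl)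
      then have "(a ^ (m * i) * x) mod int n = x"
        using x by (simp add: Cong.cong_def X_def Zmod_mod_eq)
      finally have "x = (a ^ ((m - 1) * i) * y) mod int n" ..
      moreover have "y \<in> X" unfolding y by (rule orbX [OF x])
      ultimately show "(y, x) \<in> r" by (auto simp: r_def)
    qed
    show "trans r"
    proof (rule transI)
      fix x y z assume "(x, y) \<in> r" "(y, z) \<in> r"
      then obtain i j where ij: "x \<in> X" "y = (a ^ i * x) mod int n" "z = (a ^ j * y) mod int n"
        by (auto simp: r_def)
      then have "z = (a ^ (j + i) * x) mod int n"
        by (simp add: mod_mult_right_eq power_add mult.assoc)
      then show "(x, z) \<in> r" using ij(1) unfolding r_def by blast
    qed
  qed
  have cop: "coprime a (int n)"
  proof -
    have "[a * a ^ (m - 1) = 1] (mod int n)" using m by (simp add: power_eq_if split: if_splits)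
    then show ?thesis using coprime_iff_invertible_int by blast
  qed
  have card_class: "card (r `` {x}) = d"
    if x: "x \<in> X" and d: "d > 0" "\<And>i. [a ^ i * x = x] (mod int n) \<longleftrightarrow> d dvd i" for x d
  proof -
    let ?f = "\<lambda>i. (a ^ i * x) mod int n"
    have "r `` {x} = ?f ` {..<d}"
    proof (intro Set.set_eqI iffI)
      fix y assume "y \<in> r `` {x}"
      then obtain i where y: "y = ?f i" by (auto simp: r_def)
      have "[a ^ (d * (i div d)) * x = x] (mod int n)" unfolding d(2) by simp
      then have "[a ^ (i mod d) * (a ^ (d * (i div d)) * x) = a ^ (i mod d) * x] (mod int n)"
        by (rule cong_scalar_left)
      moreover have "a ^ (i mod d) * (a ^ (d * (i div d)) * x) = a ^ i * x"
        by (simp add: mult.assoc [symmetric] power_add [symmetric])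
      ultimately have "y = ?f (i mod d)" by (simp add: y Cong.cong_def)
      then show "y \<in> ?f ` {..<d}" using d(1) by simp
    qed (use x in \<open>auto simp: r_def\<close>)
    moreover have "inj_on ?f {..<d}"
    proof (rule linorder_inj_onI)
      fix i j assume ij: "i < j" "i \<in> {..<d}" "j \<in> {..<d}"
      show "?f i \<noteq> ?f j"
      proof
        assume "?f i = ?f j"
        then have "[a ^ i * (a ^ (j - i) * x) = a ^ i * x] (mod int n)"
          using ij(1) by (simp add: Cong.cong_def mult.assoc [symmetric] power_add [symmetric])
        then have "[a ^ (j - i) * x = x] (mod int n)"
          using cop by (simp add: cong_mult_lcancel)
        then show False using d(2) ij by (auto dest: dvd_imp_le)
      qed
    qed auto
    ultimately show ?thesis by (simp add: card_image)
  qed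
  have inv: "invariant_sets n a = {A. A \<subseteq> X \<and> (\<forall>x y. (x, y) \<in> r \<longrightarrow> x \<in> A \<longrightarrow> y \<in> A)}"
  proof (intro Set.set_eqI iffI)
    fix A assume A: "A \<in> invariant_sets n a"
    then have AX: "A \<subseteq> X" by (simp add: invariant_sets_def X_def)
    have "(a ^ i * x) mod int n \<in> A" if "x \<in> A" for x i
      by (rule invariant_sets_power [OF A]) (use that AX in \<open>auto simp: X_def Zmod_mod_eq\<close>)
    then show "A \<in> {A. A \<subseteq> X \<and> (\<forall>x y. (x, y) \<in> r \<longrightarrow> x \<in> A \<longrightarrow> y \<in> A)}"
      using AX by (auto simp: r_def)
  next
    fix A assume A: "A \<in> {A. A \<subseteq> X \<and> (\<forall>x y. (x, y) \<in> r \<longrightarrow> x \<in> A \<longrightarrow> y \<in> A)}"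
    have "(x, (a * x) mod int n) \<in> r" if "x \<in> A" for x
      using that A by (auto simp: r_def intro!: exI [of _ 1])
    then show "A \<in> invariant_sets n a" using A by (auto simp: invariant_sets_def X_def)
  qed
  have fin: "finite X" by (simp add: X_def)
  have part: "d * card (Y // r) = card Y"
    if "Y \<subseteq> X" "\<And>x. x \<in> Y \<Longrightarrow> (a * x) mod int n \<in> Y" "d > 0"
      "\<And>x i. x \<in> Y \<Longrightarrow> [a ^ i * x = x] (mod int n) \<longleftrightarrow> d dvd i" for Y d
  proof (rule card_classes_of_equal_size [OF eq that(1)])
    show "finite Y" using that(1) fin finite_subset by blast
    show "r `` {x} \<subseteq> Y" if "x \<in> Y" for x
      using orb [OF that \<open>Y \<subseteq> X\<close>] \<open>\<And>x. x \<in> Y \<Longrightarrow> (a * x) mod int n \<in> Y\<close> by (auto simp: r_def)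
    show "card (r `` {x}) = d" if "x \<in> Y" for x
      using card_class [of x d] that \<open>Y \<subseteq> X\<close> \<open>d > 0\<close>
        \<open>\<And>x i. x \<in> Y \<Longrightarrow> [a ^ i * x = x] (mod int n) \<longleftrightarrow> d dvd i\<close> by blast
  qed
  have "d1 * card (Y1 // r) = card Y1" "d2 * card (Y2 // r) = card Y2"
    using part [of Y1 d1] part [of Y2 d2] Y1 Y2 d d1 d2 XY by blast+
  then have "card Y1 div d1 = card (Y1 // r)" "card Y2 div d2 = card (Y2 // r)"
    using d by (metis nonzero_mult_div_cancel_left less_numeral_extra(3))+
  moreover have "card (X // r) = card (Y1 // r) + card (Y2 // r)"
  proof -
    have "X // r = Y1 // r \<union> Y2 // r" by (auto simp: XY quotient_def)
    moreover have "Y1 // r \<inter> Y2 // r = {}"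
    proof -
      have "r `` {x} \<noteq> r `` {y}" if xy: "x \<in> Y1" "y \<in> Y2" for x y
      proof
        assume "r `` {x} = r `` {y}"
        then have "(x, y) \<in> r"
          using equiv_class_self [OF eq, of y] xy XY by blast
        then obtain i where "y = (a ^ i * x) mod int n" by (auto simp: r_def)
        then have "y \<in> Y1" using orb [OF xy(1) _ Y1] XY by blast
        then show False using xy(2) Y(2) by blast
      qed
      then show ?thesis by (auto simp: quotient_def)
    qed
    moreover have "finite (Y1 // r)" "finite (Y2 // r)"
      using fin XY by (simp_all add: quotient_def)
    ultimately show ?thesis by (simp add: card_Un_disjoint)
  qed
  ultimately show ?thesis unfolding inv card_saturated_subsets [OF eq fin] by simp
qed

lemma card_Zmod [simp]: "card (Zmod n) = n"
  by (simp add: Zmod_def)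

lemma finite_ACG: "finite (ACG n)"
proof -
  have "ACG n \<subseteq> circulant n ` Pow (Zmod n)" by (auto simp: ACG_def connection_set_def)
  then show ?thesis by (rule finite_subset) simp
qed

lemma connection_set_if_invariant:
  assumes n: "n > 0" and S: "S \<in> invariant_sets n a" and m: "[a ^ m = - 1] (mod int n)"
  shows "connection_set n S"
proof -
  have sub: "S \<subseteq> Zmod n - {0}" using S by (simp add: invariant_sets_def)
  have neg: "(- s) mod int n \<in> S" if "s \<in> S" for s
  proof -
    have "s mod int n \<in> S" using that sub by (auto simp: Zmod_mod_eq)
    then have "(a ^ m * s) mod int n \<in> S" by (rule invariant_sets_power [OF S])
    moreover have "[a ^ m * s = (- 1) * s] (mod int n)" using m by (rule cong_scalar_right)
    ultimately show ?thesis by (simp add: Cong.cong_def)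
  qed
  have "s \<in> (\<lambda>s. (- s) mod int n) ` S" if s: "s \<in> S" for s
  proof
    show "(- s) mod int n \<in> S" by (rule neg [OF s])
    show "s = (- ((- s) mod int n)) mod int n" using s sub by (auto simp: mod_minus_eq Zmod_mod_eq)
  qed
  then show ?thesis using sub neg by (auto simp: connection_set_def)
qed

lemma card_circulant_image:
  assumes "n > 0" "\<And>S. S \<in> X \<Longrightarrow> connection_set n S"
  shows "card (circulant n ` X) = card X"
  using assms circulant_inj by (intro card_image inj_onI) blast

text \<open>A unit acts injectively, so it maps the finite set \<open>S\<close> onto itself; this
  gives the direction from a x back to x.\<close>

lemma finite_invariance:
  assumes n: "n > 0" and a: "coprime a (int n)" and S: "S \<in> invariant_sets n a"
  shows "(a * x) mod int n \<in> S \<longleftrightarrow> x mod int n \<in> S"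
proof
  assume "x mod int n \<in> S"
  then show "(a * x) mod int n \<in> S" using invariant_sets_power [OF S, of x 1] by simp
next
  let ?f = "affine_map n a 0"
  have S_sub: "S \<subseteq> Zmod n" using S by (auto simp: invariant_sets_def)
  have f: "?f s = (a * s) mod int n" if "s \<in> Zmod n" for s using that by (simp add: affine_map_def)
  have inj: "inj_on ?f (Zmod n)" using affine_map_Bij [OF n a] by (simp add: Bij_def bij_betw_def)
  have "?f ` S \<subseteq> S" using S S_sub f by (auto simp: invariant_sets_def)
  then have im: "?f ` S = S"
    by (rule endo_inj_surj [OF finite_subset [OF S_sub finite_Zmod] _ inj_on_subset [OF inj S_sub]])
  assume "(a * x) mod int n \<in> S"
  moreover have "?f (x mod int n) = (a * x) mod int n"
    using n by (simp add: f mod_mult_right_eq)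
  ultimately obtain s where "s \<in> S" "?f (x mod int n) = ?f s" using im by (metis imageE)
  then show "x mod int n \<in> S" using inj S_sub n by (metis inj_onD mod_mem_Zmod subsetD)
qed

section \<open>Multipliers of graphs that are not small\<close>

lemma affine_map_eqD:
  assumes n: "n > 1" and eq: "affine_map n a b = affine_map n a' b'"
  shows "[a = a'] (mod int n)"
proof -
  have "(a * 0 + b) mod int n = (a' * 0 + b') mod int n" "(a * 1 + b) mod int n = (a' * 1 + b') mod int n"
    using fun_cong [OF eq, of 0] fun_cong [OF eq, of 1] n by (auto simp: affine_map_def mem_Zmod)
  then have "int n dvd b - b'" "int n dvd (a * 1 + b) - (a' * 1 + b')"
    by (simp_all only: mod_eq_dvd_iff) simp
  then have "int n dvd ((a * 1 + b) - (a' * 1 + b')) - (b - b')" by (rule dvd_diff [rotated])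
  then show ?thesis by (simp add: cong_iff_dvd_diff)
qed

lemma NonNorG_not_Small:
  assumes n: "n > 0"
  shows "NonNorG n \<inter> Small n = {}"
proof -
  have False if G: "G \<in> NonNorG n" "G \<in> Small n" for G
  proof -
    obtain S where S: "G = circulant n S" "connection_set n S" using G by (auto simp: NonNorG_def ACG_def)
    have "Aut (circulant n S) \<subseteq> {affine_map n a b | a b. a \<in> {1, - 1}}"
      using G(2) Small_circulant_iff [OF n S(2)] S(1) by blast
    then have "normal_circulant n (circulant n S)" unfolding normal_circulant_iff [OF n] by blast
    then show False using G(1) S(1) by (simp add: NonNorG_def)
  qed
  then show ?thesis by blast
qed

lemma multiplier_not_Small:
  assumes n: "n > 1" and S: "connection_set n S" "S \<in> invariant_sets n a" and a: "coprime a (int n)"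
    "\<not> [a = 1] (mod int n)" "\<not> [a = - 1] (mod int n)"
  shows "circulant n S \<in> ACG n - Small n"
proof -
  have n0: "n > 0" using n by simp
  have "affine_map n a 0 \<in> Aut (circulant n S)"
    by (rule affine_map_in_Aut [OF n0 a(1) finite_invariance [OF n0 a(1) S(2)]])
  moreover have "affine_map n a 0 \<notin> {affine_map n a b | a b. a \<in> {1, - 1}}"
    using affine_map_eqD [OF n] a(2,3) by blast
  ultimately have "circulant n S \<notin> Small n" unfolding Small_circulant_iff [OF n0 S(1)] by blast
  then show ?thesis using S(1) by (auto simp: ACG_def)
qed

text \<open>A normal graph has only affine automorphisms, and if it is not small, one of them has
  linear part other than 1 and -1. Comparing the images of \<open>s\<close> and 0 removes the
  translation part.\<close>

lemma normal_not_Small_multiplier: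
  assumes n: "n > 0" and G: "G \<in> ACG n - Small n" "G \<notin> NonNorG n"
  obtains S a where "G = circulant n S" "connection_set n S" "S \<in> invariant_sets n a"
    "coprime a (int n)" "\<not> [a = 1] (mod int n)" "\<not> [a = - 1] (mod int n)"
proof -
  obtain S where S: "G = circulant n S" "connection_set n S" using G by (auto simp: ACG_def)
  have "Aut (circulant n S) \<subseteq> {affine_map n a b | a b. True}"
    using G S normal_circulant_iff [OF n] by (auto simp: NonNorG_def)
  moreover have "\<not> Aut (circulant n S) \<subseteq> {affine_map n a b | a b. a \<in> {1, - 1}}"
    using G S Small_circulant_iff [OF n S(2)] by auto
  ultimately obtain a b where ab: "affine_map n a b \<in> Aut (circulant n S)"
      "affine_map n a b \<notin> {affine_map n a b | a b. a \<in> {1, - 1}}"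
    by blast
  have aut: "affine_map n a b \<in> Bij (Zmod n)"
      "\<And>u v. u \<in> Zmod n \<Longrightarrow> v \<in> Zmod n \<Longrightarrow>
        (affine_map n a b u - affine_map n a b v) mod int n \<in> S \<longleftrightarrow> (u - v) mod int n \<in> S"
    using ab(1) unfolding mem_Aut_circulant by blast+
  have sub: "S \<subseteq> Zmod n - {0}" using S(2) by (simp add: connection_set_def)
  have "(a * s) mod int n \<in> S" if s: "s \<in> S" for s
  proof -
    have "s \<in> Zmod n" "0 \<in> Zmod n" using s sub n by (auto simp: mem_Zmod)
    then have "((a * s + b) mod int n - b mod int n) mod int n \<in> S"
      using aut(2) [of s 0] s by (simp add: affine_map_def Zmod_mod_eq)
    then show ?thesis by (simp add: mod_diff_eq)
  qed
  then have inv: "S \<in> invariant_sets n a" using sub by (simp add: invariant_sets_def)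
  have "\<not> [a = c] (mod int n)" if "c \<in> {1, - 1}" for c
  proof
    assume "[a = c] (mod int n)"
    then have "affine_map n a b = affine_map n c b" by (rule affine_map_cong [OF _ cong_refl])
    then show False using ab(2) that by blast
  qed
  then have "\<not> [a = 1] (mod int n)" "\<not> [a = - 1] (mod int n)" by blast+
  then show ?thesis using that S inv Bij_affine_coprime [OF n aut(1)] by blast
qed

section \<open>From graph automorphisms to permutations of residue classes\<close>

lemma residue_perm_of_Bij:
  assumes n: "n > 0" and f: "f \<in> Bij (Zmod n)"
  shows "residue_perm n (\<lambda>x. f (x mod int n))"
proof
  show "n > 0" by (rule n)
  have inj: "inj_on f (Zmod n)" using f by (simp add: Bij_def bij_betw_def)
  have mem: "f (x mod int n) \<in> Zmod n" for x using Bij_imp_funcset [OF f] n by auto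
  show "[f (x mod int n) = f (y mod int n)] (mod int n) \<longleftrightarrow> [x = y] (mod int n)" for x y
  proof
    assume "[f (x mod int n) = f (y mod int n)] (mod int n)"
    then have "f (x mod int n) = f (y mod int n)" by (rule Zmod_cong_imp_eq [OF mem mem])
    then show "[x = y] (mod int n)" using inj n by (simp add: inj_on_eq_iff Cong.cong_def)
  qed (simp add: Cong.cong_def)
qed

lemma stable_of_Aut:
  assumes n: "n > 0" and f: "f \<in> Aut (circulant n S)"
  shows "residue_perm.stable n (\<lambda>x. f (x mod int n)) {x. x mod int n \<in> S}"
proof -
  have "f \<in> Bij (Zmod n)" using f by (simp add: mem_Aut_circulant)
  then interpret residue_perm n "\<lambda>x. f (x mod int n)" by (rule residue_perm_of_Bij [OF n])
  have "(f (x mod int n) - f (y mod int n)) mod int n \<in> S \<longleftrightarrow> (x - y) mod int n \<in> S" for x y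
    using f n by (simp add: mem_Aut_circulant mod_diff_eq)
  then show ?thesis by (simp add: stable_def Cong.cong_def)
qed

lemma affine_map_of_cong:
  assumes f: "f \<in> Bij (Zmod n)" and ab: "\<And>x. [f (x mod int n) = a * x + b] (mod int n)"
  shows "f = affine_map n a b"
proof (rule extensionalityI [of _ "Zmod n"])
  show "f \<in> extensional (Zmod n)" using f by (simp add: Bij_def)
  show "affine_map n a b \<in> extensional (Zmod n)" by (simp add: affine_map_def)
  fix x assume x: "x \<in> Zmod n"
  then have "f x \<in> Zmod n" using Bij_imp_funcset [OF f] by blast
  then show "f x = affine_map n a b x"
    using x ab [of x] by (simp add: affine_map_def Zmod_mod_eq Cong.cong_def)
qed

lemma nonnormal_prime:
  assumes p: "prime n" and S: "connection_set n S" "\<not> normal_circulant n (circulant n S)"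
  shows "S = {} \<or> S = Zmod n - {0}"
proof (rule ccontr)
  assume *: "\<not> ?thesis"
  have n: "n > 0" using p prime_gt_0_nat by blast
  have sub: "S \<subseteq> Zmod n - {0}" using S(1) by (simp add: connection_set_def)
  then obtain x y where xy: "x \<in> S" "y \<in> Zmod n - {0}" "y \<notin> S" using * by blast
  have nz: "\<not> int n dvd z" if "z \<in> Zmod n - {0}" for z
    using that zdvd_not_zless [of z "int n"] by (auto simp: mem_Zmod)
  obtain f where f: "f \<in> Aut (circulant n S)" "f \<notin> {affine_map n a b | a b. True}"
    using S(2) unfolding normal_circulant_iff [OF n] by blast
  have bij: "f \<in> Bij (Zmod n)" using f(1) by (simp add: mem_Aut_circulant)
  interpret residue_perm n "\<lambda>x. f (x mod int n)" by (rule residue_perm_of_Bij [OF n bij])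
  have "\<exists>a b. \<forall>x. [f (x mod int n) = a * x + b] (mod int n)"
    by (rule affine_if_prime [OF p stable_of_Aut [OF n f(1)], of x y])
      (use xy sub nz in \<open>auto simp: Zmod_mod_eq\<close>)
  then show False using affine_map_of_cong [OF bij] f(2) by blast
qed

lemma nonnormal_prime_power:
  assumes p: "prime p" "odd p" and k: "k \<ge> 2" and n: "n = p ^ k"
    and S: "\<not> normal_circulant n (circulant n S)"
    and x: "\<not> int p dvd x" "x mod int n \<in> S"
  shows "(x + int p ^ (k - 1) * j) mod int n \<in> S"
proof (rule ccontr)
  assume *: "\<not> ?thesis"
  have n0: "n > 0" using p prime_gt_0_nat by (simp add: n)
  obtain f where f: "f \<in> Aut (circulant n S)" "f \<notin> {affine_map n a b | a b. True}"
    using S unfolding normal_circulant_iff [OF n0] by blast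
  have bij: "f \<in> Bij (Zmod n)" using f(1) by (simp add: mem_Aut_circulant)
  interpret residue_perm n "\<lambda>x. f (x mod int n)" by (rule residue_perm_of_Bij [OF n0 bij])
  have "\<exists>a b. \<forall>x. [f (x mod int n) = a * x + b] (mod int n)"
    by (rule affine_if_not_coset_union [OF p k n stable_of_Aut [OF n0 f(1)], of x j])
      (use x * in auto)
  then show False using affine_map_of_cong [OF bij] f(2) by blast
qed

section \<open>Non-normal circulant graphs of odd prime power order\<close>

text \<open>Multiplication by 1 + P fixes the multiples of \<open>p\<close> and moves a unit x by P
  x, so its powers carry x through the whole coset of the multiples of \<open>P\<close>. The sign
  puts the symmetry S = -S into the same cyclic group, of order 2p.\<close>

locale odd_prime_power =
  fixes p k n :: nat and P a :: int
  assumes p: "prime p" "odd p" and k: "k \<ge> 2"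
  defines "n \<equiv> p ^ k" and "P \<equiv> int p ^ (k - 1)" and "a \<equiv> - (1 + P)"
begin

lemma p_ge_3: "p \<ge> 3"
  using p prime_ge_2_nat [of p] by (cases "p = 2") auto

lemma prime_int_p: "prime (int p)"
  using p by simp

lemma P_mult_p: "P * int p = int n"
  using k by (simp add: n_def P_def power_Suc2 [symmetric] del: power_Suc2)

lemma n_pos: "n > 0"
  using p_ge_3 by (simp add: n_def)

lemma n_gt_1: "n > 1"
  using p_ge_3 k one_less_power [of p k] by (simp add: n_def)

lemma P_pos: "P > 0"
  using p_ge_3 by (simp add: P_def)

lemma p_dvd_P: "int p dvd P"
  using k by (simp add: P_def dvd_power)

lemma p_dvd_n: "int p dvd int n"
  unfolding P_mult_p [symmetric] by simp

lemma n_dvd_P_mult: "int n dvd P * x \<longleftrightarrow> int p dvd x"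
  unfolding P_mult_p [symmetric] using P_pos by simp

lemma n_dvd_P_squared: "int n dvd P\<^sup>2"
  using p_dvd_P by (simp add: power2_eq_square n_dvd_P_mult)

lemma not_dvd_2: "\<not> int p dvd 2"
  using p_ge_3 zdvd_not_zless [of 2 "int p"] by simp

lemma coprime_n: "\<not> int p dvd x \<Longrightarrow> coprime x (int n)"
  using prime_imp_coprime [OF prime_int_p, of x] by (simp add: n_def coprime_commute)

lemma n_dvd_double: "int n dvd 2 * x \<longleftrightarrow> int n dvd x"
  using coprime_n [OF not_dvd_2] by (simp add: coprime_dvd_mult_right_iff coprime_commute)

lemma one_plus_P_power: "[(1 + P) ^ i = 1 + int i * P] (mod int n)"
  using dvd_trans [OF n_dvd_P_squared square_dvd_one_plus_power] by (simp add: cong_iff_dvd_diff)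

text \<open>Modulo \<open>n\<close>, (1 + P)^p is 1, and \<open>p\<close> is odd. So -1 is a power
  of \<open>a\<close>, and sets invariant under \<open>a\<close> are symmetric.\<close>

lemma a_power_p: "[a ^ p = - 1] (mod int n)"
proof -
  have "a ^ p = - ((1 + P) ^ p)" using p(2) unfolding a_def by (rule power_minus_odd)
  moreover have "int n dvd (1 + P) ^ p - 1"
  proof -
    have "int n dvd ((1 + P) ^ p - (1 + int p * P)) + P * int p"
      using one_plus_P_power [of p] P_mult_p by (intro dvd_add) (simp_all add: cong_iff_dvd_diff)
    then show ?thesis by (simp add: mult.commute)
  qed
  ultimately show ?thesis by (simp add: cong_iff_dvd_diff dvd_diff_commute)
qed

lemma a_power_even: "[a ^ (2 * l) = 1 + 2 * int l * P] (mod int n)"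
proof -
  have "a\<^sup>2 = (1 + P)\<^sup>2" unfolding a_def by (rule power2_minus)
  then have "a ^ (2 * l) = (1 + P) ^ (2 * l)" by (simp only: power_mult)
  then show ?thesis using one_plus_P_power [of "2 * l"] by simp
qed

lemma a_power_double_p: "[a ^ (2 * p) = 1] (mod int n)"
proof -
  have "[(a ^ p)\<^sup>2 = (- 1)\<^sup>2] (mod int n)" by (rule cong_pow [OF a_power_p])
  then show ?thesis by (simp add: power_mult [symmetric] mult.commute)
qed

lemma a_mod_p: "[a = - 1] (mod int p)"
  using p_dvd_P by (simp add: a_def cong_iff_dvd_diff)

lemma a_unit: "\<not> int p dvd a"
proof
  assume "int p dvd a"
  moreover have "int p dvd a + 1" using a_mod_p by (simp add: cong_iff_dvd_diff)
  ultimately have "int p dvd (a + 1) - a" by (simp only: dvd_diff)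
  then show False using p_ge_3 by simp
qed

text \<open>\<open>P\<close> annihilates the multiples of \<open>p\<close>, so \<open>a\<close> acts
  on them as -1; and x differs from -x because \<open>n\<close> is odd.\<close>

lemma a_power_fixes_multiple:
  assumes x: "int p dvd x" "\<not> int n dvd x"
  shows "[a ^ i * x = x] (mod int n) \<longleftrightarrow> 2 dvd i"
proof -
  have step: "[a * y = - y] (mod int n)" if "int p dvd y" for y
  proof -
    have "int n dvd P * y" using that by (simp add: n_dvd_P_mult)
    then show ?thesis by (simp add: a_def cong_iff_dvd_diff algebra_simps)
  qed
  have pw: "[a ^ i * x = (- 1) ^ i * x] (mod int n)"
  proof (induction i)
    case (Suc i)
    have "[a * (a ^ i * x) = - (a ^ i * x)] (mod int n)" using x(1) by (intro step) simp
    moreover have "[- (a ^ i * x) = - ((- 1) ^ i * x)] (mod int n)"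
      using Suc by (simp add: cong_minus_minus_iff)
    ultimately have "[a * (a ^ i * x) = - ((- 1) ^ i * x)] (mod int n)" by (rule cong_trans)
    then show ?case by (simp add: mult.assoc)
  qed simp
  show ?thesis
  proof (cases "even i")
    case True
    then show ?thesis using pw by simp
  next
    case False
    then have "[a ^ i * x = - x] (mod int n)" using pw by simp
    moreover have "\<not> [- x = x] (mod int n)"
    proof
      assume "[- x = x] (mod int n)"
      then have "int n dvd x - (- x)" by (simp add: cong_iff_dvd_diff dvd_diff_commute)
      then show False using n_dvd_double x(2) by simp
    qed
    ultimately show ?thesis using False by (simp add: Cong.cong_def)
  qed
qed

text \<open>Modulo \<open>p\<close>, \<open>a\<close> is -1, which forces \<open>i\<close> to be
  even; then a^(2l) = 1 + 2 l P leaves the condition that \<open>p\<close> divides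
  \<open>l\<close>.\<close>

lemma a_power_fixes_unit:
  assumes x: "\<not> int p dvd x"
  shows "[a ^ i * x = x] (mod int n) \<longleftrightarrow> 2 * p dvd i"
proof -
  have "[a ^ i * x = x] (mod int n) \<longleftrightarrow> [a ^ i = 1] (mod int n)"
    using cong_mult_rcancel [OF coprime_n [OF x], of "a ^ i" 1] by simp
  also have "\<dots> \<longleftrightarrow> 2 * p dvd i"
  proof
    assume "2 * p dvd i"
    then obtain l where "i = (2 * p) * l" ..
    then show "[a ^ i = 1] (mod int n)" using cong_pow [OF a_power_double_p, of l] by (simp add: power_mult)
  next
    assume i: "[a ^ i = 1] (mod int n)"
    then have "[a ^ i = 1] (mod int p)" using p_dvd_n by (rule cong_dvd_modulus)
    moreover have "[a ^ i = (- 1) ^ i] (mod int p)" by (rule cong_pow [OF a_mod_p])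
    ultimately have "int p dvd 1 - (- 1) ^ i" by (simp add: Cong.cong_def mod_eq_dvd_iff [symmetric])
    then have "even i" using not_dvd_2 by (cases "even i") auto
    then obtain l where l: "i = 2 * l" ..
    have "int n dvd (a ^ i - 1) - (a ^ i - (1 + 2 * int l * P))"
      using i a_power_even [of l] unfolding l cong_iff_dvd_diff by (simp only: dvd_diff)
    then have "int n dvd P * (2 * int l)" by (simp add: mult_ac)
    then have "int p dvd 2 * int l" unfolding n_dvd_P_mult .
    then have "p dvd l" using prime_int_p not_dvd_2 by (simp add: prime_dvd_mult_iff)
    then show "2 * p dvd i" unfolding l by simp
  qed
  finally show ?thesis .
qed

lemma card_multiples: "card {x \<in> Zmod n - {0}. int p dvd x} = p ^ (k - 1) - 1"
proof -
  have "{x \<in> Zmod n. int p dvd x} = (\<lambda>i. i * int p) ` {0..<P}"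
  proof (intro Set.set_eqI iffI)
    fix x assume "x \<in> {x \<in> Zmod n. int p dvd x}"
    then obtain i where i: "x = i * int p" "0 \<le> x" "x < int n" by (auto simp: mem_Zmod dvd_def mult.commute)
    then have "0 \<le> i" "i < P"
      using p_ge_3 unfolding P_mult_p [symmetric] by (simp_all add: zero_le_mult_iff)
    then show "x \<in> (\<lambda>i. i * int p) ` {0..<P}" unfolding i(1) by (intro imageI) simp
  next
    fix x assume "x \<in> (\<lambda>i. i * int p) ` {0..<P}"
    then show "x \<in> {x \<in> Zmod n. int p dvd x}"
      using p_ge_3 by (auto simp: mem_Zmod P_mult_p [symmetric])
  qed
  moreover have "inj_on (\<lambda>i. i * int p) {0..<P}" using p_ge_3 by (intro inj_onI) simp
  ultimately have "card {x \<in> Zmod n. int p dvd x} = nat P" by (simp add: card_image)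
  moreover have "{x \<in> Zmod n - {0}. int p dvd x} = {x \<in> Zmod n. int p dvd x} - {0}" by auto
  moreover have "0 \<in> {x \<in> Zmod n. int p dvd x}" using n_pos by (simp add: mem_Zmod)
  ultimately show ?thesis by (simp add: P_def nat_power_eq)
qed

text \<open>Orbits have length 2 on the nonzero multiples of \<open>p\<close> and length 2p on the
  units.\<close>

lemma card_invariant_sets_a:
  "card (invariant_sets n a) = 2 ^ ((p ^ (k - 1) - 1) div 2 + (p ^ k - p ^ (k - 1)) div (2 * p))"
proof -
  define Y1 where "Y1 = {x \<in> Zmod n - {0}. int p dvd x}"
  define Y2 where "Y2 = {x \<in> Zmod n - {0}. \<not> int p dvd x}"
  have Y: "Y1 \<union> Y2 = Zmod n - {0}" "Y1 \<inter> Y2 = {}" by (auto simp: Y1_def Y2_def)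
  have dvd_mod: "int p dvd x mod int n \<longleftrightarrow> int p dvd x" for x
    using p_dvd_n by (rule dvd_mod_iff)
  have nz: "\<not> int n dvd x" if "x \<in> Zmod n - {0}" for x
    using that zdvd_not_zless [of x "int n"] by (auto simp: mem_Zmod)
  have a_nz: "(a * x) mod int n \<noteq> 0" if "x \<in> Zmod n - {0}" for x
    using nz [OF that] coprime_n [OF a_unit]
    by (simp add: dvd_eq_mod_eq_0 [symmetric] coprime_dvd_mult_right_iff coprime_commute)
  have "card (invariant_sets n a) = 2 ^ (card Y1 div 2 + card Y2 div (2 * p))"
  proof (rule card_invariant_sets [OF n_pos _ a_power_double_p Y])
    show "(a * x) mod int n \<in> Y1" if "x \<in> Y1" for x
      using that a_nz n_pos by (auto simp: Y1_def dvd_mod)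
    show "(a * x) mod int n \<in> Y2" if "x \<in> Y2" for x
      using that a_nz n_pos a_unit prime_int_p by (auto simp: Y2_def dvd_mod prime_dvd_mult_iff)
    show "[a ^ i * x = x] (mod int n) \<longleftrightarrow> 2 dvd i" if "x \<in> Y1" for x i
      using that nz by (intro a_power_fixes_multiple) (auto simp: Y1_def)
    show "[a ^ i * x = x] (mod int n) \<longleftrightarrow> 2 * p dvd i" if "x \<in> Y2" for x i
      using that by (intro a_power_fixes_unit) (simp add: Y2_def)
  qed (use p_ge_3 in auto)
  moreover have cY1: "card Y1 = p ^ (k - 1) - 1" unfolding Y1_def by (rule card_multiples)
  moreover have "card Y2 = p ^ k - p ^ (k - 1)"
  proof -
    have "card (Zmod n - {0}) = card Y1 + card Y2"
      unfolding Y(1) [symmetric] by (rule card_Un_disjoint) (auto simp: Y1_def Y2_def)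
    moreover have "card (Zmod n - {0}) = n - 1" using n_pos by (simp add: mem_Zmod)
    moreover have "p ^ (k - 1) > 0" using p_ge_3 by simp
    ultimately show ?thesis using cY1 unfolding n_def by arith
  qed
  ultimately show ?thesis by simp
qed

lemma connection_set_a: "S \<in> invariant_sets n a \<Longrightarrow> connection_set n S"
  using connection_set_if_invariant [OF n_pos _ a_power_p] by blast

text \<open>The powers of a^2 = 1 + 2 P cover all units 1 + P i; taking i = x' j with
  \<open>x'\<close> inverse to \<open>x\<close> turns \<open>x\<close> into x + P j.\<close>

lemma invariant_sets_a_coset:
  assumes S: "S \<in> invariant_sets n a" and x: "\<not> int p dvd x" "x mod int n \<in> S"
  shows "(x + P * j) mod int n \<in> S"
proof -
  obtain x' where x': "[x * x' = 1] (mod int n)" using cong_solve_coprime_int [OF coprime_n [OF x(1)]] ..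
  have a2: "[a\<^sup>2 = 1 + 2 * P] (mod int n)" using a_power_even [of 1] by simp
  have "\<exists>m. [(a\<^sup>2) ^ m = 1 + int p ^ (k - 1) * (x' * j)] (mod int p ^ k)"
  proof (rule powers_cover_kernel [OF p k])
    have "[a\<^sup>2 = (- 1)\<^sup>2] (mod int p)" by (rule cong_pow [OF a_mod_p])
    then show "[a\<^sup>2 = 1] (mod int p)" by simp
    have "\<not> [1 + 2 * P = 1] (mod int n)"
      using n_dvd_P_mult [of 2] not_dvd_2 by (simp add: cong_iff_dvd_diff mult.commute)
    then have "\<not> [a\<^sup>2 = 1] (mod int n)" using a2 by (simp add: Cong.cong_def)
    then show "\<not> [a\<^sup>2 = 1] (mod int p ^ k)" by (simp add: n_def)
  qed
  then obtain m where m: "[a ^ (2 * m) = 1 + P * (x' * j)] (mod int n)"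
    by (auto simp: P_def n_def power_mult)
  have "(a ^ (2 * m) * x) mod int n \<in> S" by (rule invariant_sets_power [OF S x(2)])
  moreover have "[a ^ (2 * m) * x = x + P * j] (mod int n)"
  proof -
    have "int n dvd (a ^ (2 * m) - (1 + P * (x' * j))) * x + (x * x' - 1) * (P * j)"
      using m x' unfolding cong_iff_dvd_diff by (simp only: dvd_add dvd_mult2)
    then show ?thesis by (simp add: cong_iff_dvd_diff algebra_simps)
  qed
  ultimately show ?thesis by (simp add: Cong.cong_def)
qed

text \<open>The witness is the map that translates the multiples of \<open>p\<close> by \<open>P\<close> and fixes all other residues:
  an automorphism that is not affine.\<close>

lemma invariant_sets_a_nonnormal:
  assumes S: "S \<in> invariant_sets n a"
  shows "\<not> normal_circulant n (circulant n S)"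
proof
  assume normal: "normal_circulant n (circulant n S)"
  define f where "f = (\<lambda>x\<in>Zmod n. if int p dvd x then (x + P) mod int n else x)"
  have dvd_mod: "int p dvd x mod int n \<longleftrightarrow> int p dvd x" for x
    using p_dvd_n by (rule dvd_mod_iff)
  have f1: "f x = (x + P) mod int n" if "x \<in> Zmod n" "int p dvd x" for x
    using that by (simp add: f_def)
  have f2: "f x = x" if "x \<in> Zmod n" "\<not> int p dvd x" for x
    using that by (simp add: f_def)
  have f_dvd: "int p dvd f x \<longleftrightarrow> int p dvd x" if "x \<in> Zmod n" for x
    using that p_dvd_P by (cases "int p dvd x") (simp_all add: f1 f2 dvd_mod)
  have f_mem: "f x \<in> Zmod n" if "x \<in> Zmod n" for x
    using that n_pos by (simp add: f_def)
  have "inj_on f (Zmod n)"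
  proof (rule inj_onI)
    fix x y assume xy: "x \<in> Zmod n" "y \<in> Zmod n" "f x = f y"
    show "x = y"
    proof (cases "int p dvd x")
      case True
      then have "int p dvd y" using f_dvd xy by metis
      then have "(x + P) mod int n = (y + P) mod int n" using xy True by (simp add: f1)
      then have "[x = y] (mod int n)" by (simp add: mod_eq_dvd_iff cong_iff_dvd_diff)
      then show ?thesis using xy Zmod_cong_imp_eq by blast
    next
      case False
      then have "\<not> int p dvd y" using f_dvd xy by metis
      then show ?thesis using xy False by (simp add: f2)
    qed
  qed
  moreover from this have "f ` Zmod n = Zmod n" using f_mem by (intro endo_inj_surj) auto
  ultimately have bij: "f \<in> Bij (Zmod n)" by (simp add: Bij_def bij_betw_def f_def)
  have coset: "(x + P * j) mod int n \<in> S \<longleftrightarrow> x mod int n \<in> S" if x: "\<not> int p dvd x" for x j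
  proof
    assume *: "(x + P * j) mod int n \<in> S"
    have "int p dvd P * j" using p_dvd_P by simp
    then have "\<not> int p dvd x + P * j" using x by (simp add: dvd_add_left_iff)
    then have "(x + P * j + P * (- j)) mod int n \<in> S" using invariant_sets_a_coset [OF S _ *] by blast
    then show "x mod int n \<in> S" by simp
  qed (use invariant_sets_a_coset [OF S x] in blast)
  have "(f u - f v) mod int n \<in> S \<longleftrightarrow> (u - v) mod int n \<in> S" if uv: "u \<in> Zmod n" "v \<in> Zmod n" for u v
  proof -
    \<comment> \<open>Only a pair with exactly one multiple of \<open>p\<close> changes its
      difference, by \<open>P\<close> or \<open>- P\<close>; that difference is prime to
      \<open>p\<close>, where \<open>S\<close> is a union of cosets.\<close>
    consider "int p dvd u" "int p dvd v" | "\<not> int p dvd u" "\<not> int p dvd v"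
      | "int p dvd u" "\<not> int p dvd v" | "\<not> int p dvd u" "int p dvd v" by blast
    then show ?thesis
    proof cases
      case 1
      then show ?thesis using uv by (simp add: f1 mod_diff_eq)
    next
      case 2
      then show ?thesis using uv by (simp add: f2)
    next
      case 3
      then have "\<not> int p dvd u - v" by (simp add: dvd_diff_right_iff)
      from coset [OF this, of 1] show ?thesis
        using 3 uv by (simp add: f1 f2 mod_diff_left_eq algebra_simps)
    next
      case 4
      then have "\<not> int p dvd u - v" by (simp add: dvd_diff_left_iff)
      from coset [OF this, of "- 1"] show ?thesis
        using 4 uv by (simp add: f1 f2 mod_diff_right_eq algebra_simps)
    qed
  qed
  then have "f \<in> Aut (circulant n S)" using bij by (simp add: mem_Aut_circulant)
  then obtain c b where cb: "f = affine_map n c b"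
    using normal unfolding normal_circulant_iff [OF n_pos] by blast
  have "p \<le> n" using p_dvd_n n_pos by (auto dest: dvd_imp_le)
  then have mem: "0 \<in> Zmod n" "1 \<in> Zmod n" "2 \<in> Zmod n" using p_ge_3 by (simp_all add: mem_Zmod)
  have "\<not> int p dvd 1" using p_ge_3 by simp
  then have "f 0 = P mod int n" "f 1 = 1" "f 2 = 2" using mem f1 [of 0] f2 not_dvd_2 by simp_all
  then have "b mod int n = P mod int n" "(c + b) mod int n = 1" "(2 * c + b) mod int n = 2"
    using mem by (simp_all add: cb affine_map_def mult.commute)
  then have "[b = P] (mod int n)" "[c + b = 1] (mod int n)" "[2 * c + b = 2] (mod int n)"
    using mem by (simp_all add: Cong.cong_def Zmod_mod_eq)
  \<comment> \<open>The second difference at 0, 1, 2 vanishes for an affine map, but for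
    \<open>f\<close> it is \<open>P\<close>, which is nonzero modulo \<open>n\<close>.\<close>
  then have "int n dvd 2 * (c + b - 1) - (2 * c + b - 2) - (b - P)"
    unfolding cong_iff_dvd_diff by (simp only: dvd_diff dvd_mult)
  then have "int n dvd P * 1" by simp
  then show False using p_ge_3 unfolding n_dvd_P_mult by simp
qed

text \<open>On multiples of \<open>p\<close>, \<open>a\<close> acts as -1 and symmetry suffices;
  elsewhere a s = -(s + P s) combines symmetry with the passage to another element of the
  coset.\<close>

lemma NonNorG_eq: "NonNorG n = circulant n ` invariant_sets n a"
proof (intro Set.set_eqI iffI)
  fix G assume "G \<in> NonNorG n"
  then obtain S where S: "G = circulant n S" "connection_set n S" "\<not> normal_circulant n (circulant n S)"
    by (auto simp: NonNorG_def ACG_def)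
  have sub: "S \<subseteq> Zmod n - {0}" using S(2) by (simp add: connection_set_def)
  have "(a * s) mod int n \<in> S" if s: "s \<in> S" for s
  proof (cases "int p dvd s")
    case True
    then have "int n dvd P * s" unfolding n_dvd_P_mult .
    then have "(a * s) mod int n = (- s) mod int n"
      by (simp add: mod_eq_dvd_iff a_def algebra_simps)
    then show ?thesis
      using s sub connection_set_minus [OF n_pos S(2), of s] by (auto simp: Zmod_mod_eq)
  next
    case False
    have "s mod int n \<in> S" using s sub by (auto simp: Zmod_mod_eq)
    then have "(s + P * s) mod int n \<in> S"
      using nonnormal_prime_power [OF p k _ S(3) False, of s] by (simp add: n_def P_def)
    then have "(- (s + P * s)) mod int n \<in> S" using connection_set_minus [OF n_pos S(2)] by blast
    then show ?thesis by (simp add: a_def algebra_simps)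
  qed
  then show "G \<in> circulant n ` invariant_sets n a" using S(1) sub by (auto simp: invariant_sets_def)
next
  fix G assume "G \<in> circulant n ` invariant_sets n a"
  then show "G \<in> NonNorG n"
    using connection_set_a invariant_sets_a_nonnormal by (auto simp: NonNorG_def ACG_def)
qed

lemma card_NonNorG:
  "card (NonNorG n) = 2 ^ ((p ^ (k - 1) - 1) div 2 + (p ^ k - p ^ (k - 1)) div (2 * p))"
  unfolding NonNorG_eq card_invariant_sets_a [symmetric]
  by (rule card_circulant_image [OF n_pos connection_set_a])

end

section \<open>Circulant graphs that are not small\<close>

lemma prime_generator:
  assumes p: "prime p"
  shows "\<exists>g :: int. (\<forall>i. [g ^ i = 1] (mod int p) \<longleftrightarrow> (p - 1) dvd i)
    \<and> (\<forall>x. \<not> int p dvd x \<longrightarrow> (\<exists>i. [x = g ^ i] (mod int p)))"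
proof -
  have p1: "p > 1" using p prime_gt_1_nat by blast
  obtain g where g: "residue_primroot p g" using prime_primitive_root_exists [OF p1 p] by blast
  have "[int g ^ i = 1] (mod int p) \<longleftrightarrow> (p - 1) dvd i" for i
  proof -
    have "[int g ^ i = 1] (mod int p) \<longleftrightarrow> [g ^ i = 1] (mod p)"
      using cong_int_iff [of "g ^ i" 1 p] by simp
    also have "\<dots> \<longleftrightarrow> (p - 1) dvd i"
      unfolding ord_divides using g totient_prime [OF p] by (simp add: residue_primroot_def)
    finally show ?thesis .
  qed
  moreover have "\<exists>i. [x = int g ^ i] (mod int p)" if x: "\<not> int p dvd x" for x
  proof -
    define y where "y = nat (x mod int p)"
    have y: "int y = x mod int p" using p1 by (simp add: y_def)
    have "y > 0" using x y p1 by (metis dvd_eq_mod_eq_0 gr0I of_nat_0)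
    moreover have "y < p" using y p1 by (metis of_nat_0_less_iff of_nat_less_iff pos_mod_bound zero_less_one less_trans)
    ultimately have "y \<in> totatives p" using p by (simp add: totatives_prime)
    then obtain i where "y = g ^ i mod p"
      using residue_primroot_is_generator [OF p1 g] by (auto simp: bij_betw_def)
    then have "int y = int g ^ i mod int p" by (simp add: zmod_int)
    then show ?thesis using y by (auto simp: Cong.cong_def)
  qed
  ultimately show ?thesis by (intro exI [of _ "int g"]) simp
qed

lemma euler_theorem_prime_power:
  fixes x :: int
  assumes p: "prime p" and k: "k \<ge> 1" and x: "\<not> int p dvd x"
  shows "[x ^ (p ^ (k - 1) * (p - 1)) = 1] (mod int p ^ k)"
proof -
  have "p ^ k > 1" using p k prime_gt_1_nat by (intro one_less_power) auto
  moreover have "coprime x (int (p ^ k))"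
    using prime_imp_coprime [of "int p" x] p x by (simp add: coprime_commute)
  moreover have "residues (int (p ^ k))"
    using \<open>p ^ k > 1\<close> unfolding residues_def by linarith
  ultimately have "[x ^ totient (nat (int (p ^ k))) = 1] (mod int (p ^ k))"
    by (intro residues.euler_theorem)
  moreover have "totient (p ^ k) = p ^ (k - 1) * (p - 1)" using p k by (simp add: totient_prime_power)
  ultimately show ?thesis unfolding nat_int by simp
qed

lemma fermat_power:
  fixes x :: int
  assumes p: "prime p"
  shows "[x ^ (p ^ j) = x] (mod int p)"
proof (induction j)
  case (Suc j)
  have fermat: "[x ^ p = x] (mod int p)" for x :: int
  proof (cases "int p dvd x")
    case True
    moreover have "int p dvd x ^ p" using True prime_gt_0_nat [OF p] by (simp add: dvd_trans [OF _ dvd_power])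
    ultimately show ?thesis by (simp add: cong_iff_dvd_diff)
  next
    case False
    have "[x * x ^ (p - 1) = x * 1] (mod int p)"
      using euler_theorem_prime_power [OF p _ False, of 1] by (intro cong_scalar_left) simp
    then show ?thesis using prime_gt_0_nat [OF p] by (simp add: power_eq_if)
  qed
  show ?case
    using cong_trans [OF cong_pow [OF Suc, of p] fermat]
    by (simp only: power_mult [symmetric] power_Suc2)
qed simp

text \<open>A primitive root is raised to s = (p - 1)/(2r), for order 2r modulo \<open>p\<close>,
  and to p^(k-1), which removes the part of \<open>p\<close>-power order modulo p^k and by Fermat
  does not change the class modulo \<open>p\<close>.\<close>

lemma exists_unit_of_order:
  assumes p: "prime p" "odd p" and k: "k \<ge> 1" and r: "r \<ge> 1" "r dvd (p - 1) div 2"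
  shows "\<exists>b :: int. [b ^ (2 * r) = 1] (mod int p ^ k) \<and> (\<forall>i. [b ^ i = 1] (mod int p) \<longleftrightarrow> 2 * r dvd i)"
proof -
  obtain g :: int where g: "\<forall>i. [g ^ i = 1] (mod int p) \<longleftrightarrow> (p - 1) dvd i"
    using prime_generator [OF p(1)] by blast
  obtain s where s: "(p - 1) div 2 = r * s" using r(2) ..
  have "even (p - 1)" using p(2) by simp
  then have p1: "p - 1 = (2 * r) * s" using s dvd_mult_div_cancel [of 2 "p - 1"] by simp
  have s0: "s > 0" using p1 prime_gt_1_nat [OF p(1)] by (cases s) auto
  have "\<not> int p dvd g"
  proof
    assume "int p dvd g"
    also have "g dvd g ^ (p - 1)" using prime_gt_1_nat [OF p(1)] by (intro dvd_power) simp
    finally have "int p dvd g ^ (p - 1)" .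
    moreover have "[g ^ (p - 1) = 1] (mod int p)" by (simp add: g)
    ultimately have "int p dvd 1" by (simp add: cong_dvd_iff)
    then show False using prime_gt_1_nat [OF p(1)] by simp
  qed
  note euler = euler_theorem_prime_power [OF p(1) k this]
  define b where "b = g ^ (s * p ^ (k - 1))"
  have "b ^ (2 * r) = g ^ (p ^ (k - 1) * (p - 1))"
    unfolding b_def power_mult [symmetric] p1 by (simp add: mult_ac)
  then have "[b ^ (2 * r) = 1] (mod int p ^ k)" using euler by simp
  moreover have "[b ^ i = 1] (mod int p) \<longleftrightarrow> 2 * r dvd i" for i
  proof -
    have "[b = g ^ s] (mod int p)"
      unfolding b_def power_mult by (rule fermat_power [OF p(1)])
    then have "[b ^ i = g ^ (s * i)] (mod int p)" unfolding power_mult by (rule cong_pow)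
    then have "[b ^ i = 1] (mod int p) \<longleftrightarrow> (p - 1) dvd s * i" using g [rule_format, of "s * i"] by (simp add: Cong.cong_def)
    also have "p - 1 = s * (2 * r)" unfolding p1 by (rule mult.commute)
    also have "s * (2 * r) dvd s * i \<longleftrightarrow> 2 * r dvd i" using s0 by simp
    finally show ?thesis .
  qed
  ultimately show ?thesis by blast
qed

text \<open>The order is 2r modulo \<open>p\<close> as well as modulo \<open>n\<close>. So each b^i
  - 1 is 0 or a unit modulo \<open>n\<close>, and the powers of \<open>b\<close> act freely on the
  nonzero residues.\<close>

locale unit_of_order =
  fixes p k n r :: nat and b :: int
  assumes p: "prime p" "odd p" and k: "k \<ge> 1" and r: "r \<ge> 1"
    and b: "[b ^ (2 * r) = 1] (mod int p ^ k)" "\<And>i. [b ^ i = 1] (mod int p) \<longleftrightarrow> 2 * r dvd i"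
  defines "n \<equiv> p ^ k"
begin

lemma n_gt_1: "n > 1"
  unfolding n_def using p k prime_gt_1_nat by (intro one_less_power) auto

lemma p_dvd_n: "int p dvd int n"
  using k by (simp add: n_def dvd_power)

lemma coprime_n: "\<not> int p dvd x \<Longrightarrow> coprime x (int n)"
  using prime_imp_coprime [of "int p" x] p by (simp add: n_def coprime_commute)

lemma b_order: "[b ^ (2 * r) = 1] (mod int n)"
  using b(1) by (simp add: n_def)

text \<open>(b^r - 1) (b^r + 1) is 0 modulo \<open>n\<close>, and the first factor is a
  unit.\<close>

lemma b_power_minus_1: "[b ^ r = - 1] (mod int n)"
proof -
  have "\<not> [b ^ r = 1] (mod int p)" using b(2) r by (auto dest: dvd_imp_le)
  then have "coprime (b ^ r - 1) (int n)" by (intro coprime_n) (simp add: cong_iff_dvd_diff)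
  moreover have "int n dvd (b ^ r - 1) * (b ^ r + 1)"
    using b_order unfolding mult_2 power_add by (simp add: cong_iff_dvd_diff algebra_simps)
  ultimately have "int n dvd b ^ r + 1" by (simp add: coprime_dvd_mult_right_iff coprime_commute)
  then show ?thesis by (simp add: cong_iff_dvd_diff)
qed

lemma coprime_b: "coprime b (int n)"
proof -
  have "[b * b ^ (2 * r - 1) = 1] (mod int n)" using b_order r by (simp add: power_eq_if)
  then show ?thesis using coprime_iff_invertible_int by blast
qed

lemma b_power_fixes:
  assumes x: "\<not> int n dvd x"
  shows "[b ^ i * x = x] (mod int n) \<longleftrightarrow> 2 * r dvd i"
proof
  assume "2 * r dvd i"
  then obtain l where "i = (2 * r) * l" ..
  then have "[b ^ i = 1] (mod int n)" using cong_pow [OF b_order, of l] by (simp add: power_mult)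
  from cong_scalar_right [OF this, of x] show "[b ^ i * x = x] (mod int n)" by simp
next
  assume "[b ^ i * x = x] (mod int n)"
  then have *: "int n dvd (b ^ i - 1) * x" by (simp add: cong_iff_dvd_diff algebra_simps)
  show "2 * r dvd i"
  proof (rule ccontr)
    assume "\<not> 2 * r dvd i"
    then have "coprime (b ^ i - 1) (int n)"
      using b(2) by (intro coprime_n) (simp add: cong_iff_dvd_diff)
    then show False using * x by (simp add: coprime_dvd_mult_right_iff coprime_commute)
  qed
qed

lemma card_invariant_sets_b: "card (invariant_sets n b) = 2 ^ ((n - 1) div (2 * r))"
proof -
  have nz: "\<not> int n dvd x" if "x \<in> Zmod n - {0}" for x
    using that zdvd_not_zless [of x "int n"] by (auto simp: mem_Zmod)
  \<comment> \<open>All orbits have the same length 2r, so the second part is empty.\<close>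
  have "card (invariant_sets n b) = 2 ^ (card (Zmod n - {0}) div (2 * r) + card ({} :: int set) div 1)"
  proof (rule card_invariant_sets [OF _ _ b_order])
    show "(b * x) mod int n \<in> Zmod n - {0}" if "x \<in> Zmod n - {0}" for x
      using nz [OF that] coprime_b n_gt_1
      by (simp add: dvd_eq_mod_eq_0 [symmetric] coprime_dvd_mult_right_iff coprime_commute)
    show "[b ^ i * x = x] (mod int n) \<longleftrightarrow> 2 * r dvd i" if "x \<in> Zmod n - {0}" for x i
      by (rule b_power_fixes [OF nz [OF that]])
  qed (use r n_gt_1 in auto)
  then show ?thesis using n_gt_1 by (simp add: mem_Zmod)
qed

lemma connection_set_b: "S \<in> invariant_sets n b \<Longrightarrow> connection_set n S"
  using connection_set_if_invariant [OF _ _ b_power_minus_1] n_gt_1 by simp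

lemma card_not_Small_ge:
  assumes "r \<ge> 2"
  shows "2 ^ ((n - 1) div (2 * r)) \<le> card (ACG n - Small n)"
proof -
  have ne: "\<not> [b\<^sup>2 = 1] (mod int n)"
  proof
    assume "[b\<^sup>2 = 1] (mod int n)"
    then have "[b\<^sup>2 = 1] (mod int p)" using p_dvd_n by (rule cong_dvd_modulus)
    then show False using b(2) [of 2] assms by (auto dest: dvd_imp_le)
  qed
  have "\<not> [b = 1] (mod int n)" "\<not> [b = - 1] (mod int n)"
    using ne cong_pow [of b 1 "int n" 2] cong_pow [of b "- 1" "int n" 2] by auto
  then have "circulant n ` invariant_sets n b \<subseteq> ACG n - Small n"
    using multiplier_not_Small [OF n_gt_1 connection_set_b _ coprime_b] by blast
  then have "card (circulant n ` invariant_sets n b) \<le> card (ACG n - Small n)"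
    by (intro card_mono finite_Diff finite_ACG)
  then show ?thesis
    using card_circulant_image [of n "invariant_sets n b"] connection_set_b n_gt_1 card_invariant_sets_b
    by simp
qed

end

lemma card_not_Small_lower_bound:
  assumes p: "prime p" "odd p" and k: "k \<ge> 1" and r2: "r \<ge> 2" and dvd: "r dvd (p - 1) div 2"
  shows "2 ^ ((p ^ k - 1) div (2 * r)) \<le> card (ACG (p ^ k) - Small (p ^ k))"
proof -
  have r1: "r \<ge> 1" using r2 by simp
  obtain b :: int where b: "[b ^ (2 * r) = 1] (mod int p ^ k)" "\<forall>i. [b ^ i = 1] (mod int p) \<longleftrightarrow> 2 * r dvd i"
    using exists_unit_of_order [OF p k r1 dvd] by blast
  interpret unit_of_order p k "p ^ k" r b by unfold_locales (use p k r1 b in auto)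
  show ?thesis by (rule card_not_Small_ge [OF r2])
qed

section \<open>The limit\<close>

lemma full_invariant:
  assumes n: "n > 0" and a: "coprime a (int n)"
  shows "Zmod n - {0} \<in> invariant_sets n a"
proof -
  have "(a * s) mod int n \<noteq> 0" if "s \<in> Zmod n - {0}" for s
  proof
    assume "(a * s) mod int n = 0"
    then have "int n dvd s"
      using a by (simp add: dvd_eq_mod_eq_0 [symmetric] coprime_dvd_mult_right_iff coprime_commute)
    then show False using that zdvd_not_zless [of s "int n"] by (auto simp: mem_Zmod)
  qed
  then show ?thesis using n by (simp add: invariant_sets_def)
qed

lemma connection_set_full: "n > 0 \<Longrightarrow> connection_set n (Zmod n - {0})"
  using connection_set_if_invariant [OF _ full_invariant, of n "- 1" 1] by simp

text \<open>The transposition of 0 and 1 preserves the complete graph. Its second difference at 0,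
  1, 2 is 3, so it can be affine only if \<open>n\<close> divides 3.\<close>

lemma full_nonnormal:
  assumes n: "n \<ge> 5"
  shows "circulant n (Zmod n - {0}) \<in> NonNorG n"
proof -
  have n0: "n > 0" using n by simp
  define f where "f = (\<lambda>x\<in>Zmod n. if x = 0 then 1 else if x = 1 then 0 else x)"
  have mem: "0 \<in> Zmod n" "1 \<in> Zmod n" "2 \<in> Zmod n" "3 \<in> Zmod n" using n by (auto simp: mem_Zmod)
  have inj: "inj_on f (Zmod n)" by (rule inj_onI) (auto simp: f_def split: if_splits)
  have fm: "f x \<in> Zmod n" if "x \<in> Zmod n" for x using that mem by (simp add: f_def)
  then have "f ` Zmod n = Zmod n" using inj by (intro endo_inj_surj) auto
  then have bij: "f \<in> Bij (Zmod n)" using inj by (simp add: Bij_def bij_betw_def f_def)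
  have diff: "(x - y) mod int n \<in> Zmod n - {0} \<longleftrightarrow> x \<noteq> y" if "x \<in> Zmod n" "y \<in> Zmod n" for x y
  proof -
    have "(x - y) mod int n = 0 \<longleftrightarrow> x = y"
      using Zmod_cong_imp_eq [OF that] by (auto simp: cong_iff_dvd_diff dvd_eq_mod_eq_0)
    then show ?thesis using n0 by simp
  qed
  have "f \<in> Aut (circulant n (Zmod n - {0}))"
    unfolding mem_Aut_circulant using bij diff fm inj by (auto simp: inj_on_eq_iff)
  moreover have "f \<notin> {affine_map n a b | a b. True}"
  proof
    assume "f \<in> {affine_map n a b | a b. True}"
    then obtain a b where ab: "f = affine_map n a b" by blast
    have "f 0 = 1" "f 1 = 0" "f 2 = 2" using mem by (simp_all add: f_def)
    then have "b mod int n = 1 mod int n" "(a + b) mod int n = 0 mod int n" "(2 * a + b) mod int n = 2 mod int n"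
      using mem by (simp_all add: ab affine_map_def mult.commute Zmod_mod_eq)
    then have "int n dvd (2 * a + b - 2) - 2 * (a + b - 0) + (b - 1)"
      unfolding mod_eq_dvd_iff by (simp only: dvd_add dvd_diff dvd_mult)
    then have "int n dvd 3" by simp
    then show False using n zdvd_not_zless [of 3 "int n"] by simp
  qed
  ultimately have "\<not> normal_circulant n (circulant n (Zmod n - {0}))"
    unfolding normal_circulant_iff [OF n0] by blast
  then show ?thesis using connection_set_full [OF n0] by (auto simp: NonNorG_def ACG_def)
qed

lemma NonNorG_prime_subset:
  assumes "prime n"
  shows "NonNorG n \<subseteq> {circulant n {}, circulant n (Zmod n - {0})}"
  using nonnormal_prime [OF assms] by (auto simp: NonNorG_def ACG_def)

lemma nonprime_factors:
  fixes q :: nat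
  assumes "q \<ge> 2" "\<not> prime q"
  obtains r s where "q = r * s" "2 \<le> r" "r \<le> s"
proof -
  obtain m where m: "m dvd q" "m \<noteq> 1" "m \<noteq> q" using assms by (auto simp: prime_nat_iff)
  then obtain l where l: "q = m * l" by auto
  have "m \<ge> 2" "l \<ge> 2" using l m assms(1) by (cases m; cases l; auto)+
  then show ?thesis using that [of m l] that [of l m] l by (cases "m \<le> l") (auto simp: mult.commute)
qed

text \<open>The quotient is at most 2 / 2^t, and the cubic bound drives \<open>t\<close> to infinity
  with \<open>n\<close>. One cubic serves all exponents \<open>k\<close>: \<open>t\<close> grows at
  least like a square root of \<open>n\<close> for k <= 2 and like a cube root for k >= 3.\<close>

lemma regular_orders_bound:
  assumes n: "n \<in> regular_orders"
  shows "\<exists>t. card (NonNorG n) * 2 ^ t \<le> 2 * card (ACG n - Small n) \<and> n \<le> 4 * t ^ 3"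
proof -
  obtain p k where p: "prime p" "odd p" and k: "k \<ge> 1" and npk: "n = p ^ k"
    using n by (auto simp: regular_orders_def odd_prime_powers_def)
  have p3: "p \<noteq> 3" using n k npk by (auto simp: regular_orders_def safe_orders_def)
  have p5: "p \<ge> 5"
  proof -
    have "p \<noteq> 0" "p \<noteq> 1" "p \<noteq> 2" "p \<noteq> 4" using p by auto
    then show ?thesis using p3 by linarith
  qed
  define q where "q = (p - 1) div 2"
  have pq: "p = 2 * q + 1" using p(2) p5 by (auto simp: q_def elim!: oddE)
  have q2: "q \<ge> 2" using pq p5 by simp
  consider "k = 1" | "k = 2" | "k \<ge> 3" using k by linarith
  then show ?thesis
  proof cases
    case 1
    then have "\<not> safe_prime p" using n npk by (auto simp: regular_orders_def safe_orders_def)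
    then have "\<not> prime q" using p(1) pq by (auto simp: safe_prime_def)
    then obtain r s where rs: "q = r * s" "2 \<le> r" "r \<le> s" using nonprime_factors q2 by blast
    \<comment> \<open>Using the smaller factor as \<open>r\<close> leaves the exponent
      \<open>s\<close>, which is at least the square root of \<open>q\<close>.\<close>
    have "2 ^ ((n - 1) div (2 * r)) \<le> card (ACG n - Small n)"
      using card_not_Small_lower_bound [OF p k rs(2)] rs(1) by (simp add: npk q_def)
    moreover have "n - 1 = s * (2 * r)" using 1 by (simp add: npk pq rs(1))
    ultimately have "2 ^ s \<le> card (ACG n - Small n)" using rs(2) by simp
    moreover have "card (NonNorG n) \<le> 2"
    proof -
      have "card (NonNorG n) \<le> card {circulant n {}, circulant n (Zmod n - {0})}"
        using NonNorG_prime_subset [of n] p(1) 1 by (intro card_mono) (simp_all add: npk)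
      also have "\<dots> \<le> 2" by (simp add: card_insert_if)
      finally show ?thesis .
    qed
    ultimately have "card (NonNorG n) * 2 ^ s \<le> 2 * card (ACG n - Small n)"
      by (intro mult_le_mono)
    moreover have "n \<le> 4 * s ^ 3"
    proof -
      have "n = 2 * (r * s) + 1" using 1 by (simp add: npk pq rs(1))
      also have "\<dots> \<le> 2 * (s * s) + 2 * (s * s)"
        using mult_le_mono1 [OF rs(3), of s] rs by (intro add_mono) auto
      also have "\<dots> \<le> 4 * s ^ 3" using rs by (simp add: power3_eq_cube)
      finally show ?thesis .
    qed
    ultimately show ?thesis by blast
  next
    case 2
    then have "\<not> safe_prime p" using n npk by (auto simp: regular_orders_def safe_orders_def)
    then have "\<not> prime q" using p(1) pq by (auto simp: safe_prime_def)
    then obtain r s where rs: "q = r * s" "2 \<le> r" "r \<le> s" using nonprime_factors q2 by blast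
    have "2 ^ ((n - 1) div (2 * r)) \<le> card (ACG n - Small n)"
      using card_not_Small_lower_bound [OF p k rs(2)] rs(1) by (simp add: npk q_def)
    moreover have "n - 1 = (s * (p + 1)) * (2 * r)"
      using 2 by (simp add: npk pq rs(1) power2_eq_square algebra_simps)
    ultimately have low: "2 ^ (s * (p + 1)) \<le> card (ACG n - Small n)" using rs(2) by simp
    have "card (NonNorG n) = 2 ^ ((p - 1) div 2 + (p\<^sup>2 - p) div (2 * p))"
      using odd_prime_power.card_NonNorG [of p 2] p 2 by (simp add: odd_prime_power_def npk)
    moreover have "p\<^sup>2 - p = q * (2 * p)" by (simp add: pq power2_eq_square algebra_simps)
    moreover have "(p - 1) div 2 = q" by (simp add: q_def)
    ultimately have "card (NonNorG n) = 2 ^ (2 * q)" using p5 by (simp add: mult_2)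
    \<comment> \<open>\<open>p + 3\<close> is the gap between 2 q = p - 1 and the exponent 2 (p +
      1), which is available because s >= 2.\<close>
    then have "card (NonNorG n) * 2 ^ (p + 3) = 2 ^ (2 * q + (p + 3))" by (simp only: power_add)
    also have "2 * q + (p + 3) = 2 * (p + 1)" by (simp add: pq)
    finally have "card (NonNorG n) * 2 ^ (p + 3) = 2 ^ (2 * (p + 1))" .
    also have "\<dots> \<le> 2 ^ (s * (p + 1))" using rs by (intro power_increasing mult_le_mono1) auto
    also have "\<dots> \<le> 2 * card (ACG n - Small n)" using low by simp
    finally have "card (NonNorG n) * 2 ^ (p + 3) \<le> 2 * card (ACG n - Small n)" .
    moreover have "n \<le> 4 * (p + 3) ^ 3"
    proof -
      have "n \<le> (p + 3) ^ 2" using 2 by (simp add: npk power_mono)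
      also have "\<dots> \<le> (p + 3) ^ 3" by (intro power_increasing) auto
      finally show ?thesis by simp
    qed
    ultimately show ?thesis by blast
  next
    case 3
    \<comment> \<open>Here \<open>p\<close> may be safe. Taking r = q gives the exponent 1 + p + ...
      + p^(k-1), which exceeds p^(k-1) by at least p^(k-2), hence this \<open>t\<close>.\<close>
    define t where "t = p ^ (k - 2)"
    have t0: "t > 0" using p5 by (simp add: t_def)
    have pt: "p ^ (k - 1) = p * t" "p ^ k = p * (p * t)"
      using 3 unfolding t_def power_Suc [symmetric] by (simp_all add: Suc_diff_Suc numeral_2_eq_2)
    have "card (NonNorG n) = 2 ^ ((p ^ (k - 1) - 1) div 2 + (p ^ k - p ^ (k - 1)) div (2 * p))"
      using odd_prime_power.card_NonNorG [of p k] p 3 by (simp add: odd_prime_power_def npk)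
    then have "card (NonNorG n) = 2 ^ ((p * t - 1) div 2 + (p * (p * t) - p * t) div (2 * p))"
      unfolding pt .
    moreover have "(p * t - 1) div 2 + (p * (p * t) - p * t) div (2 * p) \<le> p * t"
    proof -
      have "(p * (p * t) - p * t) div (2 * p) \<le> (p * (p * t)) div (2 * p)" by (intro div_le_mono) simp
      also have "\<dots> = (p * t) div 2" using p5 by (simp add: mult.commute [of 2 p])
      finally show ?thesis by linarith
    qed
    ultimately have "card (NonNorG n) \<le> 2 ^ (p * t)" by (simp add: power_increasing)
    then have "card (NonNorG n) * 2 ^ t \<le> 2 ^ (p * t) * 2 ^ t" by (rule mult_le_mono1)
    also have "\<dots> = 2 ^ ((p + 1) * t)" by (simp add: power_add [symmetric] algebra_simps)
    also have "\<dots> \<le> 2 ^ ((n - 1) div (2 * q))"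
    proof (rule power_increasing)
      have "(p + 1) * t * (2 * q) = p * (p * t) - t"
        by (simp add: pq algebra_simps)
      also have "\<dots> \<le> n - 1" using t0 by (simp add: npk pt)
      finally show "(p + 1) * t \<le> (n - 1) div (2 * q)"
        using q2 by (simp add: less_eq_div_iff_mult_less_eq)
    qed simp
    also have "\<dots> \<le> card (ACG n - Small n)"
      using card_not_Small_lower_bound [OF p k q2] by (simp add: npk q_def)
    finally have "card (NonNorG n) * 2 ^ t \<le> 2 * card (ACG n - Small n)" by simp
    moreover have "n \<le> 4 * t ^ 3"
    proof -
      have "p ^ k \<le> p ^ ((k - 2) * 3)" using 3 p5 by (intro power_increasing) auto
      then show ?thesis by (simp add: npk t_def power_mult)
    qed
    ultimately show ?thesis by blast
  qed
qed

lemma regular_orders_limit: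
  "((\<lambda>n. real (card (NonNorG n)) / real (card (ACG n - Small n))) \<longlongrightarrow> 0)
    (inf at_top (principal regular_orders))"
proof (rule tendstoI)
  fix e :: real assume e: "e > 0"
  obtain T where T: "2 * (1 / 2) ^ T < e"
  proof -
    obtain T where "(1 / 2 :: real) ^ T < e / 2" using real_arch_pow_inv [of "e / 2" "1 / 2"] e by auto
    then show ?thesis using that [of T] by simp
  qed
  have *: "dist (real (card (NonNorG n)) / real (card (ACG n - Small n))) 0 < e"
    if n: "n > 4 * T ^ 3" "n \<in> regular_orders" for n
  proof -
    obtain t where t: "card (NonNorG n) * 2 ^ t \<le> 2 * card (ACG n - Small n)" "n \<le> 4 * t ^ 3"
      using regular_orders_bound [OF n(2)] by blast
    have "T \<le> t"
    proof (rule ccontr)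
      assume "\<not> T \<le> t"
      then have "t ^ 3 \<le> T ^ 3" by (intro power_mono) auto
      then show False using t(2) n(1) by linarith
    qed
    have "real (card (NonNorG n)) * 2 ^ t \<le> 2 * real (card (ACG n - Small n))"
      using t(1) by (metis (mono_tags) of_nat_le_iff of_nat_mult of_nat_numeral of_nat_power)
    \<comment> \<open>If the denominator is 0, the quotient is 0 by convention.\<close>
    then have "real (card (NonNorG n)) / real (card (ACG n - Small n)) \<le> 2 * (1 / 2) ^ t"
      by (cases "card (ACG n - Small n) = 0") (simp_all add: field_simps)
    also have "\<dots> \<le> 2 * (1 / 2) ^ T" using \<open>T \<le> t\<close> by (simp add: power_decreasing)
    finally show ?thesis using T by simp
  qed
  show "\<forall>\<^sub>F n in inf at_top (principal regular_orders).
      dist (real (card (NonNorG n)) / real (card (ACG n - Small n))) 0 < e"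
    unfolding eventually_inf_principal
    by (rule eventually_mono [OF eventually_gt_at_top [of "4 * T ^ 3"]]) (use * in blast)
qed

section \<open>Safe orders\<close>

text \<open>Up to sign the units modulo \<open>p\<close> form a cyclic group of prime order
  \<open>q\<close>, which every nontrivial element generates.\<close>

lemma safe_prime_generates:
  fixes a x :: int
  assumes p: "prime p" and q: "prime q" "p = 2 * q + 1"
    and a: "\<not> int p dvd a" "\<not> [a = 1] (mod int p)" "\<not> [a = - 1] (mod int p)"
    and x: "\<not> int p dvd x"
  shows "\<exists>i. [x = a ^ i] (mod int p) \<or> [x = - (a ^ i)] (mod int p)"
proof -
  obtain g :: int where g1: "\<forall>i. [g ^ i = 1] (mod int p) \<longleftrightarrow> (p - 1) dvd i"
      and g2: "\<forall>x. \<not> int p dvd x \<longrightarrow> (\<exists>i. [x = g ^ i] (mod int p))"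
    using prime_generator [OF p] by blast
  obtain s t where s: "[a = g ^ s] (mod int p)" and t: "[x = g ^ t] (mod int p)" using g2 a(1) x by blast
  \<comment> \<open>g^q is a square root of 1, so its powers contribute only signs.\<close>
  have sign: "[(g ^ q) ^ l = 1] (mod int p) \<or> [(g ^ q) ^ l = - 1] (mod int p)" for l
  proof -
    have "[g ^ (2 * (q * l)) = 1] (mod int p)" using g1 by (simp add: q(2))
    then have "int p dvd ((g ^ q) ^ l - 1) * ((g ^ q) ^ l - - 1)"
      unfolding power_mult [symmetric] mult_2 power_add by (simp add: cong_iff_dvd_diff algebra_simps)
    then show ?thesis using p by (simp add: prime_dvd_mult_iff cong_iff_dvd_diff)
  qed
  have "\<not> q dvd s"
  proof
    assume "q dvd s"
    then obtain l where "s = q * l" ..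
    then have "[a = (g ^ q) ^ l] (mod int p)" using s by (simp add: power_mult)
    then show False using sign [of l] a(2,3) by (auto dest: cong_trans)
  qed
  then have "coprime q s" by (rule prime_imp_coprime [OF q(1)])
  then have "coprime s q" by (simp only: coprime_commute)
  then obtain s' where "[s * s' = 1] (mod q)" using cong_solve_coprime_nat by (metis One_nat_def)
  then have "[s * (s' * t) = t] (mod q)" using cong_scalar_right [of "s * s'" 1 q t] by (simp add: mult.assoc)
  \<comment> \<open>Multiples of \<open>q\<close> on both sides express the congruence of exponents
    without subtraction; they turn into the signs \<open>e1\<close> and \<open>e2\<close>.\<close>
  then obtain k1 k2 where k: "t + k1 * q = s * (s' * t) + k2 * q"
    unfolding cong_iff_lin_nat by metis
  define m where "m = s' * t"
  have eq: "g ^ t * (g ^ q) ^ k1 = (g ^ s) ^ m * (g ^ q) ^ k2"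
    unfolding power_mult [symmetric] power_add [symmetric] m_def using k by (simp add: mult.commute)
  have am: "[(g ^ s) ^ m = a ^ m] (mod int p)" by (rule cong_pow [OF cong_sym [OF s]])
  obtain e1 where e1: "[(g ^ q) ^ k1 = e1] (mod int p)" "e1 = 1 \<or> e1 = - 1" using sign [of k1] by blast
  obtain e2 where e2: "[(g ^ q) ^ k2 = e2] (mod int p)" "e2 = 1 \<or> e2 = - 1" using sign [of k2] by blast
  have "[x * e1 = g ^ t * (g ^ q) ^ k1] (mod int p)" by (rule cong_mult [OF t cong_sym [OF e1(1)]])
  moreover have "[(g ^ s) ^ m * (g ^ q) ^ k2 = a ^ m * e2] (mod int p)" by (rule cong_mult [OF am e2(1)])
  ultimately have "[x * e1 = a ^ m * e2] (mod int p)" unfolding eq by (rule cong_trans)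
  then have "[(x * e1) * e1 = (a ^ m * e2) * e1] (mod int p)" by (rule cong_scalar_right)
  then have "[x = a ^ m] (mod int p) \<or> [x = - (a ^ m)] (mod int p)" using e1(2) e2(2) by auto
  then show ?thesis by blast
qed

lemma invariant_sets_uminus:
  assumes n: "n > 0" and S: "connection_set n S" "S \<in> invariant_sets n c"
  shows "S \<in> invariant_sets n (- c)"
proof -
  have "(- c * s) mod int n \<in> S" if "s \<in> S" for s
    using connection_set_minus [OF n S(1), of "c * s"] S(2) that by (simp add: invariant_sets_def)
  then show ?thesis using S(2) by (simp add: invariant_sets_def)
qed

lemma invariant_sets_of_power:
  assumes S: "S \<in> invariant_sets n c" and i: "[d = c ^ i] (mod int n)"
  shows "S \<in> invariant_sets n d"
proof -
  have sub: "S \<subseteq> Zmod n - {0}" using S by (simp add: invariant_sets_def)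
  have "(d * s) mod int n \<in> S" if s: "s \<in> S" for s
  proof -
    have "s mod int n \<in> S" using s sub by (auto simp: Zmod_mod_eq)
    then have "(c ^ i * s) mod int n \<in> S" by (rule invariant_sets_power [OF S])
    then show ?thesis using cong_scalar_right [OF i, of s] by (simp add: Cong.cong_def)
  qed
  then show ?thesis using sub by (simp add: invariant_sets_def)
qed

section \<open>Multipliers modulo p and modulo its powers\<close>

context odd_prime_power
begin

text \<open>One of c and -c is 1 modulo \<open>p\<close> but not modulo \<open>n\<close>, so 1 + P
  is among its powers, and symmetry supplies the sign of \<open>a\<close>. By
  \<open>NonNorG_eq\<close> such multipliers do not occur for normal graphs.\<close>

lemma multiplier_kernel:
  assumes S: "connection_set n S" "S \<in> invariant_sets n c"
    and c: "[c = 1] (mod int p) \<or> [c = - 1] (mod int p)"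
    "\<not> [c = 1] (mod int n)" "\<not> [c = - 1] (mod int n)"
  shows "S \<in> invariant_sets n a"
proof -
  have main: "S \<in> invariant_sets n a"
    if S': "S \<in> invariant_sets n c" and c: "[c = 1] (mod int p)" "\<not> [c = 1] (mod int n)" for c
  proof -
    have "\<not> [c = 1] (mod int p ^ k)" using c(2) by (simp add: n_def)
    then obtain m where "[c ^ m = 1 + int p ^ (k - 1) * 1] (mod int p ^ k)"
      using powers_cover_kernel [OF p k c(1)] by blast
    then have "[1 + P = c ^ m] (mod int n)" by (simp add: P_def n_def cong_sym_eq)
    then have "S \<in> invariant_sets n (1 + P)" by (rule invariant_sets_of_power [OF S'])
    then show ?thesis using invariant_sets_uminus [OF n_pos S(1)] unfolding a_def by blast
  qed
  show ?thesis
  proof (cases "[c = 1] (mod int p)")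
    case True
    then show ?thesis using main S(2) c(2) by blast
  next
    case False
    have "[- c = 1] (mod m) \<longleftrightarrow> [c = - 1] (mod m)" for m
      using cong_minus_minus_iff [of c "- 1" m] by simp
    then show ?thesis using main [OF invariant_sets_uminus [OF n_pos S]] False c by blast
  qed
qed

text \<open>The quotient of \<open>x\<close> and \<open>y\<close> is 1 modulo \<open>p\<close> and
  its order divides \<open>p - 1\<close>. A nontrivial quotient would have the power 1 + P, whose
  order \<open>p\<close> does not divide \<open>p - 1\<close>.\<close>

lemma teichmueller_unique:
  assumes x: "[x ^ (p - 1) = 1] (mod int n)" and y: "[y ^ (p - 1) = 1] (mod int n)"
    and xy: "[x = y] (mod int p)"
  shows "[x = y] (mod int n)"
proof -
  have p2: "p - 1 > 0" using p_ge_3 by simp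
  have "[y * y ^ (p - 1 - 1) = 1] (mod int n)" using y p2 by (simp add: power_eq_if)
  then obtain y' where y': "[y * y' = 1] (mod int n)" by blast
  define u where "u = x * y'"
  have "[x * y' = y * y'] (mod int p)" using xy by (rule cong_scalar_right)
  then have u1: "[u = 1] (mod int p)"
    unfolding u_def by (rule cong_trans) (rule cong_dvd_modulus [OF y' p_dvd_n])
  have "[(y * y') ^ (p - 1) = 1 ^ (p - 1)] (mod int n)" using y' by (rule cong_pow)
  then have yp: "[y' ^ (p - 1) = 1] (mod int n)"
    using cong_scalar_right [OF y, of "y' ^ (p - 1)"] by (simp add: power_mult_distrib Cong.cong_def)
  have up: "[u ^ (p - 1) = 1] (mod int n)"
    using cong_mult [OF x yp] by (simp add: u_def power_mult_distrib)
  have "[u = 1] (mod int n)"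
  proof (rule ccontr)
    assume "\<not> [u = 1] (mod int n)"
    then have "\<not> [u = 1] (mod int p ^ k)" by (simp add: n_def)
    then obtain m where "[u ^ m = 1 + int p ^ (k - 1) * 1] (mod int p ^ k)"
      using powers_cover_kernel [OF p k u1] by blast
    then have "[u ^ m = 1 + P] (mod int n)" by (simp add: P_def n_def)
    then have 1: "[(u ^ m) ^ (p - 1) = (1 + P) ^ (p - 1)] (mod int n)" by (rule cong_pow)
    have 2: "[(u ^ (p - 1)) ^ m = 1 ^ m] (mod int n)" using up by (rule cong_pow)
    have 3: "(u ^ m) ^ (p - 1) = (u ^ (p - 1)) ^ m" by (simp add: power_mult [symmetric] mult.commute)
    have "[1 = 1 + int (p - 1) * P] (mod int n)"
      using 1 2 one_plus_P_power [of "p - 1"] unfolding 3 by (simp add: Cong.cong_def)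
    then have "int n dvd P * int (p - 1)" by (simp add: cong_iff_dvd_diff mult.commute)
    then have "p dvd p - 1" unfolding n_dvd_P_mult by simp
    then show False using p2 by (auto dest: dvd_imp_le)
  qed
  then have "[u * y = 1 * y] (mod int n)" by (rule cong_scalar_right)
  moreover have "[x * (y * y') = x * 1] (mod int n)" using y' by (rule cong_scalar_left)
  ultimately show ?thesis by (simp add: u_def Cong.cong_def ac_simps)
qed

lemma normal_not_Small_cases:
  assumes G: "G \<in> ACG n - Small n" "G \<notin> NonNorG n"
  obtains S c where "G = circulant n S" "connection_set n S" "S \<in> invariant_sets n c"
    "coprime c (int n)" "\<not> [c = 1] (mod int p)" "\<not> [c = - 1] (mod int p)"
proof -
  obtain S c where S: "G = circulant n S" "connection_set n S" "S \<in> invariant_sets n c"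
      and c: "coprime c (int n)" "\<not> [c = 1] (mod int n)" "\<not> [c = - 1] (mod int n)"
    using normal_not_Small_multiplier [OF n_pos G] by blast
  have "S \<notin> invariant_sets n a" using G(2) S(1) unfolding NonNorG_eq by blast
  then have "\<not> [c = 1] (mod int p)" "\<not> [c = - 1] (mod int p)"
    using multiplier_kernel [OF S(2,3) _ c(2,3)] by blast+
  then show ?thesis using that S c(1) by blast
qed

lemma full_in_NonNorG: "circulant n (Zmod n - {0}) \<in> NonNorG n"
  unfolding NonNorG_eq by (intro imageI full_invariant n_pos coprime_n a_unit)

end

lemma fifth_if_subset:
  assumes n: "n > 0" and sub: "ACG n - Small n \<subseteq> NonNorG n" and ne: "NonNorG n \<noteq> {}"
  shows "real (card (NonNorG n \<inter> (ACG n - Small n))) > real (card (ACG n - Small n)) / 5"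
proof -
  have "NonNorG n \<subseteq> ACG n - Small n" using NonNorG_not_Small [OF n] by (auto simp: NonNorG_def)
  then have eq: "ACG n - Small n = NonNorG n" using sub by blast
  have "finite (NonNorG n)" by (rule finite_subset [OF _ finite_ACG]) (auto simp: NonNorG_def)
  then have "card (NonNorG n) > 0" using ne by (simp add: card_gt_0_iff)
  then show ?thesis unfolding eq by simp
qed

text \<open>A multiplier other than 1 and -1 is, together with -1, transitive on the nonzero
  residues. So at most the empty and the complete graph are not small; the complete one is
  non-normal, and 1 > 2/5.\<close>

lemma fifth_safe_prime:
  assumes "safe_prime n"
  shows "real (card (NonNorG n \<inter> (ACG n - Small n))) > real (card (ACG n - Small n)) / 5"
proof -
  obtain q where p: "prime n" and q: "prime q" "n = 2 * q + 1"
    using assms by (auto simp: safe_prime_def)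
  have n5: "n \<ge> 5" using q prime_ge_2_nat [of q] by simp
  have n0: "n > 0" using n5 by simp
  have sub: "ACG n - Small n \<subseteq> {circulant n {}, circulant n (Zmod n - {0})}"
  proof
    fix G assume G: "G \<in> ACG n - Small n"
    show "G \<in> {circulant n {}, circulant n (Zmod n - {0})}"
    proof (cases "G \<in> NonNorG n")
      case True
      then show ?thesis using NonNorG_prime_subset [OF p] by blast
    next
      case False
      then obtain S c where S: "G = circulant n S" "connection_set n S" "S \<in> invariant_sets n c"
          and c: "coprime c (int n)" "\<not> [c = 1] (mod int n)" "\<not> [c = - 1] (mod int n)"
        using normal_not_Small_multiplier [OF n0 G] by blast
      have sub: "S \<subseteq> Zmod n - {0}" using S(2) by (simp add: connection_set_def)
      have nz: "\<not> int n dvd z" if "z \<in> Zmod n - {0}" for z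
        using that zdvd_not_zless [of z "int n"] by (auto simp: mem_Zmod)
      have cn: "\<not> int n dvd c" using c(1) n5 coprime_common_divisor_int [of c "int n" "int n"] by auto
      have "y \<in> S" if s: "s \<in> S" and y: "y \<in> Zmod n - {0}" for s y
      proof -
        have "coprime s (int n)"
          using nz s sub prime_imp_coprime [of "int n" s] p by (auto simp: coprime_commute)
        then obtain s' where s': "[s * s' = 1] (mod int n)" using cong_solve_coprime_int by blast
        have "\<not> int n dvd y * s'"
        proof
          assume "int n dvd y * s'"
          then have "int n dvd y * s' * s - y * (s * s' - 1)"
            using s' unfolding cong_iff_dvd_diff by (simp only: dvd_diff dvd_mult dvd_mult2)
          then show False using nz [OF y] by (simp add: algebra_simps)
        qed
        then obtain i where i: "[y * s' = c ^ i] (mod int n) \<or> [y * s' = - (c ^ i)] (mod int n)"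
          using safe_prime_generates [OF p q cn c(2,3)] by blast
        have ys: "[y * s' * s = y] (mod int n)" using cong_scalar_left [OF s', of y] by (simp add: ac_simps)
        have "s mod int n \<in> S" using s sub by (auto simp: Zmod_mod_eq)
        then have *: "(c ^ i * s) mod int n \<in> S" by (rule invariant_sets_power [OF S(3)])
        then have **: "(- (c ^ i * s)) mod int n \<in> S" using connection_set_minus [OF n0 S(2)] by blast
        have "y mod int n \<in> S"
          using i
        proof
          assume "[y * s' = c ^ i] (mod int n)"
          from cong_scalar_right [OF this, of s] show ?thesis using ys * by (simp add: Cong.cong_def)
        next
          assume "[y * s' = - (c ^ i)] (mod int n)"
          from cong_scalar_right [OF this, of s] show ?thesis using ys ** by (simp add: Cong.cong_def)
        qed
        then show ?thesis using y by (simp add: Zmod_mod_eq)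
      qed
      then have "S = {} \<or> S = Zmod n - {0}" using sub by blast
      then show ?thesis using S(1) by blast
    qed
  qed
  have "card (ACG n - Small n) \<le> card {circulant n {}, circulant n (Zmod n - {0})}"
    using sub by (intro card_mono) simp_all
  also have "\<dots> \<le> 2" by (simp add: card_insert_if)
  finally have "card (ACG n - Small n) \<le> 2" .
  moreover have "circulant n (Zmod n - {0}) \<in> NonNorG n \<inter> (ACG n - Small n)"
    using full_nonnormal [OF n5] NonNorG_not_Small [OF n0] by (auto simp: NonNorG_def)
  then have "card (NonNorG n \<inter> (ACG n - Small n)) > 0"
    using finite_ACG by (auto simp: card_gt_0_iff)
  ultimately show ?thesis by linarith
qed

text \<open>Every unit modulo 3 is 1 or -1, so no multiplier is left for a normal graph that is not
  small, and the proportion is 1.\<close>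

lemma fifth_power_of_3:
  assumes "k \<ge> 2"
  shows "real (card (NonNorG (3 ^ k) \<inter> (ACG (3 ^ k) - Small (3 ^ k))))
    > real (card (ACG (3 ^ k) - Small (3 ^ k))) / 5"
proof -
  interpret odd_prime_power 3 k "3 ^ k" "int 3 ^ (k - 1)" "- (1 + int 3 ^ (k - 1))"
    by unfold_locales (use assms in auto)
  have "ACG (3 ^ k) - Small (3 ^ k) \<subseteq> NonNorG (3 ^ k)"
  proof
    fix G assume G: "G \<in> ACG (3 ^ k) - Small (3 ^ k)"
    show "G \<in> NonNorG (3 ^ k)"
    proof (rule ccontr)
      assume "G \<notin> NonNorG (3 ^ k)"
      then obtain c where c: "coprime c (int (3 ^ k))" "\<not> [c = 1] (mod int 3)" "\<not> [c = - 1] (mod int 3)"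
        using normal_not_Small_cases [OF G] by blast
      have "coprime c 3" using c(1) assms by simp
      then have "\<not> 3 dvd c" using coprime_common_divisor_int [of c 3 3] by auto
      then have "3 dvd c - 1 \<or> 3 dvd c - - 1" by presburger
      then show False using c(2,3) by (simp add: cong_iff_dvd_diff)
    qed
  qed
  then show ?thesis using fifth_if_subset n_pos full_in_NonNorG by blast
qed

text \<open>A normal graph that is not small has a multiplier other than 1 and -1 modulo
  \<open>p\<close>. Up to sign, a power of it is the fixed unit \<open>b\<close> of order 2q = p -
  1, so the family invariant under \<open>b\<close> contains all these graphs.\<close>

lemma fifth_safe_prime_squared:
  assumes "safe_prime p"
  shows "real (card (NonNorG (p ^ 2) \<inter> (ACG (p ^ 2) - Small (p ^ 2))))
    > real (card (ACG (p ^ 2) - Small (p ^ 2))) / 5"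
proof -
  obtain q where pp: "prime p" and q: "prime q" "p = 2 * q + 1"
    using assms by (auto simp: safe_prime_def)
  have podd: "odd p" using q(2) by simp
  have q2: "q \<ge> 2" using prime_ge_2_nat [OF q(1)] .
  have q1: "q \<ge> 1" using q2 by simp
  define n where "n = p ^ 2"
  define w where "w = - (1 + int p ^ (2 - 1))"
  interpret W: odd_prime_power p 2 "p ^ 2" "int p ^ (2 - 1)" w
    unfolding w_def by unfold_locales (use pp podd in auto)
  obtain b :: int where b: "[b ^ (2 * q) = 1] (mod int p ^ 2)" "\<forall>i. [b ^ i = 1] (mod int p) \<longleftrightarrow> 2 * q dvd i"
    using exists_unit_of_order [OF pp podd _ q1, of 2] q(2) by auto
  interpret B: unit_of_order p 2 "p ^ 2" q b
    by unfold_locales (use pp podd q1 b in auto)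
  let ?A = "invariant_sets n w" and ?B = "invariant_sets n b"
  have NN: "NonNorG n = circulant n ` ?A" unfolding n_def by (rule W.NonNorG_eq)
  have n0: "n > 0" using W.n_pos by (simp add: n_def)
  have sub: "ACG n - Small n \<subseteq> circulant n ` (?A \<union> ?B)"
  proof
    fix G assume G: "G \<in> ACG n - Small n"
    show "G \<in> circulant n ` (?A \<union> ?B)"
    proof (cases "G \<in> NonNorG n")
      case True
      then show ?thesis unfolding NN by blast
    next
      case False
      then obtain S c where S: "G = circulant n S" "connection_set n S" "S \<in> invariant_sets n c"
          and c: "coprime c (int n)" "\<not> [c = 1] (mod int p)" "\<not> [c = - 1] (mod int p)"
        using W.normal_not_Small_cases [of G] G unfolding n_def by blast
      \<comment> \<open>The power \<open>p\<close> removes the part of \<open>c\<close> of order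
        \<open>p\<close> and keeps its class modulo \<open>p\<close>; then d^(p - 1) = 1, so the
        powers of \<open>d\<close> are determined by their classes.\<close>
      define d where "d = c ^ p"
      have dS: "S \<in> invariant_sets n d" by (rule invariant_sets_of_power [OF S(3), of _ p]) (simp add: d_def)
      have dc: "[d = c] (mod int p)" using fermat_power [OF pp, of c 1] by (simp add: d_def)
      have pc: "\<not> int p dvd c"
        using c(1) W.p_dvd_n W.p_ge_3 coprime_common_divisor_int [of c "int n" "int p"] by (auto simp: n_def)
      have pd: "\<not> int p dvd d" using pc dc by (simp add: cong_dvd_iff)
      have d1: "\<not> [d = 1] (mod int p)" "\<not> [d = - 1] (mod int p)" using c(2,3) dc by (simp_all add: Cong.cong_def)
      have "[b ^ (2 * q) = 1] (mod int p)" using b(2) by simp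
      have pb: "\<not> int p dvd b"
      proof
        assume "int p dvd b"
        also have "b dvd b ^ (2 * q)" using q1 by (intro dvd_power) simp
        finally have "int p dvd 1" using \<open>[b ^ (2 * q) = 1] (mod int p)\<close> by (simp add: cong_dvd_iff)
        then show False using W.p_ge_3 by simp
      qed
      obtain i where i: "[b = d ^ i] (mod int p) \<or> [b = - (d ^ i)] (mod int p)"
        using safe_prime_generates [OF pp q pd d1 pb] by blast
      have bq: "[b ^ (p - 1) = 1] (mod int (p ^ 2))" using b(1) by (simp add: q(2))
      have "[c ^ (p ^ (2 - 1) * (p - 1)) = 1] (mod int p ^ 2)"
        by (rule euler_theorem_prime_power [OF pp _ pc]) simp
      then have "[d ^ (p - 1) = 1] (mod int (p ^ 2))" by (simp add: d_def power_mult)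
      from cong_pow [OF this, of i] have di: "[(d ^ i) ^ (p - 1) = 1] (mod int (p ^ 2))"
        by (simp add: power_mult [symmetric] mult.commute)
      have even: "even (p - 1)" using podd by simp
      have ndi: "[(- (d ^ i)) ^ (p - 1) = 1] (mod int (p ^ 2))"
        using di even by simp
      have "S \<in> ?B"
        using i
      proof
        assume "[b = d ^ i] (mod int p)"
        then have "[b = d ^ i] (mod int (p ^ 2))" by (rule W.teichmueller_unique [OF bq di])
        then show ?thesis using invariant_sets_of_power [OF dS] by (simp add: n_def)
      next
        assume "[b = - (d ^ i)] (mod int p)"
        then have "[b = - (d ^ i)] (mod int (p ^ 2))" by (rule W.teichmueller_unique [OF bq ndi])
        then have "[- b = d ^ i] (mod int (p ^ 2))"
          using cong_minus_minus_iff [of b "- (d ^ i)" "int (p ^ 2)"] by simp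
        then have "S \<in> invariant_sets n (- b)" using invariant_sets_of_power [OF dS] by (simp add: n_def)
        then show ?thesis using invariant_sets_uminus [OF n0 S(2), of "- b"] by simp
      qed
      then show ?thesis using S(1) by blast
    qed
  qed
  have cA: "card ?A = 2 ^ (2 * q)"
  proof -
    have "card ?A = 2 ^ ((p ^ (2 - 1) - 1) div 2 + (p ^ 2 - p ^ (2 - 1)) div (2 * p))"
      unfolding n_def by (rule W.card_invariant_sets_a)
    moreover have "p ^ 2 - p ^ (2 - 1) = q * (2 * p)" by (simp add: q(2) power2_eq_square algebra_simps)
    moreover have "p ^ (2 - 1) - 1 = q * 2" by (simp add: q(2))
    moreover have "2 * p > 0" using q(2) by simp
    ultimately show ?thesis by (simp add: mult_2)
  qed
  have cB: "card ?B = 2 ^ (2 * q + 2)"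
  proof -
    have "card ?B = 2 ^ ((p ^ 2 - 1) div (2 * q))" unfolding n_def by (rule B.card_invariant_sets_b)
    moreover have "p ^ 2 - 1 = (2 * q + 2) * (2 * q)" by (simp add: q(2) power2_eq_square algebra_simps)
    ultimately show ?thesis using q1 by simp
  qed
  \<comment> \<open>The complete graph lies in both families; this one overlap makes the bound by
    five times \<open>card ?A\<close> strict.\<close>
  have "Zmod n - {0} \<in> ?A \<inter> ?B"
    using full_invariant [OF n0] W.coprime_n [OF W.a_unit] B.coprime_b by (simp add: n_def)
  then have "card (?A \<inter> ?B) > 0" using finite_invariant_sets by (auto simp: card_gt_0_iff)
  moreover have "card ?A + card ?B = card (?A \<union> ?B) + card (?A \<inter> ?B)"
    by (rule card_Un_Int [OF finite_invariant_sets finite_invariant_sets])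
  ultimately have "card (?A \<union> ?B) < 5 * 2 ^ (2 * q)" using cA cB by (simp add: power_add)
  moreover have "card (ACG n - Small n) \<le> card (?A \<union> ?B)"
  proof -
    have "card (ACG n - Small n) \<le> card (circulant n ` (?A \<union> ?B))"
      using sub finite_invariant_sets by (intro card_mono) auto
    also have "\<dots> \<le> card (?A \<union> ?B)" by (intro card_image_le) (simp add: finite_invariant_sets)
    finally show ?thesis .
  qed
  moreover have "card (NonNorG n) = card ?A"
    unfolding NN by (rule card_circulant_image [OF n0]) (use W.connection_set_a in \<open>simp add: n_def\<close>)
  ultimately have "card (ACG n - Small n) < 5 * card (NonNorG n)" unfolding cA by linarith
  moreover have "NonNorG n \<inter> (ACG n - Small n) = NonNorG n"
    using NonNorG_not_Small [OF n0] by (auto simp: NonNorG_def)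
  ultimately show ?thesis unfolding n_def [symmetric] by simp
qed

theorem theorem3p5:
  shows "((\<lambda>n. real (card (NonNorG n)) / real (card (ACG n - Small n))) \<longlongrightarrow> 0)
           (inf at_top (principal regular_orders))
       \<and> (\<forall>n \<in> safe_orders. n \<noteq> 3 \<longrightarrow>
            real (card (NonNorG n \<inter> (ACG n - Small n))) > real (card (ACG n - Small n)) / 5)"
proof (intro conjI ballI impI)
  fix n assume n: "n \<in> safe_orders" "n \<noteq> 3"
  then consider "safe_prime n" | p where "safe_prime p" "n = p ^ 2" | k where "k \<ge> 1" "n = 3 ^ k"
    by (auto simp: safe_orders_def)
  then show "real (card (NonNorG n \<inter> (ACG n - Small n))) > real (card (ACG n - Small n)) / 5"
  proof cases
    case 3
    \<comment> \<open>The exponent 1 gives only the degenerate order 3.\<close>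
    then have "k \<ge> 2" using n(2) by (cases "k = 1") auto
    then show ?thesis using fifth_power_of_3 3 by simp
  qed (use fifth_safe_prime fifth_safe_prime_squared in auto)
qed (rule regular_orders_limit)

end
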